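(* Let $V$ be a finite dimensional real vector space with lattice $\Lambda$. If $m(\lambda,k)\in\mathcal{S}(\Lambda)$, then the sequence of distributions $\Theta(m)(k)$, $k\ge1$, on $V$, defined by $$\langle\Theta(m)(k),\varphi\rangle=\sum_{\lambda\in\Lambda}m(\lambda,k)\varphi(\lambda/k),$$ admits an asymptotic expansion (with coefficients periodic in $k$) when $k\to\infty$.
   Context: Test functions $\varphi$ are smooth with compact support on $V$. A function on a lattice $L$ is periodic if it is invariant under translation by $DL$ for some positive integer $D$. Quasi-polynomial functions on $L$ are the elements of the algebra of functions on $L$ generated by polynomials and periodic functions. For a rational polyhedron $P\subset V$ (possibly with empty interior), let $C_P=\{(t\xi,t):t\ge0,\ \xi\in P\}\subset V\oplus\mathbb{R}$ and let $[C_P]$ be its characteristic function. For $q$ a quasi-polynomial function on $\Lambda\oplus\mathbb{Z}$, $q[C_P]$ is the function on $\Lambda\oplus\mathbb{Z}$ equal to $q(\lambda,k)$ if $(\lambda,k)\in C_P$ and to $0$ otherwise. $\mathcal{S}(\Lambda)$ is the space of functions on $\Lambda\oplus\mathbb{Z}$ linearly generated by all such functions $q[C_P]$. A family $\theta(k)$ of distributions is periodic in $k\in\mathbb{Z}$ if there is a positive integer $D$ with $\langle\theta(k_0+Dk),\varphi\rangle=\langle\theta(k_0),\varphi\rangle$ for all integers $k_0,k$ and all test functions $\varphi$. A sequence $(\Theta(k))_{k\ge1}$ of distributions admits an asymptotic expansion (with periodic coefficients) if there exist $n_0\in\mathbb{Z}$ and distributions $\theta_n(k)$, $n\ge0$,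 each periodic in $k$, such that for every test function $\varphi$ and every integer $N\ge0$, $$\langle\Theta(k),\varphi\rangle=k^{n_0}\sum_{n=0}^N\frac{1}{k^n}\langle\theta_n(k),\varphi\rangle+o(k^{n_0-N})\quad(k\to\infty).$$ *)

theory Defs
  imports "HOL-Analysis.Analysis" "HOL-Library.Landau_Symbols"
begin

section \<open>Lattices, quasi-polynomials and polyhedra\<close>

text \<open>A lattice of full rank; the existence of a finite basis \<open>B\<close> also forces the ambient
  space to be finite dimensional. The norm of the ambient space plays no role beyond fixing its
  topology, and the zero space is allowed.\<close>

definition full_lattice :: "'a::real_normed_vector set \<Rightarrow> bool" where
  "full_lattice L \<longleftrightarrow>
     (\<exists>B. finite B \<and> independent B \<and> span B = UNIV \<and>
          L = {\<Sum>b\<in>B. of_int (c b) *\<^sub>R b | c :: 'a \<Rightarrow> int. True})"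

text \<open>A function on \<open>L\<close> is represented by a function on the ambient space; in the next two
  definitions its values off \<open>L\<close> are irrelevant.\<close>

definition lattice_periodic :: "'a::real_normed_vector set \<Rightarrow> ('a \<Rightarrow> complex) \<Rightarrow> bool" where
  "lattice_periodic L f \<longleftrightarrow>
     (\<exists>D::nat. D > 0 \<and> (\<forall>x\<in>L. \<forall>y\<in>L. f (x + of_nat D *\<^sub>R y) = f x))"

inductive_set quasi_polynomials :: "'a::real_normed_vector set \<Rightarrow> ('a \<Rightarrow> complex) set"
  for L :: "'a set" where
  poly: "polynomial_function p \<Longrightarrow> p \<in> quasi_polynomials L"
| periodic: "lattice_periodic L f \<Longrightarrow> f \<in> quasi_polynomials L"
| add: "f \<in> quasi_polynomials L \<Longrightarrow> g \<in> quasi_polynomials L \<Longrightarrow>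
         (\<lambda>x. f x + g x) \<in> quasi_polynomials L"
| mult: "f \<in> quasi_polynomials L \<Longrightarrow> g \<in> quasi_polynomials L \<Longrightarrow>
          (\<lambda>x. f x * g x) \<in> quasi_polynomials L"

text \<open>Rationality is with respect to \<open>L\<close>: finitely many inequalities \<open>f x \<le> b\<close> with \<open>b\<close> rational
  and \<open>f\<close> a linear form taking rational values on \<open>L\<close>.\<close>

definition rational_polyhedron :: "'a::real_normed_vector set \<Rightarrow> 'a set \<Rightarrow> bool" where
  "rational_polyhedron L P \<longleftrightarrow>
     (\<exists>H :: (('a \<Rightarrow> real) \<times> real) set. finite H \<and>
          (\<forall>(f, b)\<in>H. linear f \<and> f ` L \<subseteq> \<rat> \<and> b \<in> \<rat>) \<and>
          P = {x. \<forall>(f, b)\<in>H. f x \<le> b})"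

definition cone_over :: "'a::real_normed_vector set \<Rightarrow> ('a \<times> real) set" where
  "cone_over P = {(t *\<^sub>R \<xi>, t) | t \<xi>. t \<ge> 0 \<and> \<xi> \<in> P}"

text \<open>The lattice \<open>\<Lambda> \<oplus> \<int>\<close> is the subset \<open>L \<times> \<int>\<close> of \<open>'a \<times> real\<close>. Functions on it are extended by
  zero to all of \<open>'a \<times> real\<close>.\<close>

definition cone_function ::
    "'a::real_normed_vector set \<Rightarrow> 'a set \<Rightarrow> ('a \<times> real \<Rightarrow> complex) \<Rightarrow> 'a \<times> real \<Rightarrow> complex" where
  "cone_function L P q = (\<lambda>z. if z \<in> L \<times> \<int> \<and> z \<in> cone_over P then q z else 0)"

inductive_set S_space :: "'a::real_normed_vector set \<Rightarrow> ('a \<times> real \<Rightarrow> complex) set"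
  for L :: "'a set" where
  gen: "rational_polyhedron L P \<Longrightarrow> q \<in> quasi_polynomials (L \<times> \<int>) \<Longrightarrow>
         cone_function L P q \<in> S_space L"
| add: "f \<in> S_space L \<Longrightarrow> g \<in> S_space L \<Longrightarrow> (\<lambda>z. f z + g z) \<in> S_space L"
| scale: "f \<in> S_space L \<Longrightarrow> (\<lambda>z. c * f z) \<in> S_space L"


section \<open>Test functions and distributions\<close>

primrec C_k :: "nat \<Rightarrow> ('a::real_normed_vector \<Rightarrow> complex) \<Rightarrow> bool" where
  "C_k 0 f \<longleftrightarrow> continuous_on UNIV f"
| "C_k (Suc n) f \<longleftrightarrow>
     (\<forall>x. f differentiable at x) \<and> (\<forall>v. C_k n (\<lambda>x. frechet_derivative f (at x) v))"

definition smooth :: "('a::real_normed_vector \<Rightarrow> complex) \<Rightarrow> bool" where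
  "smooth f \<longleftrightarrow> (\<forall>n. C_k n f)"

definition supp :: "('a::real_normed_vector \<Rightarrow> complex) \<Rightarrow> 'a set" where
  "supp f = closure {x. f x \<noteq> 0}"

definition test_functions :: "('a::real_normed_vector \<Rightarrow> complex) set" where
  "test_functions = {\<phi>. smooth \<phi> \<and> compact (supp \<phi>)}"

text \<open>Iterated directional derivatives along a list of vectors.\<close>

primrec dir_derivs ::
    "'a::real_normed_vector list \<Rightarrow> ('a \<Rightarrow> complex) \<Rightarrow> 'a \<Rightarrow> complex" where
  "dir_derivs [] f = f"
| "dir_derivs (v # vs) f = (\<lambda>x. frechet_derivative (dir_derivs vs f) (at x) v)"

text \<open>Distributions are complex linear functionals on test functions; only their values on test
  functions matter. Continuity: on test functions supported in a fixed compact set, the functional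
  is dominated by finitely many of the seminorms \<open>sup |\<partial>\<^sub>v\<^sub>1 \<dots> \<partial>\<^sub>v\<^sub>r \<phi>|\<close>.\<close>

definition distribution :: "(('a::real_normed_vector \<Rightarrow> complex) \<Rightarrow> complex) \<Rightarrow> bool" where
  "distribution T \<longleftrightarrow>
     (\<forall>\<phi>\<in>test_functions. \<forall>\<psi>\<in>test_functions. T (\<lambda>x. \<phi> x + \<psi> x) = T \<phi> + T \<psi>) \<and>
     (\<forall>\<phi>\<in>test_functions. \<forall>c. T (\<lambda>x. c * \<phi> x) = c * T \<phi>) \<and>
     (\<forall>K. compact K \<longrightarrow>
        (\<exists>C F. finite F \<and>
           (\<forall>\<phi>\<in>test_functions. supp \<phi> \<subseteq> K \<longrightarrow>
              norm (T \<phi>) \<le> C * (\<Sum>vs\<in>F. SUP x. norm (dir_derivs vs \<phi> x)))))"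


section \<open>Asymptotic expansions\<close>

definition periodic_family ::
    "(int \<Rightarrow> ('a::real_normed_vector \<Rightarrow> complex) \<Rightarrow> complex) \<Rightarrow> bool" where
  "periodic_family \<theta> \<longleftrightarrow>
     (\<exists>D::int. D > 0 \<and>
        (\<forall>k\<^sub>0 k. \<forall>\<phi>\<in>test_functions. \<theta> (k\<^sub>0 + D * k) \<phi> = \<theta> k\<^sub>0 \<phi>))"

definition admits_asymptotic_expansion ::
    "(nat \<Rightarrow> ('a::real_normed_vector \<Rightarrow> complex) \<Rightarrow> complex) \<Rightarrow> bool" where
  "admits_asymptotic_expansion \<Theta> \<longleftrightarrow>
     (\<exists>(n\<^sub>0::int) (\<theta> :: nat \<Rightarrow> int \<Rightarrow> ('a \<Rightarrow> complex) \<Rightarrow> complex).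
        (\<forall>n k. distribution (\<theta> n k)) \<and>
        (\<forall>n. periodic_family (\<theta> n)) \<and>
        (\<forall>\<phi>\<in>test_functions. \<forall>N::nat.
           (\<lambda>k. \<Theta> k \<phi> - of_nat k powi n\<^sub>0 * (\<Sum>n\<le>N. 1 / of_nat k ^ n * \<theta> n (int k) \<phi>))
             \<in> o[sequentially](\<lambda>k. of_nat k powi (n\<^sub>0 - int N))))"

text \<open>For a test function \<open>\<phi>\<close> and \<open>k \<ge> 1\<close> the sum has only finitely many nonzero terms.\<close>

definition Theta ::
    "'a::real_normed_vector set \<Rightarrow> ('a \<times> real \<Rightarrow> complex) \<Rightarrow> nat \<Rightarrow> ('a \<Rightarrow> complex) \<Rightarrow> complex" where
  "Theta L m k \<phi> = (\<Sum>\<^sub>\<infinity>x\<in>L. m (x, of_nat k) * \<phi> (x /\<^sub>R of_nat k))"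

end

theory Submission
  imports Defs
begin

text \<open>The sum over \<open>\<Lambda>\<close> is evaluated one lattice coordinate at a time. Polynomial factors are absorbed
  into the test function and powers of \<open>k\<close>, so the weight may be taken to be a periodic function
  times the indicator of finitely many rational inequalities, and these can be rearranged so that
  at most one of them involves the coordinate being eliminated. One-sided Euler--Maclaurin
  summation in that coordinate then gives, up to \<open>O(k\<^sup>-\<^sup>N)\<close>, the values at the boundary
  hyperplane of a primitive of the test function and of its derivatives. Their coefficients depend
  periodically on the remaining lattice coordinates and on \<open>k\<close>, and the boundary values are again
  smooth with bounded support, so induction on the dimension applies. All bounds are uniform in
  finitely many derivatives of the test function, which makes the coefficients distributions.\<close>

section \<open>One-sided Euler--Maclaurin summation\<close>

text \<open>On a lattice line with parameter \<open>j\<close>, one inequality says that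
  \<open>j\<close> is at least the ceiling of an affine function \<open>u\<close> of the other
  coordinates and \<open>k\<close>. Several bounds on the same side would start the sum at a maximum
  of ceilings, which is neither smooth nor periodic in the remaining variables. With a single bound
  the boundary value is an affine substitution, and the rounding error, ceiling of \<open>u\<close>
  minus \<open>u\<close>, is periodic because \<open>u\<close> takes rational values with a common
  denominator. These rounding errors enter through Bernoulli polynomials, so periodic weights in the
  lattice point and \<open>k\<close> arise even from a constant weight; this is the source of the
  periodicity of the coefficients. A weight of period \<open>D\<close> is summed over each residue
  class modulo \<open>D\<close> separately.

  The primitive need not vanish far out against the direction of integration, and its boundary
  values, extended from the hyperplane by projection, are constant along the eliminated coordinate.
  The function classes therefore bound the support only in the coordinates still to be
  summed.\<close>

lemma Taylor_remainder_bound: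
  fixes g :: "nat \<Rightarrow> real \<Rightarrow> 'b::banach"
  assumes g: "\<And>n t. (g n has_vector_derivative g (Suc n) t) (at t)"
    and M: "\<And>t. norm (g (r + n) t) \<le> M" and \<delta>: "\<delta> \<ge> 0"
  shows "norm (g r (t + \<delta>) - (\<Sum>i<n. (\<delta> ^ i / fact i) *\<^sub>R g (r + i) t)) \<le> M * \<delta> ^ n"
proof (cases n)
  case 0
  then show ?thesis using M[of "t + \<delta>"] by simp
next
  case (Suc p)
  have M0: "M \<ge> 0" using norm_ge_zero[of "g (r + n) t"] M[of t] by linarith
  let ?i = "\<lambda>x. ((t + \<delta> - x) ^ (n - 1) / fact (n - 1)) *\<^sub>R g (r + n) x"
  have *: "(?i has_integral g r (t + \<delta>) - (\<Sum>i<n. ((t + \<delta> - t) ^ i / fact i) *\<^sub>R g (r + i) t)) {t..t + \<delta>}"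
  proof (rule Taylor_has_integral[where Df = "\<lambda>m. g (r + m)"])
    show "((\<lambda>a. g (r + m) a) has_vector_derivative g (r + Suc m) s) (at s within {t..t + \<delta>})" for m s
      using g[of "r + m" s] by (simp add: has_vector_derivative_at_within)
  qed (use \<delta> Suc in auto)
  have "norm (g r (t + \<delta>) - (\<Sum>i<n. ((t + \<delta> - t) ^ i / fact i) *\<^sub>R g (r + i) t))
      \<le> (M * \<delta> ^ p) * Henstock_Kurzweil_Integration.content (cbox t (t + \<delta>))"
  proof (rule has_integral_bound[OF _ *[folded box_real(2)]])
    show "M * \<delta> ^ p \<ge> 0" using M0 \<delta> by simp
    fix x assume x: "x \<in> cbox t (t + \<delta>)"
    then have "(t + \<delta> - x) ^ p \<le> \<delta> ^ p" by (intro power_mono) auto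
    moreover have "(t + \<delta> - x) ^ p / fact p \<le> (t + \<delta> - x) ^ p"
      using x by (simp add: divide_le_eq mult_le_cancel_left1 fact_ge_1)
    moreover have "0 \<le> (t + \<delta> - x) ^ p / fact p" using x by simp
    ultimately have "\<bar>(t + \<delta> - x) ^ p / fact p\<bar> * norm (g (r + n) x) \<le> \<delta> ^ p * M"
      using M[of x] by (intro mult_mono) auto
    then show "norm (?i x) \<le> M * \<delta> ^ p" using Suc by (simp add: mult.commute)
  qed
  also have "\<dots> = M * \<delta> ^ n" using Suc \<delta> by simp
  finally show ?thesis by simp
qed

text \<open>The numbers \<open>B\<^sub>n / n!\<close>, i.e. the coefficients of \<open>z / (e\<^sup>z - 1)\<close>.\<close>

fun bern :: "nat \<Rightarrow> real" where
  "bern n = (if n = 0 then 1 else - (\<Sum>i<n. bern i / fact (Suc n - i)))"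

declare bern.simps [simp del]

text \<open>This is the m-th Bernoulli polynomial divided by m!, the coefficient of z^m in z e^(x z)
  / (e^z - 1).\<close>

definition bern_poly :: "nat \<Rightarrow> real \<Rightarrow> real" where
  "bern_poly m x = (\<Sum>i\<le>m. bern i * (x ^ (m - i) / fact (m - i)))"

text \<open>z e^z / (e^z - 1) = z / (e^z - 1) + z, so only the coefficient of z changes. This extra
  term is what makes the Euler-Maclaurin sum telescope.\<close>

lemma bern_poly_1: "bern_poly m 1 = bern m + (if m = 1 then 1 else 0)"
proof (cases m)
  case 0 then show ?thesis by (simp add: bern_poly_def)
next
  case (Suc n)
  have "(\<Sum>i\<le>n. bern i / fact (Suc n - i)) = (if n = 0 then 1 else 0)"
  proof (cases n)
    case (Suc p)
    have "(\<Sum>i\<le>n. bern i / fact (Suc n - i)) = (\<Sum>i<n. bern i / fact (Suc n - i)) + bern n"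
      by (simp add: Suc lessThan_Suc_atMost[symmetric])
    also have "bern n = - (\<Sum>i<n. bern i / fact (Suc n - i))"
      using Suc by (subst bern.simps) simp
    finally show ?thesis using Suc by simp
  qed (simp add: bern.simps)
  moreover have "bern_poly m 1 = (\<Sum>i\<le>n. bern i / fact (Suc n - i)) + bern m"
    by (simp add: bern_poly_def Suc)
  ultimately show ?thesis using Suc by auto
qed

text \<open>Taylor expansion of \<open>g r\<close> to order \<open>Suc N - r\<close> turns the left
  sum into the truncated product of the series z / (e^z - 1) and e^(y z), with z standing for
  \<open>h\<close> times differentiation. The coefficients of that product are
  \<open>bern_poly m y\<close>, and every Taylor remainder, with its factor \<open>h ^ r\<close>,
  has order \<open>h ^ Suc N\<close>.\<close>

lemma bern_expansion:
  fixes g :: "nat \<Rightarrow> real \<Rightarrow> complex"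
  assumes g: "\<And>n t. (g n has_vector_derivative g (Suc n) t) (at t)"
    and M: "\<And>t. norm (g (Suc N) t) \<le> M" and h: "h \<ge> 0" and y: "0 \<le> y" "y \<le> 1"
  shows "norm ((\<Sum>r\<le>N. (bern r * h ^ r) *\<^sub>R g r (t + y * h))
      - (\<Sum>m\<le>N. (bern_poly m y * h ^ m) *\<^sub>R g m t)) \<le> (\<Sum>r\<le>N. \<bar>bern r\<bar>) * M * h ^ Suc N"
proof -
  have M0: "M \<ge> 0" using norm_ge_zero[of "g (Suc N) t"] M[of t] by linarith
  let ?T = "\<lambda>r. (\<Sum>i<Suc N - r. ((y * h) ^ i / fact i) *\<^sub>R g (r + i) t)"
  have tay: "norm (g r (t + y * h) - ?T r) \<le> M * (y * h) ^ (Suc N - r)" if "r \<le> N" for r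
    by (rule Taylor_remainder_bound) (use g M h y that in auto)
  have "(\<Sum>m\<le>N. (bern_poly m y * h ^ m) *\<^sub>R g m t)
      = (\<Sum>m\<le>N. \<Sum>r\<le>m. (bern r * h ^ r) *\<^sub>R (((y * h) ^ (m - r) / fact (m - r)) *\<^sub>R g (r + (m - r)) t))"
  proof (rule sum.cong[OF refl])
    fix m
    have "h ^ m = h ^ r * h ^ (m - r)" if "r \<le> m" for r
      using that by (simp flip: power_add)
    then show "(bern_poly m y * h ^ m) *\<^sub>R g m t
      = (\<Sum>r\<le>m. (bern r * h ^ r) *\<^sub>R (((y * h) ^ (m - r) / fact (m - r)) *\<^sub>R g (r + (m - r)) t))"
      by (auto simp: bern_poly_def scaleR_sum_left sum_distrib_right power_mult_distrib intro!: sum.cong)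
  qed
  also have "\<dots> = (\<Sum>(r,i)\<in>{(r,i). r + i \<le> N}. (bern r * h ^ r) *\<^sub>R (((y * h) ^ i / fact i) *\<^sub>R g (r + i) t))"
    by (rule sum.triangle_reindex_eq[symmetric])
  also have "{(r,i). r + i \<le> N} = Sigma {..N} (\<lambda>r. {..<Suc N - r})"
    by auto
  also have "(\<Sum>(r,i)\<in>Sigma {..N} (\<lambda>r. {..<Suc N - r}). (bern r * h ^ r) *\<^sub>R (((y * h) ^ i / fact i) *\<^sub>R g (r + i) t))
      = (\<Sum>r\<le>N. (bern r * h ^ r) *\<^sub>R ?T r)"
    by (subst sum.Sigma[symmetric]) (auto simp: scaleR_sum_right)
  finally have eq: "(\<Sum>r\<le>N. (bern r * h ^ r) *\<^sub>R g r (t + y * h))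
      - (\<Sum>m\<le>N. (bern_poly m y * h ^ m) *\<^sub>R g m t)
      = (\<Sum>r\<le>N. (bern r * h ^ r) *\<^sub>R (g r (t + y * h) - ?T r))"
    by (simp add: sum_subtractf scaleR_diff_right)
  have "norm \<dots> \<le> (\<Sum>r\<le>N. \<bar>bern r\<bar> * M * h ^ Suc N)"
  proof (rule sum_norm_le)
    fix r assume r: "r \<in> {..N}"
    have "norm ((bern r * h ^ r) *\<^sub>R (g r (t + y * h) - ?T r)) \<le> \<bar>bern r\<bar> * h ^ r * (M * (y * h) ^ (Suc N - r))"
      using tay[of r] r h by (auto simp: abs_mult intro!: mult_left_mono)
    also have "\<dots> \<le> \<bar>bern r\<bar> * h ^ r * (M * h ^ (Suc N - r))"
      using h y M0 by (intro mult_left_mono power_mono) (auto simp: mult_left_le_one_le)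
    also have "\<dots> = \<bar>bern r\<bar> * M * h ^ (r + (Suc N - r))"
      by (simp only: power_add mult_ac)
    finally show "norm ((bern r * h ^ r) *\<^sub>R (g r (t + y * h) - ?T r)) \<le> \<bar>bern r\<bar> * M * h ^ Suc N"
      using r by simp
  qed
  then show ?thesis unfolding eq by (simp add: sum_distrib_right)
qed

lemma card_nat_between:
  fixes A L :: real
  assumes "L \<ge> 0"
  shows "real (card {i::nat. A < real i \<and> real i < A + L}) \<le> L + 1"
proof (cases "{i::nat. A < real i \<and> real i < A + L} = {}")
  case False
  let ?S = "{i::nat. A < real i \<and> real i < A + L}"
  have fin: "finite ?S"
    by (rule finite_subset[of _ "{..nat \<lceil>A + L\<rceil>}"]) (auto, linarith)
  have "?S \<subseteq> {Min ?S..Max ?S}" using fin by auto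
  then have "card ?S \<le> Suc (Max ?S) - Min ?S" using card_mono[of "{Min ?S..Max ?S}" ?S] by simp
  moreover have "Min ?S \<in> ?S" "Max ?S \<in> ?S" using fin False Min_in Max_in by blast+
  moreover have "Min ?S \<le> Max ?S" using fin False by (meson Max_in Min_le)
  ultimately show ?thesis by auto
qed (use assms in \<open>simp only: card.empty; simp\<close>)

text \<open>The function summed is \<open>g 1\<close>, and \<open>g 0\<close> is its primitive
  vanishing to the right of \<open>b\<close>. If \<open>G\<close> is the sum of the terms
  \<open>bern r * h ^ r * g r\<close>, then \<open>G (s + h) - G s\<close> equals
  \<open>h * g 1 s\<close> up to order \<open>h ^ Suc N\<close>. The sum over the progression thus
  telescopes to \<open>- G (t + x * h)\<close>, which \<open>bern_expansion\<close> rewrites at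
  \<open>t\<close>. Steps that avoid the interval from \<open>a\<close> to \<open>b\<close> cause no
  error, so the number of errors is of order \<open>(b - a) / h\<close>, up to a constant, whatever
  \<open>I\<close> is.\<close>

lemma Euler_Maclaurin_one_sided:
  fixes N :: nat
  obtains C where "C \<ge> 0" and
    "\<And>g :: nat \<Rightarrow> real \<Rightarrow> complex. \<And>M a b h x I t.
      (\<And>n t. (g n has_vector_derivative g (Suc n) t) (at t)) \<Longrightarrow>
      (\<And>t. norm (g (Suc N) t) \<le> M) \<Longrightarrow>
      (\<And>n t. t \<ge> b \<Longrightarrow> g n t = 0) \<Longrightarrow> (\<And>n t. t \<le> a \<Longrightarrow> g (Suc n) t = 0) \<Longrightarrow>
      h > 0 \<Longrightarrow> a \<le> b \<Longrightarrow> 0 \<le> x \<Longrightarrow> x \<le> 1 \<Longrightarrow> t + (x + real I) * h \<ge> b \<Longrightarrow>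
      norm (h *\<^sub>R (\<Sum>i<I. g 1 (t + (x + real i) * h)) + (\<Sum>m\<le>N. (bern_poly m x * h ^ m) *\<^sub>R g m t))
        \<le> C * M * h ^ N * (b - a + 3 * h)"
proof -
  \<comment> \<open>The summand 1 pays for the case \<open>N = 0\<close>, in which the term
    \<open>h * g 1\<close> lies beyond the truncation and is itself of the size of the
    error.\<close>
  define K where "K = (\<Sum>r\<le>N. \<bar>bern r\<bar>) + 1"
  have K1: "K \<ge> 1" by (simp add: K_def sum_nonneg)
  show thesis
  proof (rule that[of K])
    show "K \<ge> 0" using K1 by simp
    fix g :: "nat \<Rightarrow> real \<Rightarrow> complex" and M a b h x :: real and I :: nat and t :: real
    assume g: "\<And>n t. (g n has_vector_derivative g (Suc n) t) (at t)"
      and M: "\<And>t. norm (g (Suc N) t) \<le> M"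
      and gb: "\<And>n t. t \<ge> b \<Longrightarrow> g n t = 0" and ga: "\<And>n t. t \<le> a \<Longrightarrow> g (Suc n) t = 0"
      and h: "h > 0" and ab: "a \<le> b" and x: "0 \<le> x" "x \<le> 1" and I: "t + (x + real I) * h \<ge> b"
    have M0: "M \<ge> 0" using norm_ge_zero[of "g (Suc N) t"] M[of t] by linarith
    define G where "G t = (\<Sum>r\<le>N. (bern r * h ^ r) *\<^sub>R g r t)" for t
    define s where "s i = t + (x + real i) * h" for i :: nat
    define E where "E i = G (s (Suc i)) - G (s i) - h *\<^sub>R g 1 (s i)" for i
    have sS: "s (Suc i) = s i + 1 * h" for i by (simp add: s_def algebra_simps)
    have e1: "norm (G (u + y * h) - (\<Sum>m\<le>N. (bern_poly m y * h ^ m) *\<^sub>R g m u)) \<le> (K - 1) * M * h ^ Suc N"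
      if "0 \<le> y" "y \<le> 1" for y u
      unfolding G_def K_def using bern_expansion[of g N M h y u] g M h that by simp
    have Ebound: "norm (E i) \<le> K * M * h ^ Suc N" for i
    proof (cases N)
      case 0
      have "norm (G (s i + 1 * h) - G (s i)) \<le> (K - 1) * M * h ^ Suc N"
        using e1[of 1 "s i"] by (simp add: 0 G_def bern_poly_def)
      moreover have "norm (h *\<^sub>R g 1 (s i)) \<le> M * h ^ Suc N"
        using M[of "s i"] h by (simp add: 0 mult.commute)
      ultimately have "norm (E i) \<le> (K - 1) * M * h ^ Suc N + M * h ^ Suc N"
        unfolding E_def sS by (meson norm_triangle_ineq4 add_mono order_trans)
      then show ?thesis by (simp add: algebra_simps)
    next
      case (Suc n)
      have "(\<Sum>m\<le>N. (bern_poly m 1 * h ^ m) *\<^sub>R g m (s i))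
          = (\<Sum>m\<le>N. (bern m * h ^ m) *\<^sub>R g m (s i) + (if m = 1 then h *\<^sub>R g 1 (s i) else 0))"
        by (rule sum.cong) (auto simp: bern_poly_1 scaleR_add_left distrib_right)
      also have "\<dots> = G (s i) + h *\<^sub>R g 1 (s i)"
        by (simp add: sum.distrib G_def Suc)
      finally have "norm (E i) \<le> (K - 1) * M * h ^ Suc N"
        using e1[of 1 "s i"] unfolding E_def sS by (simp add: algebra_simps)
      also have "\<dots> \<le> K * M * h ^ Suc N"
        using M0 h by (intro mult_right_mono) auto
      finally show ?thesis .
    qed
    have E0: "E i = 0" if i: "s i \<ge> b \<or> s (Suc i) \<le> a" for i
    proof (cases "s i \<ge> b")
      case True
      then have "s (Suc i) \<ge> b" using h sS[of i] by simp
      then show ?thesis using True gb by (simp add: E_def G_def)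
    next
      case False
      then have sa: "s (Suc i) \<le> a" using i by simp
      have si: "s i \<le> s (Suc i)" using sS[of i] h by simp
      \<comment> \<open>To the left of \<open>a\<close> the primitive \<open>g 0\<close> need not
        vanish, but it is constant there and cancels in the difference.\<close>
      have "g 0 (s (Suc i)) = g 0 (s i)"
      proof -
        have "(g 0 has_vector_derivative 0) (at u within {..a})" if "u \<in> {..a}" for u
          using g[of 0 u] ga[of u 0] that by (simp add: has_vector_derivative_at_within)
        then obtain c where "\<And>u. u \<in> {..a} \<Longrightarrow> g 0 u = c"
          using has_vector_derivative_zero_constant[of "{..a}" "g 0"] by auto
        then show ?thesis using sa si by simp
      qed
      moreover have "g r (s (Suc i)) = 0" "g r (s i) = 0" if "r > 0" for r
        using ga[of _ "r - 1"] sa si that by auto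
      ultimately have "g r (s (Suc i)) = g r (s i)" "g 1 (s i) = 0" for r
        by (cases r; simp)+
      then have "G (s (Suc i)) = G (s i)" "g 1 (s i) = 0"
        unfolding G_def by simp_all
      then show ?thesis by (simp add: E_def)
    qed
    have "(\<Sum>i<I. E i) = G (s I) - G (s 0) - h *\<^sub>R (\<Sum>i<I. g 1 (s i))"
      using sum_lessThan_telescope[of "\<lambda>i. G (s i)" I]
      by (simp add: E_def sum_subtractf scaleR_sum_right)
    moreover have "G (s I) = 0" using I gb by (simp add: G_def s_def)
    ultimately have eq: "h *\<^sub>R (\<Sum>i<I. g 1 (s i)) + (\<Sum>m\<le>N. (bern_poly m x * h ^ m) *\<^sub>R g m t)
        = - (G (t + x * h) - (\<Sum>m\<le>N. (bern_poly m x * h ^ m) *\<^sub>R g m t)) - (\<Sum>i<I. E i)"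
      by (simp add: s_def algebra_simps)
    \<comment> \<open>\<open>?S\<close> collects the steps from \<open>s i\<close> to
      \<open>s (Suc i)\<close> that reach beyond \<open>a\<close> and start before \<open>b\<close>;
      the shift of \<open>a\<close> by \<open>h\<close> comes from testing the right end of the
      step.\<close>
    let ?A = "(a - h - t) / h - x"
    let ?S = "{i::nat. ?A < real i \<and> real i < ?A + (b - a + h) / h}"
    have "?A + (b - a + h) / h = (b - t) / h - x"
      by (simp add: add_divide_distrib[symmetric] diff_divide_distrib[symmetric])
    then have S: "i \<in> ?S \<longleftrightarrow> a < s (Suc i) \<and> s i < b" for i
    proof -
      have "?A < real i \<longleftrightarrow> a < s (Suc i)" using h by (auto simp: s_def field_simps)
      moreover have "real i < (b - t) / h - x \<longleftrightarrow> (real i + x) * h < b - t"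
        using h by (simp only: less_diff_eq pos_less_divide_eq)
      ultimately show ?thesis
        unfolding \<open>?A + (b - a + h) / h = (b - t) / h - x\<close> by (auto simp: s_def algebra_simps)
    qed
    have finS: "finite ?S"
      by (rule finite_subset[of _ "{..nat \<lceil>?A + (b - a + h) / h\<rceil>}"]) (auto, linarith)
    have "norm (\<Sum>i<I. E i) = norm (\<Sum>i\<in>{..<I} \<inter> ?S. E i)"
    proof (rule arg_cong[where f = norm], rule sum.mono_neutral_right)
      show "\<forall>i\<in>{..<I} - {..<I} \<inter> ?S. E i = 0"
        using E0 S by (meson DiffE IntI not_le)
    qed auto
    also have "\<dots> \<le> (\<Sum>i\<in>{..<I} \<inter> ?S. K * M * h ^ Suc N)"
      by (rule sum_norm_le) (use Ebound in auto)
    also have "\<dots> = real (card ({..<I} \<inter> ?S)) * (K * M * h ^ Suc N)" by simp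
    also have "\<dots> \<le> real (card ?S) * (K * M * h ^ Suc N)"
      using finS K1 M0 h by (intro mult_right_mono) (auto intro!: card_mono)
    also have "\<dots> \<le> ((b - a + h) / h + 1) * (K * M * h ^ Suc N)"
      using K1 M0 h ab by (intro mult_right_mono card_nat_between) auto
    also have "\<dots> = K * M * h ^ N * (b - a + 2 * h)"
      using h by (simp add: field_simps)
    finally have n1: "norm (\<Sum>i<I. E i) \<le> K * M * h ^ N * (b - a + 2 * h)" .
    have "norm (G (t + x * h) - (\<Sum>m\<le>N. (bern_poly m x * h ^ m) *\<^sub>R g m t)) \<le> (K - 1) * M * h ^ Suc N"
      using e1[of x t] x by simp
    also have "\<dots> \<le> K * M * h ^ Suc N"
      using M0 h by (intro mult_right_mono) auto
    finally have "norm (G (t + x * h) - (\<Sum>m\<le>N. (bern_poly m x * h ^ m) *\<^sub>R g m t)) \<le> K * M * h ^ N * h" by (simp add: mult_ac)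
    then have "norm (h *\<^sub>R (\<Sum>i<I. g 1 (s i)) + (\<Sum>m\<le>N. (bern_poly m x * h ^ m) *\<^sub>R g m t))
      \<le> K * M * h ^ N * h + K * M * h ^ N * (b - a + 2 * h)"
      unfolding eq using n1
      by (intro order_trans[OF norm_triangle_ineq4] add_mono) (simp_all only: norm_minus_cancel)
    then show "norm (h *\<^sub>R (\<Sum>i<I. g 1 (t + (x + real i) * h)) + (\<Sum>m\<le>N. (bern_poly m x * h ^ m) *\<^sub>R g m t))
        \<le> K * M * h ^ N * (b - a + 3 * h)"
      by (simp only: s_def) (simp add: algebra_simps)
  qed
qed

section \<open>Functions with continuous iterated directional derivatives\<close>

text \<open>Derivatives are taken along lines, so that affine substitution, multiplication by a
  linear form and integration along a ray can each be differentiated by a one-variable rule.\<close>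

definition dd :: "'a::real_normed_vector \<Rightarrow> ('a \<Rightarrow> complex) \<Rightarrow> 'a \<Rightarrow> complex" where
  "dd v f x = vector_derivative (\<lambda>t. f (x + t *\<^sub>R v)) (at 0)"

primrec dds :: "'a::real_normed_vector list \<Rightarrow> ('a \<Rightarrow> complex) \<Rightarrow> 'a \<Rightarrow> complex" where
  "dds [] f = f"
| "dds (v # vs) f = dd v (dds vs f)"

definition dir_smooth :: "('a::real_normed_vector \<Rightarrow> complex) \<Rightarrow> bool" where
  "dir_smooth f \<longleftrightarrow> (\<forall>vs. continuous_on UNIV (dds vs f) \<and>
     (\<forall>v x. ((\<lambda>t. dds vs f (x + t *\<^sub>R v)) has_vector_derivative dds (v # vs) f x) (at 0)))"

lemma dds_append: "dds vs (dds us f) = dds (vs @ us) f"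
  by (induction vs) auto

lemma dd_eqI: "(\<And>x. ((\<lambda>t. f (x + t *\<^sub>R v)) has_vector_derivative g x) (at 0)) \<Longrightarrow> dd v f = g"
  by (rule ext) (auto simp: dd_def intro: vector_derivative_at)

text \<open>A class \<open>A\<close> that is stable under a single directional derivative contains
  all iterated ones. Each closure property below then needs a suitable class instead of an induction
  over lists of directions.\<close>

lemma dir_smooth_coinduct:
  assumes "f \<in> A" and cont: "\<And>f. f \<in> A \<Longrightarrow> continuous_on UNIV f"
    and step: "\<And>f v. f \<in> A \<Longrightarrow> \<exists>g\<in>A. \<forall>x. ((\<lambda>t. f (x + t *\<^sub>R v)) has_vector_derivative g x) (at 0)"
  shows "dir_smooth f"
proof -
  have dd: "dd v f \<in> A" "((\<lambda>t. f (x + t *\<^sub>R v)) has_vector_derivative dd v f x) (at 0)"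
    if "f \<in> A" for f v x
    using step[OF that, of v] dd_eqI[of f v] by auto
  have "dds vs f \<in> A" for vs
    using assms(1) dd(1) by (induction vs) auto
  then show ?thesis using cont dd(2) by (auto simp: dir_smooth_def)
qed

lemma dir_smooth_dds: "dir_smooth f \<Longrightarrow> dir_smooth (dds vs f)"
  unfolding dir_smooth_def dds_append by (metis append_Cons)

lemma dir_smooth_dd: "dir_smooth f \<Longrightarrow> dir_smooth (dd v f)"
  using dir_smooth_dds[of f "[v]"] by simp

lemma dir_smooth_continuous: "dir_smooth f \<Longrightarrow> continuous_on UNIV f"
  unfolding dir_smooth_def by (metis dds.simps(1))

lemma dir_smooth_derivative:
  assumes "dir_smooth f"
  shows "((\<lambda>t. f (x + t *\<^sub>R v)) has_vector_derivative dd v f (x + s *\<^sub>R v)) (at s)"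
proof -
  have "((\<lambda>t. f ((x + s *\<^sub>R v) + t *\<^sub>R v)) has_vector_derivative dd v f (x + s *\<^sub>R v)) (at (s - s))"
    using assms unfolding dir_smooth_def by (metis dds.simps diff_self)
  then have "((\<lambda>t. f ((x + s *\<^sub>R v) + t *\<^sub>R v)) \<circ> (\<lambda>t. t - s) has_vector_derivative 1 *\<^sub>R dd v f (x + s *\<^sub>R v)) (at s)"
    by (intro vector_diff_chain_at) (auto intro!: derivative_eq_intros)
  then show ?thesis by (simp add: o_def algebra_simps)
qed

lemma dir_smooth_derivative_0:
  "dir_smooth f \<Longrightarrow> ((\<lambda>t. f (x + t *\<^sub>R v)) has_vector_derivative dd v f x) (at 0)"
  using dir_smooth_derivative[of f x v 0] by simp

lemma dd_add: "dir_smooth f \<Longrightarrow> dir_smooth g \<Longrightarrow> dd v (\<lambda>x. f x + g x) = (\<lambda>x. dd v f x + dd v g x)"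
  by (intro dd_eqI has_vector_derivative_add dir_smooth_derivative_0)

lemma dd_scale: "dir_smooth f \<Longrightarrow> dd v (\<lambda>x. c * f x) = (\<lambda>x. c * dd v f x)"
  by (intro dd_eqI has_vector_derivative_mult_right dir_smooth_derivative_0)

lemma dds_add: "dir_smooth f \<Longrightarrow> dir_smooth g \<Longrightarrow> dds vs (\<lambda>x. f x + g x) = (\<lambda>x. dds vs f x + dds vs g x)"
  by (induction vs) (auto simp: dd_add dir_smooth_dds)

lemma dds_scale: "dir_smooth f \<Longrightarrow> dds vs (\<lambda>x. c * f x) = (\<lambda>x. c * dds vs f x)"
  by (induction vs) (auto simp: dd_scale dir_smooth_dds)

lemma dir_smooth_add: assumes "dir_smooth f" "dir_smooth g" shows "dir_smooth (\<lambda>x. f x + g x)"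
proof (rule dir_smooth_coinduct[where A = "{\<lambda>x. f x + g x | f g. dir_smooth f \<and> dir_smooth g}"])
  fix h v assume "h \<in> {\<lambda>x. f x + g x | f g :: 'a \<Rightarrow> complex. dir_smooth f \<and> dir_smooth g}"
  then obtain f g where fg: "h = (\<lambda>x. f x + g x)" "dir_smooth f" "dir_smooth g" by auto
  show "\<exists>g\<in>{\<lambda>x. f x + g x | f g. dir_smooth f \<and> dir_smooth g}. \<forall>x. ((\<lambda>t. h (x + t *\<^sub>R v)) has_vector_derivative g x) (at 0)"
    by (rule bexI[of _ "\<lambda>x. dd v f x + dd v g x"])
      (use fg in \<open>auto intro!: has_vector_derivative_add dir_smooth_derivative_0 dir_smooth_dd\<close>)
next
  fix h assume "h \<in> {\<lambda>x. f x + g x | f g :: 'a \<Rightarrow> complex. dir_smooth f \<and> dir_smooth g}"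
  then show "continuous_on UNIV h" by (auto intro: continuous_on_add dest: dir_smooth_continuous)
qed (use assms in auto)

lemma dir_smooth_scale: assumes "dir_smooth f" shows "dir_smooth (\<lambda>x. c * f x)"
proof (rule dir_smooth_coinduct[where A = "{\<lambda>x. c * f x | f. dir_smooth f}"])
  fix h v assume "h \<in> {\<lambda>x. c * f x | f :: 'a \<Rightarrow> complex. dir_smooth f}"
  then obtain f where f: "h = (\<lambda>x. c * f x)" "dir_smooth f" by auto
  show "\<exists>g\<in>{\<lambda>x. c * f x | f. dir_smooth f}. \<forall>x. ((\<lambda>t. h (x + t *\<^sub>R v)) has_vector_derivative g x) (at 0)"
    by (rule bexI[of _ "\<lambda>x. c * dd v f x"])
      (use f in \<open>auto intro!: has_vector_derivative_mult_right dir_smooth_derivative_0 dir_smooth_dd\<close>)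
next
  fix h assume "h \<in> {\<lambda>x. c * f x | f :: 'a \<Rightarrow> complex. dir_smooth f}"
  then show "continuous_on UNIV h" by (auto intro: continuous_intros dest: dir_smooth_continuous)
qed (use assms in auto)

lemma dd_affine:
  assumes "dir_smooth f" "bounded_linear A"
  shows "dd v (\<lambda>y. f (A y + a)) = (\<lambda>y. dd (A v) f (A y + a))"
    and "((\<lambda>t. f (A (x + t *\<^sub>R v) + a)) has_vector_derivative dd (A v) f (A x + a)) (at 0)"
proof -
  interpret A: bounded_linear A by fact
  show *: "((\<lambda>t. f (A (x + t *\<^sub>R v) + a)) has_vector_derivative dd (A v) f (A x + a)) (at 0)" for x
    using dir_smooth_derivative_0[OF assms(1), of "A x + a" "A v"] by (simp add: A.add A.scaleR algebra_simps)
  show "dd v (\<lambda>y. f (A y + a)) = (\<lambda>y. dd (A v) f (A y + a))"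
    by (rule dd_eqI) (rule *)
qed

lemma dir_smooth_affine:
  assumes "dir_smooth f" "bounded_linear A"
  shows "dir_smooth (\<lambda>y. f (A y + a))"
proof (rule dir_smooth_coinduct[where A = "{\<lambda>y. f (A y + a) | f. dir_smooth f}"])
  fix h v assume "h \<in> {\<lambda>y. f (A y + a) | f. dir_smooth f}"
  then obtain f where f: "h = (\<lambda>y. f (A y + a))" "dir_smooth f" by auto
  show "\<exists>g\<in>{\<lambda>y. f (A y + a) | f. dir_smooth f}. \<forall>x. ((\<lambda>t. h (x + t *\<^sub>R v)) has_vector_derivative g x) (at 0)"
    by (rule bexI[of _ "\<lambda>y. dd (A v) f (A y + a)"])
      (use f assms(2) in \<open>auto intro!: dd_affine dir_smooth_dd\<close>)
next
  fix h assume "h \<in> {\<lambda>y. f (A y + a) | f. dir_smooth f}"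
  then obtain f where f: "h = (\<lambda>y. f (A y + a))" "dir_smooth f" by auto
  have "continuous_on UNIV (\<lambda>y. A y + a)"
    using linear_continuous_on[OF assms(2)] by (intro continuous_on_add continuous_on_const) auto
  then show "continuous_on UNIV h"
    unfolding f(1) by (rule continuous_on_compose2[OF dir_smooth_continuous[OF f(2)]]) auto
qed (use assms in auto)

lemma dds_affine:
  assumes "dir_smooth f" "bounded_linear A"
  shows "dds vs (\<lambda>y. f (A y + a)) = (\<lambda>y. dds (map A vs) f (A y + a))"
proof (induction vs)
  case (Cons v vs)
  then show ?case using dd_affine(1)[of "dds (map A vs) f" A v a] assms by (simp add: dir_smooth_dds)
qed simp

lemma derivative_linear_mult:
  assumes "dir_smooth f" "bounded_linear l"
  shows "((\<lambda>t. of_real (l (x + t *\<^sub>R v)) * f (x + t *\<^sub>R v)) has_vector_derivative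
           of_real (l v) * f x + of_real (l x) * dd v f x) (at 0)"
proof -
  interpret l: bounded_linear l by fact
  have "((\<lambda>t. complex_of_real (l x + t * l v)) has_vector_derivative of_real (l v)) (at 0)"
    by (auto intro!: derivative_eq_intros has_vector_derivative_of_real)
  from has_vector_derivative_mult[OF this dir_smooth_derivative_0[OF assms(1), of x v]]
  show ?thesis by (simp add: l.add l.scaleR algebra_simps)
qed

lemma dd_linear_mult:
  assumes "dir_smooth f" "bounded_linear l"
  shows "dd v (\<lambda>x. of_real (l x) * f x) = (\<lambda>x. of_real (l v) * f x + of_real (l x) * dd v f x)"
  by (rule dd_eqI) (rule derivative_linear_mult[OF assms])

lemma dir_smooth_linear_mult:
  assumes "dir_smooth f" "bounded_linear l"
  shows "dir_smooth (\<lambda>x. of_real (l x) * f x)"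
\<comment> \<open>The products alone are not stable: the product rule adds the summand
  \<open>l v * f\<close>. The class therefore carries a free smooth summand \<open>g\<close>, which
  is zero at the start.\<close>
proof (rule dir_smooth_coinduct[where A = "{\<lambda>x. g x + of_real (l x) * f x | f g. dir_smooth f \<and> dir_smooth g}"])
  show "(\<lambda>x. of_real (l x) * f x) \<in> {\<lambda>x. g x + of_real (l x) * f x | f g. dir_smooth f \<and> dir_smooth g}"
    using assms(1) dir_smooth_scale[OF assms(1), of 0]
    by (intro CollectI exI[of _ f] exI[of _ "\<lambda>x. 0 * f x"]) simp
next
  fix h assume "h \<in> {\<lambda>x. g x + of_real (l x) * f x | f g. dir_smooth f \<and> dir_smooth g}"
  then show "continuous_on UNIV h"
    using linear_continuous_on[OF assms(2)]
    by (auto intro!: continuous_on_add continuous_on_mult continuous_on_of_real dest: dir_smooth_continuous)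
next
  fix h v assume "h \<in> {\<lambda>x. g x + of_real (l x) * f x | f g. dir_smooth f \<and> dir_smooth g}"
  then obtain f g where fg: "h = (\<lambda>x. g x + of_real (l x) * f x)" "dir_smooth f" "dir_smooth g" by auto
  show "\<exists>g\<in>{\<lambda>x. g x + of_real (l x) * f x | f g. dir_smooth f \<and> dir_smooth g}.
      \<forall>x. ((\<lambda>t. h (x + t *\<^sub>R v)) has_vector_derivative g x) (at 0)"
  proof (rule bexI[of _ "\<lambda>x. (dd v g x + of_real (l v) * f x) + of_real (l x) * dd v f x"])
    show "\<forall>x. ((\<lambda>t. h (x + t *\<^sub>R v)) has_vector_derivative
        (dd v g x + of_real (l v) * f x) + of_real (l x) * dd v f x) (at 0)"
      using fg assms(2) unfolding add.assoc
      by (auto intro!: has_vector_derivative_add dir_smooth_derivative_0 derivative_linear_mult)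
    have "dir_smooth (\<lambda>x. dd v g x + of_real (l v) * f x)" "dir_smooth (dd v f)"
      using fg by (auto intro!: dir_smooth_add dir_smooth_scale dir_smooth_dd)
    then show "(\<lambda>x. (dd v g x + of_real (l v) * f x) + of_real (l x) * dd v f x)
        \<in> {\<lambda>x. g x + of_real (l x) * f x | f g. dir_smooth f \<and> dir_smooth g}"
      by (intro CollectI exI[of _ "dd v f"] exI[of _ "\<lambda>x. dd v g x + of_real (l v) * f x"]) simp
  qed
qed

subsection \<open>Integration along a ray\<close>

text \<open>Up to sign this is the primitive along \<open>v\<close> that vanishes far out in
  direction \<open>v\<close>: its derivative along \<open>v\<close> is \<open>- f\<close>.\<close>

definition ray_integral :: "'a::real_normed_vector \<Rightarrow> ('a \<Rightarrow> complex) \<Rightarrow> 'a \<Rightarrow> complex" where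
  "ray_integral v f y = integral {0..} (\<lambda>t. f (y + t *\<^sub>R v))"

lemma dd_vanish:
  assumes "open U" "x \<in> U" "\<And>y. y \<in> U \<Longrightarrow> f y = 0"
  shows "dd v f x = 0"
proof -
  have "\<forall>\<^sub>F t in at 0. x + t *\<^sub>R v \<in> U"
  proof (rule topological_tendstoD[OF _ assms(1)])
    show "((\<lambda>t. x + t *\<^sub>R v) \<longlongrightarrow> x) (at 0)" by (auto intro!: tendsto_eq_intros)
  qed fact
  then have "\<forall>\<^sub>F t in at 0. f (x + t *\<^sub>R v) = 0" by eventually_elim (use assms in auto)
  then have "((\<lambda>t. f (x + t *\<^sub>R v)) has_vector_derivative 0) (at 0) \<longleftrightarrow>
      ((\<lambda>t. 0) has_vector_derivative (0::complex)) (at (0::real))"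
    by (intro has_vector_derivative_cong_ev)
      (use assms in \<open>auto simp: eventually_at_filter elim: eventually_mono\<close>)
  then show ?thesis unfolding dd_def by (simp add: vector_derivative_at)
qed

lemma dds_vanish:
  assumes "open U" "x \<in> U" "\<And>y. y \<in> U \<Longrightarrow> f y = 0"
  shows "dds vs f x = 0"
proof -
  have "\<forall>y\<in>U. dds vs f y = 0"
    using assms by (induction vs) (auto intro: dd_vanish)
  then show ?thesis using assms by auto
qed

text \<open>The form \<open>\<zeta>\<close> measures position along \<open>v\<close>. Boundedness of
  the support in this one direction makes every ray integral a proper one; nothing is asked of the
  transverse directions, where the support may be unbounded.\<close>

locale strip =
  fixes \<zeta> :: "'a::real_normed_vector \<Rightarrow> real" and v :: 'a and R :: real
  assumes bl: "bounded_linear \<zeta>" and \<zeta>v: "\<zeta> v = 1"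
begin

sublocale bounded_linear \<zeta> by (rule bl)

definition V :: "('a \<Rightarrow> complex) set" where
  "V = {f. dir_smooth f \<and> (\<forall>y. \<bar>\<zeta> y\<bar> > R \<longrightarrow> f y = 0)}"

lemma V_dd: "f \<in> V \<Longrightarrow> dd w f \<in> V"
  unfolding V_def mem_Collect_eq
proof (intro conjI allI impI)
  fix y assume f: "dir_smooth f \<and> (\<forall>y. \<bar>\<zeta> y\<bar> > R \<longrightarrow> f y = 0)" and y: "R < \<bar>\<zeta> y\<bar>"
  show "dd w f y = 0"
  proof (rule dd_vanish[where U = "{y. R < \<bar>\<zeta> y\<bar>}"])
    show "open {y. R < \<bar>\<zeta> y\<bar>}"
      using bl by (intro open_Collect_less continuous_intros linear_continuous_on)
  qed (use f y in auto)
qed (simp add: dir_smooth_dd)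

lemma V_dds: "f \<in> V \<Longrightarrow> dds vs f \<in> V"
  by (induction vs) (auto simp: V_dd)

lemma zero_off:
  assumes "f \<in> V" "t < - R - \<zeta> y \<or> t > R - \<zeta> y"
  shows "f (y + t *\<^sub>R v) = 0"
proof -
  have "\<zeta> (y + t *\<^sub>R v) = \<zeta> y + t" by (simp add: add scaleR \<zeta>v)
  then show ?thesis using assms by (auto simp: V_def)
qed

text \<open>The freedom in the endpoints has two uses. The choice
  \<open>p = max 0 (- R - \<zeta> y)\<close> gives an interval of length at most
  \<open>2 * \<bar>R\<bar>\<close>, hence a bound uniform in \<open>y\<close>; the choice
  \<open>p = 0\<close> with a large \<open>q\<close> gives one interval common to several functions
  or nearby base points.\<close>

lemma ray_integral_eq:
  assumes "f \<in> V" "0 \<le> p" "p \<le> max 0 (- R - \<zeta> y)" "q \<ge> R - \<zeta> y"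
  shows "ray_integral v f y = integral {p..q} (\<lambda>t. f (y + t *\<^sub>R v))"
proof -
  have "ray_integral v f y = integral {0..} (\<lambda>t. if t \<in> {p..q} then f (y + t *\<^sub>R v) else 0)"
    unfolding ray_integral_def
    by (rule Henstock_Kurzweil_Integration.integral_cong)
      (use assms in \<open>auto intro!: zero_off\<close>)
  also have "\<dots> = integral ({p..q} \<inter> {0..}) (\<lambda>t. f (y + t *\<^sub>R v))"
    by (rule Henstock_Kurzweil_Integration.integral_restrict_Int)
  also have "{p..q} \<inter> {0..} = {p..q}" using assms by auto
  finally show ?thesis .
qed

lemma continuous_ray: "f \<in> V \<Longrightarrow> continuous_on S (\<lambda>t. f (y + t *\<^sub>R v))"
  by (rule continuous_on_compose2[OF dir_smooth_continuous]) (auto simp: V_def intro!: continuous_intros)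

lemma ray_integral_bound:
  assumes "f \<in> V" "\<And>y. norm (f y) \<le> M"
  shows "norm (ray_integral v f y) \<le> 2 * \<bar>R\<bar> * M"
proof -
  have M0: "M \<ge> 0" using order_trans[OF norm_ge_zero assms(2)] .
  let ?p = "max 0 (- R - \<zeta> y)" and ?q = "R - \<zeta> y"
  have eq: "ray_integral v f y = integral {?p..?q} (\<lambda>t. f (y + t *\<^sub>R v))"
    by (rule ray_integral_eq) (use assms in auto)
  show ?thesis
  proof (cases "?p \<le> ?q")
    case True
    have "norm (ray_integral v f y) \<le> M * (?q - ?p)"
      unfolding eq by (rule integral_bound) (use True assms continuous_ray in auto)
    also have "\<dots> \<le> M * (2 * \<bar>R\<bar>)" using M0 by (intro mult_left_mono) auto
    finally show ?thesis by (simp add: mult_ac)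
  qed (use M0 eq in auto)
qed

lemma ray_integral_add:
  assumes "f \<in> V" "g \<in> V"
  shows "ray_integral v (\<lambda>x. f x + g x) y = ray_integral v f y + ray_integral v g y"
proof -
  have "(\<lambda>x. f x + g x) \<in> V" using assms by (auto simp: V_def dir_smooth_add)
  then show ?thesis
    using assms by (subst (1 2 3) ray_integral_eq[of _ 0 y "R - \<zeta> y"])
      (auto intro!: Henstock_Kurzweil_Integration.integral_add integrable_continuous_interval continuous_ray)
qed

lemma ray_integral_scale: "ray_integral v (\<lambda>x. c * f x) y = c * ray_integral v f y"
  unfolding ray_integral_def by simp

lemma continuous_shear: "f \<in> V \<Longrightarrow> continuous_on S (\<lambda>(x, t). f (x + t *\<^sub>R v))"
  unfolding split_beta
  by (rule continuous_on_compose2[OF dir_smooth_continuous]) (auto simp: V_def intro!: continuous_intros)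

lemma continuous_ray_integral:
  assumes "f \<in> V"
  shows "continuous_on UNIV (ray_integral v f)"
proof -
  have "isCont (ray_integral v f) y0" for y0
  proof -
    \<comment> \<open>For all base points in this open half-space the ray may be cut off at the same
      \<open>?T\<close>, which makes the continuity theorem for parameter integrals over a fixed
      interval applicable.\<close>
    let ?U = "{y. \<zeta> y0 - 1 < \<zeta> y}" and ?T = "R - \<zeta> y0 + 1"
    have "open ?U" using bl by (intro open_Collect_less continuous_intros linear_continuous_on)
    have "continuous_on ?U (\<lambda>y. integral (cbox 0 ?T) (\<lambda>t. f (y + t *\<^sub>R v)))"
      using continuous_shear[OF assms] by (rule integral_continuous_on_param)
    then have "continuous_on ?U (ray_integral v f)"
      by (rule continuous_on_eq) (use assms in \<open>auto intro!: ray_integral_eq[symmetric]\<close>)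
    then show ?thesis using \<open>open ?U\<close> by (auto simp: continuous_on_eq_continuous_at)
  qed
  then show ?thesis by (simp add: continuous_at_imp_continuous_on)
qed

lemma ray_integral_derivative:
  assumes f: "f \<in> V"
  shows "((\<lambda>s. ray_integral v f (y + s *\<^sub>R w)) has_vector_derivative ray_integral v (dd w f) y) (at 0)"
proof -
  \<comment> \<open>As long as \<open>s\<close> stays between -1 and 1, moving the base point by
    \<open>s *\<^sub>R w\<close> changes \<open>\<zeta>\<close> by at most
    \<open>\<bar>\<zeta> w\<bar>\<close>, so one cutoff \<open>?T\<close> allows differentiation
    under the integral.\<close>
  let ?U = "{-1<..<1::real}" and ?T = "R - \<zeta> y + \<bar>\<zeta> w\<bar>"
  have smf: "dir_smooth f" using f by (simp add: V_def)
  have bd: "R - \<zeta> (y + s *\<^sub>R w) \<le> ?T" if "s \<in> ?U" for s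
  proof -
    have "\<bar>s * \<zeta> w\<bar> \<le> 1 * \<bar>\<zeta> w\<bar>" unfolding abs_mult using that by (intro mult_right_mono) auto
    then show ?thesis by (auto simp: add scaleR)
  qed
  have "((\<lambda>s. integral (cbox 0 ?T) (\<lambda>t. f (y + s *\<^sub>R w + t *\<^sub>R v))) has_vector_derivative
      integral (cbox 0 ?T) (\<lambda>t. dd w f (y + 0 *\<^sub>R w + t *\<^sub>R v))) (at 0 within ?U)"
  proof (rule leibniz_rule_vector_derivative)
    fix s t
    show "((\<lambda>s. f (y + s *\<^sub>R w + t *\<^sub>R v)) has_vector_derivative dd w f (y + s *\<^sub>R w + t *\<^sub>R v)) (at s within ?U)"
      using dir_smooth_derivative[OF smf, of "y + t *\<^sub>R v" w s]
      by (simp add: has_vector_derivative_at_within algebra_simps)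
  next
    show "continuous_on (?U \<times> cbox 0 ?T) (\<lambda>(s, t). dd w f (y + s *\<^sub>R w + t *\<^sub>R v))"
      unfolding split_beta
      by (rule continuous_on_compose2[OF dir_smooth_continuous[OF dir_smooth_dd[OF smf]]]) (auto intro!: continuous_intros)
  qed (auto intro!: integrable_continuous_interval continuous_ray f)
  also have "integral (cbox 0 ?T) (\<lambda>t. dd w f (y + 0 *\<^sub>R w + t *\<^sub>R v)) = ray_integral v (dd w f) y"
    using V_dd[OF f] bd[of 0] by (subst ray_integral_eq[of _ 0 y ?T]) auto
  finally have "((\<lambda>s. integral (cbox 0 ?T) (\<lambda>t. f (y + s *\<^sub>R w + t *\<^sub>R v))) has_vector_derivative
      ray_integral v (dd w f) y) (at 0)"
    using has_vector_derivative_within_open[of 0 ?U] by auto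
  then show ?thesis
  proof (rule has_vector_derivative_transform_within_open[where S = ?U])
    fix s :: real assume "s \<in> ?U"
    then show "integral (cbox 0 ?T) (\<lambda>t. f (y + s *\<^sub>R w + t *\<^sub>R v)) = ray_integral v f (y + s *\<^sub>R w)"
      using f bd[of s] by (subst ray_integral_eq[of _ 0 _ ?T]) auto
  qed auto
qed

lemma dd_ray_integral: "f \<in> V \<Longrightarrow> dd w (ray_integral v f) = ray_integral v (dd w f)"
  by (rule dd_eqI) (rule ray_integral_derivative)

lemma dds_ray_integral: "f \<in> V \<Longrightarrow> dds ws (ray_integral v f) = ray_integral v (dds ws f)"
  by (induction ws) (auto simp: dd_ray_integral V_dds)

lemma dir_smooth_ray_integral:
  assumes "f \<in> V" shows "dir_smooth (ray_integral v f)"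
proof (rule dir_smooth_coinduct[where A = "ray_integral v ` V"])
  fix h w assume "h \<in> ray_integral v ` V"
  then obtain f where f: "h = ray_integral v f" "f \<in> V" by auto
  show "\<exists>g\<in>ray_integral v ` V. \<forall>x. ((\<lambda>t. h (x + t *\<^sub>R w)) has_vector_derivative g x) (at 0)"
    by (rule bexI[of _ "ray_integral v (dd w f)"])
      (use f in \<open>auto intro!: ray_integral_derivative V_dd\<close>)
qed (use assms continuous_ray_integral in auto)

lemma dd_ray_integral_self:
  assumes f: "f \<in> V"
  shows "dd v (ray_integral v f) y = - f y"
proof -
  let ?T = "max 0 (R - \<zeta> y + 1)"
  have "((\<lambda>t. dd v f (y + t *\<^sub>R v)) has_integral f (y + ?T *\<^sub>R v) - f (y + 0 *\<^sub>R v)) {0..?T}"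
    by (rule fundamental_theorem_of_calculus)
      (use f in \<open>auto simp: V_def intro!: has_vector_derivative_at_within dir_smooth_derivative\<close>)
  moreover have "f (y + ?T *\<^sub>R v) = 0" using f by (rule zero_off) auto
  moreover have "ray_integral v (dd v f) y = integral {0..?T} (\<lambda>t. dd v f (y + t *\<^sub>R v))"
    by (rule ray_integral_eq) (use V_dd[OF f] in auto)
  ultimately show ?thesis using f by (simp add: dd_ray_integral integral_unique)
qed

lemma ray_integral_eq_0:
  assumes "f \<in> V" "\<zeta> y > R"
  shows "ray_integral v f y = 0"
  using assms by (subst ray_integral_eq[of _ 0 y 0]) auto

end

section \<open>Functionals controlled by finitely many derivatives\<close>

text \<open>Applied to families of functionals, this asks for one period that serves all test
  functions at once, as \<open>periodic_family\<close> does.\<close>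

definition int_periodic :: "(int \<Rightarrow> 'b) \<Rightarrow> bool" where
  "int_periodic F \<longleftrightarrow> (\<exists>D>0. \<forall>k l. F (k + D * l) = F k)"

lemma int_periodic_const: "int_periodic (\<lambda>k. c)"
  unfolding int_periodic_def by (auto intro: exI[of _ 1])

lemma int_periodic_comp: "int_periodic F \<Longrightarrow> int_periodic (\<lambda>k. h (F k))"
  unfolding int_periodic_def by metis

lemma int_periodic_op2:
  assumes "int_periodic F" "int_periodic G" shows "int_periodic (\<lambda>k. h (F k) (G k))"
proof -
  obtain D E where "D > 0" "\<And>k l. F (k + D * l) = F k" "E > 0" "\<And>k l. G (k + E * l) = G k"
    using assms unfolding int_periodic_def by auto
  moreover from this have "F (k + (D * E) * l) = F k" "G (k + (D * E) * l) = G k" for k l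
    by (metis mult.assoc) (metis \<open>\<And>k l. G (k + E * l) = G k\<close> mult.assoc mult.commute)
  ultimately show ?thesis unfolding int_periodic_def by (intro exI[of _ "D * E"]) auto
qed

lemma int_periodic_sum:
  assumes "finite I" "\<And>i. i \<in> I \<Longrightarrow> int_periodic (T i)"
  shows "int_periodic (\<lambda>k f. \<Sum>i\<in>I. T i k f :: complex)"
  using assms
proof (induction I rule: finite_induct)
  case (insert j I)
  then have "int_periodic (T j)" "int_periodic (\<lambda>k f. \<Sum>i\<in>I. T i k f)" by auto
  from int_periodic_op2[OF this, of "\<lambda>u v f. u f + v f"]
  show ?case using insert by simp
qed (simp add: int_periodic_const)

locale lattice_basis =
  fixes B :: "'a::real_normed_vector set"
  assumes finite_B: "finite B" and indep_B: "independent B" and span_B: "span B = UNIV"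
begin

subsection \<open>Coordinates\<close>

definition crd :: "'a \<Rightarrow> 'a \<Rightarrow> real" where
  "crd b x = representation B x b"

lemma crd_linear: "linear (crd b)"
  by (rule linearI)
    (auto simp: crd_def span_B indep_B real_vector.representation_add real_vector.representation_scale)

lemma crd_add: "crd b (x + y) = crd b x + crd b y"
  and crd_diff: "crd b (x - y) = crd b x - crd b y"
  and crd_minus: "crd b (- x) = - crd b x"
  and crd_scale: "crd b (r *\<^sub>R x) = r * crd b x"
  and crd_0 [simp]: "crd b 0 = 0"
  using linear_add[OF crd_linear] linear_diff[OF crd_linear] linear_neg[OF crd_linear]
    linear_cmul[OF crd_linear] linear_0[OF crd_linear] by auto

lemma crd_sum: "crd b (sum f I) = (\<Sum>i\<in>I. crd b (f i))"
  by (rule linear_sum[OF crd_linear])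

lemma crd_basis: "c \<in> B \<Longrightarrow> crd b c = (if b = c then 1 else 0)"
  by (simp add: crd_def real_vector.representation_basis indep_B)

lemma crd_expand: "(\<Sum>b\<in>B. crd b x *\<^sub>R b) = x"
  unfolding crd_def by (rule real_vector.sum_representation_eq) (auto simp: finite_B indep_B span_B)

lemma crd_eqI: "(\<And>b. b \<in> B \<Longrightarrow> crd b x = crd b y) \<Longrightarrow> x = y"
  using crd_expand[of x] crd_expand[of y] by (metis (no_types, lifting) sum.cong)

lemma linear_crd: "linear f \<Longrightarrow> f x = (\<Sum>b\<in>B. crd b x * f b)" for f :: "'a \<Rightarrow> real"
  by (subst crd_expand[of x, symmetric]) (simp add: linear_sum linear_cmul)

text \<open>This is the equivalence of norms in finite dimension: by linear independence the norm
  has a positive minimum on the compact set of coefficient vectors of absolute sum 1, and scaling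
  does the rest.\<close>

lemma crd_bounded: "\<exists>K. \<forall>b\<in>B. \<forall>x. \<bar>crd b x\<bar> \<le> K * norm x"
proof (cases "B = {}")
  case False
  define N where "N c = norm (\<Sum>b\<in>B. c b *\<^sub>R b)" for c :: "'a \<Rightarrow> real"
  \<comment> \<open>Coefficient vectors are functions on the whole space that vanish off
    \<open>B\<close>; with the factor \<open>{0}\<close> at those places, \<open>Q\<close> is a
    product of compact sets.\<close>
  define Q where "Q = PiE UNIV (\<lambda>b. if b \<in> B then {-1..1::real} else {0})"
  define P where "P = Q \<inter> {c. (\<Sum>b\<in>B. \<bar>c b\<bar>) = 1}"
  have "compactin (product_topology (\<lambda>_. euclidean) UNIV) Q"
    unfolding Q_def by (subst compactin_PiE) auto
  then have "compact Q" by (simp add: euclidean_product_topology)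
  have contc: "continuous_on UNIV (\<lambda>c::'a \<Rightarrow> real. c b)" for b
    by (rule continuous_on_product_coordinates)
  have "closed {c::'a \<Rightarrow> real. (\<Sum>b\<in>B. \<bar>c b\<bar>) = 1}"
    by (intro closed_Collect_eq continuous_on_sum continuous_on_rabs contc continuous_on_const)
  with \<open>compact Q\<close> have "compact P" unfolding P_def by (rule compact_Int_closed)
  have contN: "continuous_on P N"
    unfolding N_def
    by (intro continuous_on_norm continuous_on_sum continuous_on_scaleR continuous_on_const)
      (rule continuous_on_subset[OF contc], simp)
  have mem: "(\<lambda>b. crd b x / (\<Sum>b\<in>B. \<bar>crd b x\<bar>)) \<in> P" if "(\<Sum>b\<in>B. \<bar>crd b x\<bar>) \<noteq> 0" for x
  proof -
    let ?s = "\<Sum>b\<in>B. \<bar>crd b x\<bar>"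
    have s: "?s > 0" using that by (simp add: sum_nonneg order_less_le)
    have "\<bar>crd b x\<bar> \<le> ?s" if "b \<in> B" for b
      using that finite_B by (intro member_le_sum) auto
    then have "crd b x / ?s \<in> {-1..1}" if "b \<in> B" for b
      using that s by (auto simp: field_simps abs_le_iff) (metis minus_le_iff)
    moreover have "crd b x = 0" if "b \<notin> B" for b
      using that real_vector.representation_ne_zero[of B x b] by (auto simp: crd_def)
    moreover have "(\<Sum>b\<in>B. \<bar>crd b x / ?s\<bar>) = 1"
      using s by (simp add: abs_divide sum_divide_distrib[symmetric])
    ultimately show ?thesis by (auto simp: P_def Q_def)
  qed
  obtain b0 where b0: "b0 \<in> B" using False by blast
  have "(\<Sum>b\<in>B. \<bar>crd b b0\<bar>) = 1"
    using b0 finite_B by (simp add: crd_basis if_distrib cong: if_cong)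
  then have "P \<noteq> {}" using mem[of b0] by auto
  then obtain c0 where c0: "c0 \<in> P" "\<And>c. c \<in> P \<Longrightarrow> N c0 \<le> N c"
    using continuous_attains_inf[OF \<open>compact P\<close> _ contN] by blast
  have "N c0 \<noteq> 0"
  proof
    assume "N c0 = 0"
    then have "c0 b = 0" if "b \<in> B" for b
      using that independentD[OF indep_B finite_B order_refl, of c0 b] by (simp add: N_def)
    then have "(\<Sum>b\<in>B. \<bar>c0 b\<bar>) = 0" by simp
    then show False using c0(1) by (simp add: P_def)
  qed
  then have pos: "N c0 > 0" by (simp add: N_def)
  have "\<bar>crd b x\<bar> \<le> (1 / N c0) * norm x" if b: "b \<in> B" for b x
  proof (cases "(\<Sum>b\<in>B. \<bar>crd b x\<bar>) = 0")
    case True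
    then have "crd b x = 0" using b finite_B by (simp add: sum_nonneg_eq_0_iff)
    then show ?thesis using pos by simp
  next
    case False
    let ?s = "\<Sum>b\<in>B. \<bar>crd b x\<bar>"
    have s: "?s > 0" using False by (simp add: sum_nonneg order_less_le)
    have "N (\<lambda>b. crd b x / ?s) = norm ((1 / ?s) *\<^sub>R (\<Sum>b\<in>B. crd b x *\<^sub>R b))"
      unfolding N_def scaleR_sum_right by (simp add: mult.commute divide_inverse)
    also have "\<dots> = norm x / ?s" using s by (simp add: crd_expand)
    finally have "N c0 \<le> norm x / ?s" using c0(2)[OF mem[OF False]] by simp
    then have "?s \<le> (1 / N c0) * norm x" using s pos by (simp add: field_simps)
    moreover have "\<bar>crd b x\<bar> \<le> ?s"
      using b finite_B by (intro member_le_sum) auto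
    ultimately show ?thesis by linarith
  qed
  then show ?thesis by blast
qed simp

lemma crd_bounded_linear: "b \<in> B \<Longrightarrow> bounded_linear (crd b)"
proof -
  assume b: "b \<in> B"
  obtain K where "\<And>b x. b \<in> B \<Longrightarrow> \<bar>crd b x\<bar> \<le> K * norm x" using crd_bounded by blast
  with b show "bounded_linear (crd b)"
    by (intro bounded_linear_intro[where K = K]) (simp_all add: crd_add crd_scale mult.commute)
qed

lemma linear_imp_bounded_linear:
  assumes "linear f" shows "bounded_linear (f :: 'a \<Rightarrow> real)"
proof -
  have "bounded_linear (\<lambda>x. \<Sum>b\<in>B. crd b x * f b)"
    by (intro bounded_linear_sum bounded_linear_mult_const crd_bounded_linear) auto
  moreover have "f = (\<lambda>x. \<Sum>b\<in>B. crd b x * f b)"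
    by (rule ext) (rule linear_crd[OF assms])
  ultimately show ?thesis by metis
qed

subsection \<open>Function classes and controlled functionals\<close>

text \<open>Only the coordinates in \<open>S\<close> are restricted. Once a coordinate has been
  eliminated, the boundary values are constant along it, and a sum over \<open>lat S\<close> never
  looks at it.\<close>

definition box_supported :: "'a set \<Rightarrow> real \<Rightarrow> ('a \<Rightarrow> complex) set" where
  "box_supported S R = {f. dir_smooth f \<and> (\<forall>y. (\<exists>b\<in>S. \<bar>crd b y\<bar> > R) \<longrightarrow> f y = 0)}"

text \<open>A bound \<open>M\<close> is used instead of suprema: for \<open>S\<close> smaller than
  \<open>B\<close> a function in \<open>box_supported S R\<close> may be unbounded, and then there
  is simply no \<open>M\<close>.\<close>

definition deriv_bound :: "'a list set \<Rightarrow> ('a \<Rightarrow> complex) \<Rightarrow> real \<Rightarrow> bool" where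
  "deriv_bound F f M \<longleftrightarrow> 0 \<le> M \<and> (\<forall>vs\<in>F. \<forall>x. norm (dds vs f x) \<le> M)"

text \<open>The constants are uniform in the index. With \<open>I = {1..}\<close> this expresses
  error bounds for all \<open>k\<close>, with \<open>I = UNIV\<close> boundedness of the
  coefficients over all residues, and with a one-point \<open>I\<close> continuity of a single
  functional.\<close>

definition controlled :: "'a set \<Rightarrow> 'i set \<Rightarrow> ('i \<Rightarrow> ('a \<Rightarrow> complex) \<Rightarrow> complex) \<Rightarrow> bool" where
  "controlled S I T \<longleftrightarrow> (\<forall>R. \<exists>C F. 0 \<le> C \<and> finite F \<and>
     (\<forall>f\<in>box_supported S R. \<forall>M. deriv_bound F f M \<longrightarrow> (\<forall>i\<in>I. norm (T i f) \<le> C * M)))"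

definition lin_functional :: "'a set \<Rightarrow> (('a \<Rightarrow> complex) \<Rightarrow> complex) \<Rightarrow> bool" where
  "lin_functional S T \<longleftrightarrow> (\<forall>R. \<forall>f\<in>box_supported S R. (\<forall>g\<in>box_supported S R. T (\<lambda>x. f x + g x) = T f + T g) \<and>
     (\<forall>c. T (\<lambda>x. c * f x) = c * T f))"

text \<open>These are linear maps, continuous in the sense needed to pull back expansions: supports
  go to supports, and each output derivative is dominated by finitely many input
  derivatives.\<close>

definition controlled_op :: "'a set \<Rightarrow> 'a set \<Rightarrow> (('a \<Rightarrow> complex) \<Rightarrow> ('a \<Rightarrow> complex)) \<Rightarrow> bool" where
  "controlled_op S S' P \<longleftrightarrow>
     (\<forall>R. \<forall>f\<in>box_supported S R. (\<forall>g\<in>box_supported S R. P (\<lambda>x. f x + g x) = (\<lambda>x. P f x + P g x)) \<and>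
        (\<forall>c. P (\<lambda>x. c * f x) = (\<lambda>x. c * P f x))) \<and>
     (\<forall>R. \<exists>R'. \<forall>f\<in>box_supported S R. P f \<in> box_supported S' R') \<and>
     (\<forall>R vs. \<exists>C F. 0 \<le> C \<and> finite F \<and>
        (\<forall>f\<in>box_supported S R. \<forall>M. deriv_bound F f M \<longrightarrow> (\<forall>x. norm (dds vs (P f) x) \<le> C * M)))"

lemma controlled_op_add: "controlled_op S S' P \<Longrightarrow> f \<in> box_supported S R \<Longrightarrow> g \<in> box_supported S R \<Longrightarrow>
    P (\<lambda>x. f x + g x) = (\<lambda>x. P f x + P g x)"
  and controlled_op_scale: "controlled_op S S' P \<Longrightarrow> f \<in> box_supported S R \<Longrightarrow> P (\<lambda>x. c * f x) = (\<lambda>x. c * P f x)"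
  by (auto simp: controlled_op_def)

lemma lin_functional_addD: "lin_functional S T \<Longrightarrow> f \<in> box_supported S R \<Longrightarrow> g \<in> box_supported S R \<Longrightarrow> T (\<lambda>x. f x + g x) = T f + T g"
  and lin_functional_scaleD: "lin_functional S T \<Longrightarrow> f \<in> box_supported S R \<Longrightarrow> T (\<lambda>x. c * f x) = c * T f"
  by (auto simp: lin_functional_def)

lemma deriv_bound_Un: "deriv_bound (F \<union> G) f M \<longleftrightarrow> deriv_bound F f M \<and> deriv_bound G f M"
  by (auto simp: deriv_bound_def)

lemma box_supported_Sm: "f \<in> box_supported S R \<Longrightarrow> dir_smooth f"
  by (simp add: box_supported_def)

lemma box_supported_zero: "f \<in> box_supported S R \<Longrightarrow> b \<in> S \<Longrightarrow> \<bar>crd b y\<bar> > R \<Longrightarrow> f y = 0"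
  by (auto simp: box_supported_def)

lemma box_supported_add: "f \<in> box_supported S R \<Longrightarrow> g \<in> box_supported S R \<Longrightarrow> (\<lambda>x. f x + g x) \<in> box_supported S R"
  by (auto simp: box_supported_def dir_smooth_add)

lemma box_supported_scale: "f \<in> box_supported S R \<Longrightarrow> (\<lambda>x. c * f x) \<in> box_supported S R"
  by (auto simp: box_supported_def dir_smooth_scale)

lemma box_supported_antimono: "S \<subseteq> S' \<Longrightarrow> R \<le> R' \<Longrightarrow> box_supported S' R \<subseteq> box_supported S R'"
  unfolding box_supported_def by (auto, meson order_le_less_trans subsetD)

lemma box_supported_dds:
  assumes "S \<subseteq> B" "f \<in> box_supported S R" shows "dds vs f \<in> box_supported S R"
proof -
  have "dds vs f y = 0" if b: "b \<in> S" "\<bar>crd b y\<bar> > R" for b y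
  proof (rule dds_vanish[where U = "{y. R < \<bar>crd b y\<bar>}"])
    show "open {y. R < \<bar>crd b y\<bar>}"
      using b assms crd_bounded_linear[of b]
      by (intro open_Collect_less continuous_intros linear_continuous_on) auto
  qed (use b assms in \<open>auto intro: box_supported_zero\<close>)
  then show ?thesis using assms by (auto simp: box_supported_def dir_smooth_dds)
qed

lemma controlled_cong:
  assumes "controlled S I T" "\<And>R i f. i \<in> I \<Longrightarrow> f \<in> box_supported S R \<Longrightarrow> U i f = T i f"
  shows "controlled S I U"
  using assms unfolding controlled_def by (metis (no_types, lifting))

lemma controlled_add:
  assumes "controlled S I T" "controlled S I U" shows "controlled S I (\<lambda>i f. T i f + U i f)"
  unfolding controlled_def
proof
  fix R
  obtain C F C' F' where 1: "0 \<le> C" "finite F"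
      "\<And>f M i. f \<in> box_supported S R \<Longrightarrow> deriv_bound F f M \<Longrightarrow> i \<in> I \<Longrightarrow> norm (T i f) \<le> C * M"
    and 2: "0 \<le> C'" "finite F'"
      "\<And>f M i. f \<in> box_supported S R \<Longrightarrow> deriv_bound F' f M \<Longrightarrow> i \<in> I \<Longrightarrow> norm (U i f) \<le> C' * M"
    using assms unfolding controlled_def by metis
  have "norm (T i f + U i f) \<le> (C + C') * M" if "f \<in> box_supported S R" "deriv_bound (F \<union> F') f M" "i \<in> I" for f M i
    using that 1(3)[of f M i] 2(3)[of f M i] norm_triangle_ineq[of "T i f" "U i f"]
    by (simp add: deriv_bound_Un distrib_right)
  with 1 2 show "\<exists>C F. 0 \<le> C \<and> finite F \<and>
     (\<forall>f\<in>box_supported S R. \<forall>M. deriv_bound F f M \<longrightarrow> (\<forall>i\<in>I. norm (T i f + U i f) \<le> C * M))"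
    by (intro exI[of _ "C + C'"] exI[of _ "F \<union> F'"]) auto
qed

lemma controlled_scale:
  assumes "controlled S I T" "\<And>i. i \<in> I \<Longrightarrow> norm (c i) \<le> K" shows "controlled S I (\<lambda>i f. c i * T i f)"
  unfolding controlled_def
proof
  fix R
  obtain C F where 1: "0 \<le> C" "finite F"
      "\<And>f M i. f \<in> box_supported S R \<Longrightarrow> deriv_bound F f M \<Longrightarrow> i \<in> I \<Longrightarrow> norm (T i f) \<le> C * M"
    using assms unfolding controlled_def by metis
  have "norm (c i * T i f) \<le> (\<bar>K\<bar> * C) * M" if "f \<in> box_supported S R" "deriv_bound F f M" "i \<in> I" for f M i
  proof -
    have "norm (c i * T i f) \<le> \<bar>K\<bar> * (C * M)"
      unfolding norm_mult using that 1 assms(2)[of i] by (intro mult_mono) auto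
    then show ?thesis by (simp add: mult.assoc)
  qed
  with 1 show "\<exists>C F. 0 \<le> C \<and> finite F \<and>
     (\<forall>f\<in>box_supported S R. \<forall>M. deriv_bound F f M \<longrightarrow> (\<forall>i\<in>I. norm (c i * T i f) \<le> C * M))"
    by (intro exI[of _ "\<bar>K\<bar> * C"] exI[of _ F]) auto
qed

lemma controlled_zero: "controlled S I (\<lambda>i f. 0)"
  unfolding controlled_def by (auto intro!: exI[of _ 0] exI[of _ "{}"])

lemma controlled_sum:
  "finite J \<Longrightarrow> (\<And>j. j \<in> J \<Longrightarrow> controlled S I (T j)) \<Longrightarrow> controlled S I (\<lambda>i f. \<Sum>j\<in>J. T j i f)"
  by (induction J rule: finite_induct) (auto simp: controlled_zero intro: controlled_add)

lemma controlled_reindex: "controlled S I T \<Longrightarrow> g ` J \<subseteq> I \<Longrightarrow> controlled S J (\<lambda>j. T (g j))"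
  unfolding controlled_def by (meson image_subset_iff)

lemma controlled_comp:
  assumes "controlled_op S S' P" "controlled S' I T" shows "controlled S I (\<lambda>i f. T i (P f))"
  unfolding controlled_def
proof
  fix R
  obtain R' where R': "\<And>f. f \<in> box_supported S R \<Longrightarrow> P f \<in> box_supported S' R'" using assms(1) unfolding controlled_op_def by metis
  obtain C F where 1: "0 \<le> C" "finite F"
      "\<And>f M i. f \<in> box_supported S' R' \<Longrightarrow> deriv_bound F f M \<Longrightarrow> i \<in> I \<Longrightarrow> norm (T i f) \<le> C * M"
    using assms unfolding controlled_def by metis
  have "\<forall>vs. \<exists>C F. 0 \<le> C \<and> finite F \<and>
        (\<forall>f\<in>box_supported S R. \<forall>M. deriv_bound F f M \<longrightarrow> (\<forall>x. norm (dds vs (P f) x) \<le> C * M))"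
    using assms(1) unfolding controlled_op_def by blast
  then obtain c G where 2: "\<And>vs. 0 \<le> c vs" "\<And>vs. finite (G vs)"
     "\<And>vs f M x. f \<in> box_supported S R \<Longrightarrow> deriv_bound (G vs) f M \<Longrightarrow> norm (dds vs (P f) x) \<le> c vs * M"
    by metis
  have "norm (T i (P f)) \<le> (C * sum c F) * M" if f: "f \<in> box_supported S R" "deriv_bound (\<Union>(G ` F)) f M" "i \<in> I" for f M i
  proof -
    have "deriv_bound F (P f) (sum c F * M)"
      unfolding deriv_bound_def
    proof (intro conjI ballI allI)
      show "0 \<le> sum c F * M" using 2(1) f(2) by (simp add: deriv_bound_def sum_nonneg)
      fix vs x assume vs: "vs \<in> F"
      have "deriv_bound (G vs) f M" using f(2) vs by (auto simp: deriv_bound_def)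
      from 2(3)[OF f(1) this] have "norm (dds vs (P f) x) \<le> c vs * M" .
      also have "\<dots> \<le> sum c F * M"
        using f(2) vs 1(2) 2(1) by (intro mult_right_mono member_le_sum) (auto simp: deriv_bound_def)
      finally show "norm (dds vs (P f) x) \<le> sum c F * M" .
    qed
    then show ?thesis using 1(3)[OF R'[OF f(1)] _ f(3)] by (simp add: mult.assoc)
  qed
  then show "\<exists>C F. 0 \<le> C \<and> finite F \<and>
     (\<forall>f\<in>box_supported S R. \<forall>M. deriv_bound F f M \<longrightarrow> (\<forall>i\<in>I. norm (T i (P f)) \<le> C * M))"
    using 1 2 by (intro exI[of _ "C * sum c F"] exI[of _ "\<Union>(G ` F)"]) (auto simp: sum_nonneg)
qed

lemma lin_functional_add: "lin_functional S T \<Longrightarrow> lin_functional S U \<Longrightarrow> lin_functional S (\<lambda>f. T f + U f)"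
  unfolding lin_functional_def by (simp add: distrib_left)

lemma lin_functional_scale: "lin_functional S T \<Longrightarrow> lin_functional S (\<lambda>f. c * T f)"
  unfolding lin_functional_def by (simp add: algebra_simps)

lemma lin_functional_zero: "lin_functional S (\<lambda>f. 0)"
  unfolding lin_functional_def by simp

lemma lin_functional_sum: "finite J \<Longrightarrow> (\<And>j. j \<in> J \<Longrightarrow> lin_functional S (T j)) \<Longrightarrow> lin_functional S (\<lambda>f. \<Sum>j\<in>J. T j f)"
  by (induction J rule: finite_induct) (auto simp: lin_functional_zero intro: lin_functional_add)

lemma lin_functional_comp:
  assumes "controlled_op S S' P" "lin_functional S' T" shows "lin_functional S (\<lambda>f. T (P f))"
  unfolding lin_functional_def
proof (intro allI ballI conjI)
  fix R f assume f: "f \<in> box_supported S R"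
  obtain R' where R': "\<And>f. f \<in> box_supported S R \<Longrightarrow> P f \<in> box_supported S' R'" using assms(1) unfolding controlled_op_def by metis
  show "T (P (\<lambda>x. c * f x)) = c * T (P f)" for c
    using controlled_op_scale[OF assms(1) f] lin_functional_scaleD[OF assms(2) R'[OF f]] by simp
  show "T (P (\<lambda>x. f x + g x)) = T (P f) + T (P g)" if "g \<in> box_supported S R" for g
    using controlled_op_add[OF assms(1) f that] lin_functional_addD[OF assms(2) R'[OF f] R'[OF that]] by simp
qed

subsection \<open>Asymptotic expansions with uniform remainders\<close>

text \<open>Scaled by \<open>k\<^sup>N / k\<^sup>d\<close>: uniform boundedness in \<open>k \<ge> 1\<close> is the error bound \<open>O(k\<^sup>d\<^sup>-\<^sup>N)\<close>.\<close>

definition remainder :: "nat \<Rightarrow> nat \<Rightarrow> (nat \<Rightarrow> ('a \<Rightarrow> complex) \<Rightarrow> complex) \<Rightarrow>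
    (nat \<Rightarrow> int \<Rightarrow> ('a \<Rightarrow> complex) \<Rightarrow> complex) \<Rightarrow> nat \<Rightarrow> ('a \<Rightarrow> complex) \<Rightarrow> complex" where
  "remainder d N A \<theta> k f =
     of_nat k ^ N / of_nat k ^ d * A k f - (\<Sum>n<N. of_nat k ^ (N - n) * \<theta> n (int k) f)"

definition coeffs_ok :: "'a set \<Rightarrow> (nat \<Rightarrow> int \<Rightarrow> ('a \<Rightarrow> complex) \<Rightarrow> complex) \<Rightarrow> bool" where
  "coeffs_ok S \<theta> \<longleftrightarrow> (\<forall>n. int_periodic (\<theta> n) \<and> controlled S UNIV (\<theta> n) \<and> (\<forall>k. lin_functional S (\<theta> n k)))"

text \<open>The exponent \<open>d\<close> only bounds the order of growth from above, since leading
  coefficients may vanish. The requirement at \<open>N = 0\<close> says that \<open>A k f\<close> is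
  of order \<open>k ^ d\<close>.\<close>

definition expands :: "'a set \<Rightarrow> nat \<Rightarrow> (nat \<Rightarrow> ('a \<Rightarrow> complex) \<Rightarrow> complex) \<Rightarrow> bool" where
  "expands S d A \<longleftrightarrow> (\<exists>\<theta>. coeffs_ok S \<theta> \<and> (\<forall>N. controlled S {1..} (remainder d N A \<theta>)))"

lemma expands_cong:
  assumes "expands S d A" "\<And>R k f. k \<ge> 1 \<Longrightarrow> f \<in> box_supported S R \<Longrightarrow> A' k f = A k f"
  shows "expands S d A'"
proof -
  obtain \<theta> where \<theta>: "coeffs_ok S \<theta>" "\<And>N. controlled S {1..} (remainder d N A \<theta>)"
    using assms(1) unfolding expands_def by auto
  have "controlled S {1..} (remainder d N A' \<theta>)" for N
    by (rule controlled_cong[OF \<theta>(2)]) (use assms(2) in \<open>auto simp: remainder_def\<close>)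
  with \<theta>(1) show ?thesis unfolding expands_def by blast
qed

lemma expands_comp:
  assumes "controlled_op S S' P" "expands S' d A" shows "expands S d (\<lambda>k f. A k (P f))"
proof -
  obtain \<theta> where \<theta>: "coeffs_ok S' \<theta>" "\<And>N. controlled S' {1..} (remainder d N A \<theta>)"
    using assms(2) unfolding expands_def by auto
  have "coeffs_ok S (\<lambda>n k f. \<theta> n k (P f))"
    using \<theta>(1) controlled_comp[OF assms(1)] lin_functional_comp[OF assms(1)]
    unfolding coeffs_ok_def by (auto intro: int_periodic_comp[where h = "\<lambda>T f. T (P f)"])
  moreover have "controlled S {1..} (remainder d N (\<lambda>k f. A k (P f)) (\<lambda>n k f. \<theta> n k (P f)))" for N
    using controlled_comp[OF assms(1) \<theta>(2)[of N]] by (simp add: remainder_def[abs_def])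
  ultimately show ?thesis unfolding expands_def by blast
qed

lemma expands_add:
  assumes "expands S d A" "expands S d A'" shows "expands S d (\<lambda>k f. A k f + A' k f)"
proof -
  obtain \<theta> \<theta>' where \<theta>: "coeffs_ok S \<theta>" "\<And>N. controlled S {1..} (remainder d N A \<theta>)"
    and \<theta>': "coeffs_ok S \<theta>'" "\<And>N. controlled S {1..} (remainder d N A' \<theta>')"
    using assms unfolding expands_def by metis
  have "coeffs_ok S (\<lambda>n k f. \<theta> n k f + \<theta>' n k f)"
    using \<theta>(1) \<theta>'(1) unfolding coeffs_ok_def
    by (auto intro: int_periodic_op2[where h = "\<lambda>T U f. T f + U f"] controlled_add lin_functional_add)
  moreover have "controlled S {1..} (remainder d N (\<lambda>k f. A k f + A' k f) (\<lambda>n k f. \<theta> n k f + \<theta>' n k f))" for N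
    by (rule controlled_cong[OF controlled_add[OF \<theta>(2)[of N] \<theta>'(2)[of N]]])
      (simp add: remainder_def distrib_left sum.distrib)
  ultimately show ?thesis unfolding expands_def by blast
qed

lemma expands_scale:
  assumes "expands S d A" shows "expands S d (\<lambda>k f. c * A k f)"
proof -
  obtain \<theta> where \<theta>: "coeffs_ok S \<theta>" "\<And>N. controlled S {1..} (remainder d N A \<theta>)"
    using assms unfolding expands_def by metis
  have "coeffs_ok S (\<lambda>n k f. c * \<theta> n k f)"
    using \<theta>(1) unfolding coeffs_ok_def
    by (auto intro: int_periodic_comp[where h = "\<lambda>T f. c * T f"] controlled_scale lin_functional_scale)
  moreover have "controlled S {1..} (remainder d N (\<lambda>k f. c * A k f) (\<lambda>n k f. c * \<theta> n k f))" for N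
    by (rule controlled_cong[OF controlled_scale[OF \<theta>(2)[of N], of "\<lambda>_. c" "norm c"]])
      (auto simp: remainder_def right_diff_distrib sum_distrib_left mult_ac)
  ultimately show ?thesis unfolding expands_def by blast
qed

lemma expands_zero: "expands S d (\<lambda>k f. 0)"
proof -
  have "coeffs_ok S (\<lambda>n k f. 0)" by (simp add: coeffs_ok_def int_periodic_const controlled_zero lin_functional_zero)
  moreover have "controlled S {1..} (remainder d N (\<lambda>k f. 0) (\<lambda>n k f. 0))" for N
    using controlled_zero by (simp add: remainder_def[abs_def])
  ultimately show ?thesis unfolding expands_def by blast
qed

lemma expands_sum: "finite J \<Longrightarrow> (\<And>j. j \<in> J \<Longrightarrow> expands S d (A j)) \<Longrightarrow> expands S d (\<lambda>k f. \<Sum>j\<in>J. A j k f)"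
  by (induction J rule: finite_induct) (auto simp: expands_zero intro: expands_add)

lemma expands_times_k:
  assumes "expands S d A" shows "expands S (Suc d) (\<lambda>k f. of_nat k * A k f)"
proof -
  obtain \<theta> where \<theta>: "coeffs_ok S \<theta>" "\<And>N. controlled S {1..} (remainder d N A \<theta>)"
    using assms unfolding expands_def by metis
  have "controlled S {1..} (remainder (Suc d) N (\<lambda>k f. of_nat k * A k f) \<theta>)" for N
    by (rule controlled_cong[OF \<theta>(2)[of N]]) (auto simp: remainder_def)
  with \<theta>(1) show ?thesis unfolding expands_def by blast
qed

text \<open>The coefficients are shifted by one place, with leading coefficient 0. Expansions of
  different orders can thereby be brought to a common \<open>d\<close> before they are
  added.\<close>

lemma expands_Suc:
  assumes "expands S d A" shows "expands S (Suc d) A"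
proof -
  obtain \<theta> where \<theta>: "coeffs_ok S \<theta>" "\<And>N. controlled S {1..} (remainder d N A \<theta>)"
    using assms unfolding expands_def by metis
  let ?\<theta> = "\<lambda>n. case n of 0 \<Rightarrow> (\<lambda>k f. 0) | Suc m \<Rightarrow> \<theta> m"
  have "coeffs_ok S ?\<theta>"
    using \<theta>(1) by (auto simp: coeffs_ok_def int_periodic_const controlled_zero lin_functional_zero split: nat.split)
  moreover have "controlled S {1..} (remainder (Suc d) N A ?\<theta>)" for N
  proof (cases N)
    case 0
    have "controlled S {1..} (\<lambda>k f. (1 / of_nat k) * remainder d 0 A \<theta> k f)"
      by (rule controlled_scale[OF \<theta>(2), where K = 1]) (auto simp: norm_divide)
    then show ?thesis by (rule controlled_cong) (simp add: 0 remainder_def)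
  next
    case (Suc M)
    show ?thesis
      by (rule controlled_cong[OF \<theta>(2)[of M]])
        (auto simp: Suc remainder_def sum.lessThan_Suc_shift simp del: sum.lessThan_Suc)
  qed
  ultimately show ?thesis unfolding expands_def by blast
qed

lemma expands_mono: "d \<le> d' \<Longrightarrow> expands S d A \<Longrightarrow> expands S d' A"
  by (induction d' rule: dec_induct) (auto intro: expands_Suc)

text \<open>If \<open>A\<close> is an asymptotic series in the terms \<open>E r / k ^ r\<close> and
  each \<open>E r\<close> expands in turn, the double series is regrouped along
  \<open>r + m = n\<close>. Each new coefficient is a finite sum, so periodicity, linearity and
  bounds survive.\<close>

lemma expands_diagonal:
  assumes E: "\<And>r. expands S d (E r)"
    and rem: "\<And>N. controlled S {1..} (\<lambda>k f. of_nat k ^ N / of_nat k ^ d * A k f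
                 - (\<Sum>r\<le>N. of_nat k ^ (N - r) / of_nat k ^ d * E r k f))"
  shows "expands S d A"
proof -
  have "\<forall>r. \<exists>\<theta>. coeffs_ok S \<theta> \<and> (\<forall>N. controlled S {1..} (remainder d N (E r) \<theta>))"
    using E unfolding expands_def by blast
  then obtain \<theta> where \<theta>: "\<And>r. coeffs_ok S (\<theta> r)" "\<And>r N. controlled S {1..} (remainder d N (E r) (\<theta> r))"
    by metis
  let ?\<theta> = "\<lambda>n k f. \<Sum>r\<le>n. \<theta> r (n - r) k f"
  have "coeffs_ok S ?\<theta>"
    using \<theta>(1) unfolding coeffs_ok_def by (auto intro!: int_periodic_sum controlled_sum lin_functional_sum)
  moreover have "controlled S {1..} (remainder d N A ?\<theta>)" for N
  proof (rule controlled_cong[OF controlled_add[OF rem[of N] controlled_sum[of "{..N}", OF finite_atMost \<theta>(2)]]])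
    fix k f R assume k: "k \<in> {1::nat..}"
    have "(\<Sum>n<N. of_nat k ^ (N - n) * ?\<theta> n (int k) f)
        = (\<Sum>n<N. \<Sum>r\<le>n. of_nat k ^ (N - r - (n - r)) * \<theta> r (n - r) (int k) f)"
      by (auto simp: sum_distrib_left intro!: sum.cong)
    also have "\<dots> = (\<Sum>(r, m)\<in>{(r, m). r + m < N}. of_nat k ^ (N - r - m) * \<theta> r m (int k) f)"
      by (rule sum.triangle_reindex[symmetric])
    \<comment> \<open>The row \<open>r = N\<close> is empty here, but it is kept because the
      hypothesis subtracts the term \<open>E N\<close>; its remainder of order 0 merely bounds
      \<open>E N / k ^ d\<close>.\<close>
    also have "{(r, m). r + m < N} = Sigma {..N} (\<lambda>r. {..<N - r})" by auto
    also have "(\<Sum>(r, m)\<in>\<dots>. of_nat k ^ (N - r - m) * \<theta> r m (int k) f)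
        = (\<Sum>r\<le>N. \<Sum>m<N - r. of_nat k ^ (N - r - m) * \<theta> r m (int k) f)"
      by (subst sum.Sigma) auto
    finally show "remainder d N A ?\<theta> k f = of_nat k ^ N / of_nat k ^ d * A k f
          - (\<Sum>r\<le>N. of_nat k ^ (N - r) / of_nat k ^ d * E r k f)
          + (\<Sum>r\<le>N. remainder d (N - r) (E r) (\<theta> r) k f)"
      by (simp add: remainder_def sum_subtractf)
  qed
  ultimately show ?thesis unfolding expands_def by blast
qed

end

section \<open>Residue classes and common denominators\<close>

lemma sum_lessThan_mult:
  fixes F :: "nat \<Rightarrow> 'b::comm_monoid_add"
  shows "(\<Sum>n<D * I. F n) = (\<Sum>e<D. \<Sum>i<I. F (e + D * i))"
proof -
  have "(\<Sum>n<D * I. F n) = (\<Sum>i<I. \<Sum>n\<in>{i * D..<i * D + D}. F n)"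
    by (simp add: sum.nat_group mult.commute)
  also have "\<dots> = (\<Sum>i<I. \<Sum>e<D. F (e + D * i))"
  proof (rule sum.cong[OF refl])
    fix i
    have "(\<Sum>n\<in>{0 + i * D..<D + i * D}. F n) = (\<Sum>e\<in>{0..<D}. F (e + i * D))"
      by (rule sum.shift_bounds_nat_ivl)
    then show "(\<Sum>n\<in>{i * D..<i * D + D}. F n) = (\<Sum>e<D. F (e + D * i))"
      by (simp add: atLeast0LessThan add.commute mult.commute)
  qed
  also have "\<dots> = (\<Sum>e<D. \<Sum>i<I. F (e + D * i))" by (rule sum.swap)
  finally show ?thesis .
qed

lemma common_denominator:
  assumes "finite A" "A \<subseteq> \<rat>"
  shows "\<exists>Q>0. \<forall>a\<in>A. of_int Q * a \<in> (\<int> :: real set)"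
  using assms
proof (induction A rule: finite_induct)
  case (insert a A)
  then obtain Q where Q: "Q > 0" "\<And>a. a \<in> A \<Longrightarrow> of_int Q * a \<in> (\<int> :: real set)" by auto
  from insert obtain m n :: int where a: "n > 0" "a = of_int m / of_int n"
    by (auto elim: Rats_cases')
  have "of_int (Q * n) * c \<in> (\<int> :: real set)" if "c \<in> insert a A" for c
  proof (cases "c = a")
    case True
    then have "of_int (Q * n) * c = of_int (Q * m)" using a by simp
    then show ?thesis by (metis Ints_of_int)
  next
    case False
    then have "of_int n * (of_int Q * c) \<in> (\<int> :: real set)" using that Q(2) by auto
    then show ?thesis by (simp add: mult_ac)
  qed
  then show ?case using Q(1) a(1) by (intro exI[of _ "Q * n"]) auto
qed (auto intro: exI[of _ 1])

context lattice_basis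
begin

subsection \<open>Lattice points\<close>

definition lat :: "'a set \<Rightarrow> 'a set" where
  "lat S = {x. \<forall>b\<in>B. (b \<in> S \<longrightarrow> crd b x \<in> \<int>) \<and> (b \<notin> S \<longrightarrow> crd b x = 0)}"

definition box :: "'a set \<Rightarrow> real \<Rightarrow> 'a set" where
  "box S K = {x\<in>lat S. \<forall>b\<in>S. \<bar>crd b x\<bar> \<le> K}"

lemma lat_add: "x \<in> lat S \<Longrightarrow> y \<in> lat S \<Longrightarrow> x + y \<in> lat S"
  by (auto simp: lat_def crd_add)

lemma lat_scale: "x \<in> lat S \<Longrightarrow> of_int j *\<^sub>R x \<in> lat S"
  by (auto simp: lat_def crd_scale)

lemma lat_basis: "b \<in> B \<Longrightarrow> b \<in> S \<Longrightarrow> b \<in> lat S"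
  by (auto simp: lat_def crd_basis)

lemma lat_minus: "x \<in> lat S \<Longrightarrow> - x \<in> lat S"
  by (auto simp: lat_def crd_minus)

lemma lat_mono: "S \<subseteq> T \<Longrightarrow> lat S \<subseteq> lat T"
  by (auto simp: lat_def)

lemma lat_B: "lat B = {\<Sum>b\<in>B. of_int (c b) *\<^sub>R b | c :: 'a \<Rightarrow> int. True}"
proof (intro set_eqI iffI)
  fix x assume x: "x \<in> lat B"
  then have "x = (\<Sum>b\<in>B. of_int \<lfloor>crd b x\<rfloor> *\<^sub>R b)"
    by (subst crd_expand[of x, symmetric]) (auto simp: lat_def intro!: sum.cong elim!: Ints_cases)
  then show "x \<in> {\<Sum>b\<in>B. of_int (c b) *\<^sub>R b | c :: 'a \<Rightarrow> int. True}"
    by (intro CollectI exI[of _ "\<lambda>b. \<lfloor>crd b x\<rfloor>"]) simp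
next
  fix x assume "x \<in> {\<Sum>b\<in>B. of_int (c b) *\<^sub>R b | c :: 'a \<Rightarrow> int. True}"
  then obtain c :: "'a \<Rightarrow> int" where x: "x = (\<Sum>b\<in>B. of_int (c b) *\<^sub>R b)" by auto
  have "crd b x = of_int (c b)" if "b \<in> B" for b
    using that finite_B by (simp add: x crd_sum crd_scale crd_basis if_distrib cong: if_cong)
  then show "x \<in> lat B" by (auto simp: lat_def)
qed

text \<open>Both orientations of the new coordinate are allowed because the elimination step directs
  \<open>v\<close> so that the inequality bounds \<open>j\<close> from below.\<close>

lemma box_insert:
  assumes b: "b \<in> B" "b \<notin> S" and v: "v = b \<or> v = - b"
  shows "bij_betw (\<lambda>(x, j). x + of_int j *\<^sub>R v) (box S K \<times> {j::int. \<bar>of_int j\<bar> \<le> K}) (box (insert b S) K)"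
proof -
  define \<sigma> :: int where "\<sigma> = (if v = b then 1 else - 1)"
  have \<sigma>: "\<sigma> * \<sigma> = 1" "\<bar>\<sigma>\<bar> = 1" "v = of_int \<sigma> *\<^sub>R b" using v by (auto simp: \<sigma>_def)
  have \<sigma>r: "real_of_int \<sigma> * (real_of_int \<sigma> * r) = r" "\<bar>real_of_int \<sigma> * r\<bar> = \<bar>r\<bar>" for r
    using \<sigma>(1,2) by (auto simp: mult.assoc[symmetric] abs_mult \<sigma>_def)
  have cb: "crd b v = of_int \<sigma>" using b \<sigma>(3) by (simp add: crd_scale crd_basis)
  have cv: "crd c v = 0" if "c \<noteq> b" for c using that b \<sigma>(3) by (simp add: crd_scale crd_basis)
  show ?thesis
  proof (rule bij_betwI[where g = "\<lambda>y. (y - crd b y *\<^sub>R b, \<sigma> * \<lfloor>crd b y\<rfloor>)"])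
    show "(\<lambda>(x, j). x + of_int j *\<^sub>R v) \<in> box S K \<times> {j. \<bar>of_int j\<bar> \<le> K} \<rightarrow> box (insert b S) K"
    proof (clarify)
      fix x and j :: int assume x: "x \<in> box S K" and j: "\<bar>real_of_int j\<bar> \<le> K"
      have xb: "crd b x = 0" using x b by (auto simp: box_def lat_def)
      then have "crd b (x + of_int j *\<^sub>R v) = of_int (\<sigma> * j)" by (simp add: crd_add crd_scale cb)
      moreover have "crd c (x + of_int j *\<^sub>R v) = crd c x" if "c \<noteq> b" for c
        using that by (simp add: crd_add crd_scale cv)
      ultimately show "x + of_int j *\<^sub>R v \<in> box (insert b S) K"
        using x j b \<sigma>r(2)[of "of_int j"] unfolding box_def lat_def
        by (auto split: if_splits) (metis Ints_of_int of_int_mult)+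
    qed
    show "(\<lambda>y. (y - crd b y *\<^sub>R b, \<sigma> * \<lfloor>crd b y\<rfloor>)) \<in> box (insert b S) K \<rightarrow> box S K \<times> {j. \<bar>of_int j\<bar> \<le> K}"
    proof
      fix y assume y: "y \<in> box (insert b S) K"
      have "crd b y \<in> \<int>" using y b by (auto simp: box_def lat_def)
      then have "of_int \<lfloor>crd b y\<rfloor> = crd b y" by (auto elim: Ints_cases)
      moreover have "crd b (y - crd b y *\<^sub>R b) = 0" using b by (simp add: crd_diff crd_scale crd_basis)
      moreover have "crd c (y - crd b y *\<^sub>R b) = crd c y" if "c \<noteq> b" for c
        using that b by (simp add: crd_diff crd_scale crd_basis)
      ultimately show "(y - crd b y *\<^sub>R b, \<sigma> * \<lfloor>crd b y\<rfloor>) \<in> box S K \<times> {j. \<bar>of_int j\<bar> \<le> K}"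
        using y b \<sigma>r(2)[of "crd b y"] unfolding box_def lat_def by (auto; metis)
    qed
    show "(\<lambda>y. (y - crd b y *\<^sub>R b, \<sigma> * \<lfloor>crd b y\<rfloor>)) (case p of (x, j) \<Rightarrow> x + of_int j *\<^sub>R v) = p"
      if "p \<in> box S K \<times> {j. \<bar>of_int j\<bar> \<le> K}" for p
    proof -
      obtain x j where p: "p = (x, j)" "x \<in> box S K" using \<open>p \<in> _\<close> by auto
      have "crd b x = 0" using p(2) b by (auto simp: box_def lat_def)
      then have *: "crd b (x + of_int j *\<^sub>R v) = of_int (\<sigma> * j)" by (simp add: crd_add crd_scale cb)
      then have "\<lfloor>crd b (x + of_int j *\<^sub>R v)\<rfloor> = \<sigma> * j" by (simp only: floor_of_int)
      with * show ?thesis using \<sigma>(1) by (simp add: p(1) \<sigma>(3) mult.assoc[symmetric] mult.commute)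
    qed
    show "(\<lambda>(x, j). x + of_int j *\<^sub>R v) (y - crd b y *\<^sub>R b, \<sigma> * \<lfloor>crd b y\<rfloor>) = y" if "y \<in> box (insert b S) K" for y
    proof -
      have "crd b y \<in> \<int>" using that b by (auto simp: box_def lat_def)
      then have fl: "real_of_int \<lfloor>crd b y\<rfloor> = crd b y" by (auto elim: Ints_cases)
      have "real_of_int (\<sigma> * \<lfloor>crd b y\<rfloor>) * of_int \<sigma> = crd b y"
        using \<sigma>r(1)[of "crd b y"] unfolding of_int_mult fl by (simp only: mult_ac)
      then have "real_of_int (\<sigma> * \<lfloor>crd b y\<rfloor>) *\<^sub>R v = crd b y *\<^sub>R b"
        unfolding \<sigma>(3) scaleR_scaleR by (rule arg_cong)
      then show ?thesis by simp
    qed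
  qed
qed

lemma finite_abs_int_le: "finite {j::int. \<bar>of_int j\<bar> \<le> (K::real)}"
  by (rule finite_subset[of _ "{-\<lfloor>K\<rfloor>..\<lfloor>K\<rfloor>}"]) (auto simp: le_floor_iff abs_le_iff, linarith)

lemma card_abs_int_le:
  assumes "K \<ge> (0::real)" shows "real (card {j::int. \<bar>of_int j\<bar> \<le> K}) \<le> 2 * K + 1"
proof -
  have "card {j::int. \<bar>of_int j\<bar> \<le> K} \<le> card {-\<lfloor>K\<rfloor>..\<lfloor>K\<rfloor>}"
    by (rule card_mono) (simp, auto simp: le_floor_iff abs_le_iff, linarith)
  also have "real \<dots> = of_int (2 * \<lfloor>K\<rfloor> + 1)" using assms by simp
  also have "\<dots> \<le> 2 * K + 1" by simp
  finally show ?thesis by simp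
qed

lemma lat_empty: "lat {} = {0}"
proof -
  have "x = 0" if "x \<in> lat {}" for x by (rule crd_eqI) (use that in \<open>auto simp: lat_def\<close>)
  then show ?thesis by (auto simp: lat_def)
qed

lemma box_finite_card:
  assumes "S \<subseteq> B"
  shows "finite (box S K) \<and> (0 \<le> K \<longrightarrow> real (card (box S K)) \<le> (2 * K + 1) ^ card S)"
proof -
  have "finite S" using assms finite_B finite_subset by blast
  then show ?thesis using assms
  proof (induction S rule: finite_induct)
    case empty
    have "box {} K = {0}" by (auto simp: box_def lat_empty)
    then show ?case by simp
  next
    case (insert b S)
    then have IH: "finite (box S K)" "0 \<le> K \<Longrightarrow> real (card (box S K)) \<le> (2 * K + 1) ^ card S" by auto
    have bij: "bij_betw (\<lambda>(x, j). x + of_int j *\<^sub>R b) (box S K \<times> {j::int. \<bar>of_int j\<bar> \<le> K}) (box (insert b S) K)"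
      by (rule box_insert) (use insert in auto)
    have "finite (box (insert b S) K)"
      using bij_betw_finite[OF bij] IH(1) finite_abs_int_le by auto
    moreover have "real (card (box (insert b S) K)) \<le> (2 * K + 1) ^ card (insert b S)" if K: "0 \<le> K"
    proof -
      have "real (card (box (insert b S) K)) = real (card (box S K)) * real (card {j::int. \<bar>of_int j\<bar> \<le> K})"
        using bij_betw_same_card[OF bij] by (metis card_cartesian_product of_nat_mult)
      also have "\<dots> \<le> (2 * K + 1) ^ card S * (2 * K + 1)"
        using K IH(2) card_abs_int_le[OF K] by (intro mult_mono) auto
      finally show ?thesis using insert by (simp add: mult.commute)
    qed
    ultimately show ?case by simp
  qed
qed

lemma finite_box: "S \<subseteq> B \<Longrightarrow> finite (box S K)"
  using box_finite_card by blast

lemma card_box: "S \<subseteq> B \<Longrightarrow> 0 \<le> K \<Longrightarrow> real (card (box S K)) \<le> (2 * K + 1) ^ card S"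
  using box_finite_card by blast

subsection \<open>Weighted lattice sums\<close>

definition lattice_sum :: "'a set \<Rightarrow> ('a \<Rightarrow> int \<Rightarrow> complex) \<Rightarrow> nat \<Rightarrow> ('a \<Rightarrow> complex) \<Rightarrow> complex" where
  "lattice_sum S w k f = (\<Sum>\<^sub>\<infinity>x\<in>lat S. w x (int k) * f (x /\<^sub>R real k))"

lemma lattice_sum_box:
  assumes "S \<subseteq> B" "f \<in> box_supported S R" "k \<ge> 1" "K \<ge> R * real k"
  shows "lattice_sum S w k f = (\<Sum>x\<in>box S K. w x (int k) * f (x /\<^sub>R real k))"
proof -
  have "lattice_sum S w k f = (\<Sum>\<^sub>\<infinity>x\<in>box S K. w x (int k) * f (x /\<^sub>R real k))"
    unfolding lattice_sum_def
  proof (rule infsum_cong_neutral)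
    fix x assume "x \<in> lat S - box S K"
    then obtain b where b: "b \<in> S" "\<bar>crd b x\<bar> > K" by (force simp: box_def)
    then have "R < \<bar>crd b x\<bar> / real k" using assms by (simp add: field_simps)
    also have "\<dots> = \<bar>crd b (x /\<^sub>R real k)\<bar>" by (simp add: crd_scale abs_mult divide_inverse mult.commute)
    finally have "f (x /\<^sub>R real k) = 0" using assms(2) b(1) by (auto intro: box_supported_zero)
    then show "w x (int k) * f (x /\<^sub>R real k) = 0" by simp
  qed (auto simp: box_def)
  then show ?thesis using finite_box[OF assms(1)] by simp
qed

lemma lattice_sum_add:
  assumes "S \<subseteq> B" "f \<in> box_supported S R" "k \<ge> 1"
  shows "lattice_sum S (\<lambda>x k. w x k + w' x k) k f = lattice_sum S w k f + lattice_sum S w' k f"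
  using assms by (simp add: lattice_sum_box[OF assms order_refl] distrib_right sum.distrib)

lemma lattice_sum_scale:
  assumes "S \<subseteq> B" "f \<in> box_supported S R" "k \<ge> 1"
  shows "lattice_sum S (\<lambda>x k. c * w x k) k f = c * lattice_sum S w k f"
  using assms by (simp add: lattice_sum_box[OF assms order_refl] sum_distrib_left mult.assoc)

text \<open>The exponent \<open>card S\<close> is the growth rate of the number of lattice points
  \<open>x\<close> for which \<open>x /\<^sub>R real k\<close> lies in a fixed box.\<close>

definition good :: "'a set \<Rightarrow> ('a \<Rightarrow> int \<Rightarrow> complex) \<Rightarrow> bool" where
  "good S w \<longleftrightarrow> expands S (card S) (lattice_sum S w)"

lemma good_add: "S \<subseteq> B \<Longrightarrow> good S w \<Longrightarrow> good S w' \<Longrightarrow> good S (\<lambda>x k. w x k + w' x k)"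
  unfolding good_def by (erule (1) expands_cong[OF expands_add]) (rule lattice_sum_add)

lemma good_scale: "S \<subseteq> B \<Longrightarrow> good S w \<Longrightarrow> good S (\<lambda>x k. c * w x k)"
  unfolding good_def by (erule expands_cong[OF expands_scale]) (rule lattice_sum_scale)

lemma good_diff: "S \<subseteq> B \<Longrightarrow> good S w \<Longrightarrow> good S w' \<Longrightarrow> good S (\<lambda>x k. w x k - w' x k)"
  using good_add[of S w "\<lambda>x k. (-1) * w' x k"] good_scale[of S w' "-1"] by simp

lemma good_cong:
  assumes "good S w" "\<And>x k. x \<in> lat S \<Longrightarrow> k \<ge> 1 \<Longrightarrow> w' x k = w x k"
  shows "good S w'"
  using assms(1) unfolding good_def
  by (rule expands_cong) (auto simp: lattice_sum_def assms(2) intro!: infsum_cong)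

subsection \<open>Periodic weights and rational inequalities\<close>

definition weight_periodic :: "('a \<Rightarrow> int \<Rightarrow> complex) \<Rightarrow> bool" where
  "weight_periodic \<eta> \<longleftrightarrow> (\<exists>D>0. \<forall>x\<in>lat B. \<forall>y\<in>lat B. \<forall>k l. \<eta> (x + of_int D *\<^sub>R y) (k + D * l) = \<eta> x k)"

definition rat_ineqs :: "(('a \<Rightarrow> real) \<times> real) set" where
  "rat_ineqs = {(f, \<beta>). linear f \<and> f ` lat B \<subseteq> \<rat> \<and> \<beta> \<in> \<rat>}"

text \<open>The inequalities are homogenized by \<open>k\<close>, so for \<open>k \<ge> 1\<close>
  they describe the points with \<open>x /\<^sub>R k\<close> in the polyhedron. Lists make the
  number of inequalities available as an induction measure.\<close>

definition ineq_indicator :: "(('a \<Rightarrow> real) \<times> real) list \<Rightarrow> 'a \<Rightarrow> int \<Rightarrow> complex" where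
  "ineq_indicator H x k = (if \<forall>(f, \<beta>)\<in>set H. f x \<le> \<beta> * of_int k then 1 else 0)"

lemma ineq_indicator_Cons: "ineq_indicator ((f, \<beta>) # H) x k = (if f x \<le> \<beta> * of_int k then 1 else 0) * ineq_indicator H x k"
  by (auto simp: ineq_indicator_def)

lemma weight_periodic_multiple:
  assumes "weight_periodic \<eta>"
  obtains D where "D > 0"
    "\<And>x y k l m. x \<in> lat B \<Longrightarrow> y \<in> lat B \<Longrightarrow> \<eta> (x + of_int (D * m) *\<^sub>R y) (k + D * m * l) = \<eta> x k"
proof -
  obtain D where D: "D > 0" "\<And>x y k l. x \<in> lat B \<Longrightarrow> y \<in> lat B \<Longrightarrow> \<eta> (x + of_int D *\<^sub>R y) (k + D * l) = \<eta> x k"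
    using assms unfolding weight_periodic_def by metis
  have "\<eta> (x + of_int (D * m) *\<^sub>R y) (k + D * m * l) = \<eta> x k" if "x \<in> lat B" "y \<in> lat B" for x y k l m
    using D(2)[of x "of_int m *\<^sub>R y" k "m * l"] that lat_scale[of y B m] by (simp add: mult.assoc)
  with D(1) show thesis by (rule that)
qed

lemma weight_periodic_mult:
  assumes "weight_periodic \<eta>" "weight_periodic \<psi>" shows "weight_periodic (\<lambda>x k. \<eta> x k * \<psi> x k)"
proof -
  from weight_periodic_multiple[OF assms(1)] obtain D where D: "D > 0"
    "\<And>x y k l m. x \<in> lat B \<Longrightarrow> y \<in> lat B \<Longrightarrow> \<eta> (x + of_int (D * m) *\<^sub>R y) (k + D * m * l) = \<eta> x k" by blast
  from weight_periodic_multiple[OF assms(2)] obtain E where E: "E > 0"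
    "\<And>x y k l m. x \<in> lat B \<Longrightarrow> y \<in> lat B \<Longrightarrow> \<psi> (x + of_int (E * m) *\<^sub>R y) (k + E * m * l) = \<psi> x k" by blast
  show ?thesis unfolding weight_periodic_def
    using D(1) E(1) D(2)[of _ _ E] E(2)[of _ _ D]
    by (intro exI[of _ "D * E"]) (auto simp: mult.commute[of E D])
qed

lemma weight_periodic_const: "weight_periodic (\<lambda>x k. c)"
  unfolding weight_periodic_def by (auto intro: exI[of _ 1])

text \<open>Reducing the integer coordinates and \<open>k\<close> modulo the period leaves finitely
  many values.\<close>

lemma weight_periodic_bounded:
  assumes "weight_periodic \<eta>"
  obtains K where "\<And>x k. x \<in> lat B \<Longrightarrow> norm (\<eta> x k) \<le> K"
proof -
  obtain D where D: "D > 0" "\<And>x y k l. x \<in> lat B \<Longrightarrow> y \<in> lat B \<Longrightarrow> \<eta> (x + of_int D *\<^sub>R y) (k + D * l) = \<eta> x k"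
    using assms unfolding weight_periodic_def by metis
  let ?A = "(\<lambda>(x, k). norm (\<eta> x k)) ` (box B (of_int D) \<times> {0..<D})"
  have "finite ?A" by (intro finite_imageI finite_cartesian_product finite_box) auto
  have "norm (\<eta> x k) \<in> ?A" if x: "x \<in> lat B" for x k
  proof -
    obtain c :: "'a \<Rightarrow> int" where c: "x = (\<Sum>b\<in>B. of_int (c b) *\<^sub>R b)" using x unfolding lat_B by auto
    let ?x0 = "\<Sum>b\<in>B. of_int (c b mod D) *\<^sub>R b" and ?y = "\<Sum>b\<in>B. of_int (c b div D) *\<^sub>R b"
    have lat: "?x0 \<in> lat B" "?y \<in> lat B"
      unfolding lat_B by (intro CollectI exI[of _ "\<lambda>b. c b mod D"] exI[of _ "\<lambda>b. c b div D"] conjI refl TrueI)+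
    have "x = ?x0 + of_int D *\<^sub>R ?y"
      unfolding c by (simp add: scaleR_sum_right sum.distrib[symmetric] scaleR_add_left[symmetric]
          of_int_mult[symmetric] of_int_add[symmetric] del: of_int_mult of_int_add)
    then have "\<eta> x k = \<eta> ?x0 (k mod D)" using D(2)[OF lat, of "k mod D" "k div D"] by simp
    moreover have "crd b ?x0 = of_int (c b mod D)" if "b \<in> B" for b
      using that finite_B by (simp add: crd_sum crd_scale crd_basis if_distrib cong: if_cong)
    then have "?x0 \<in> box B (of_int D)" using lat D(1)
      by (auto simp: box_def order_less_imp_le)
    moreover have "k mod D \<in> {0..<D}" using D(1) by simp
    ultimately show ?thesis by force
  qed
  then have "norm (\<eta> x k) \<le> Max ?A" if "x \<in> lat B" for x k
    using that \<open>finite ?A\<close> by (intro Max_ge) auto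
  then show thesis by (rule that)
qed

end

section \<open>Euler-Maclaurin summation along a lattice direction\<close>

text \<open>The one-variable formula is applied with step \<open>D / k\<close> to the iterated
  derivatives, along the line through \<open>z\<close>, of the ray integral of \<open>f\<close>; the
  first of them is \<open>- f\<close>. The bound refers to derivative \<open>Suc N\<close> of
  \<open>f\<close> because that of the ray integral is the ray integral of it.\<close>

lemma (in strip) tail_sum_expansion:
  fixes N D :: nat
  assumes R: "R \<ge> 0" and D: "D > 0"
  obtains C where "C \<ge> 0" and
    "\<And>f M k z \<xi> I. f \<in> V \<Longrightarrow> (\<And>x. norm (dds (replicate (Suc N) v) f x) \<le> M) \<Longrightarrow> k \<ge> (1::nat) \<Longrightarrow>
       0 \<le> \<xi> \<Longrightarrow> \<xi> \<le> 1 \<Longrightarrow> \<zeta> z + (\<xi> + real I) * (real D / real k) \<ge> R + 1 \<Longrightarrow>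
       norm ((\<Sum>i<I. f (z + ((\<xi> + real i) * (real D / real k)) *\<^sub>R v))
         - (\<Sum>m\<le>N. of_real (bern_poly m \<xi> * (real D / real k) ^ m * (real k / real D))
               * dds (replicate m v) (ray_integral v f) z)) \<le> C * M * (real k / real k ^ N)"
proof (rule Euler_Maclaurin_one_sided[of N])
  fix C assume C: "C \<ge> (0::real)" and EM: "\<And>g :: nat \<Rightarrow> real \<Rightarrow> complex. \<And>M a b h x I t.
      (\<And>n t. (g n has_vector_derivative g (Suc n) t) (at t)) \<Longrightarrow>
      (\<And>t. norm (g (Suc N) t) \<le> M) \<Longrightarrow>
      (\<And>n t. t \<ge> b \<Longrightarrow> g n t = 0) \<Longrightarrow> (\<And>n t. t \<le> a \<Longrightarrow> g (Suc n) t = 0) \<Longrightarrow>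
      h > 0 \<Longrightarrow> a \<le> b \<Longrightarrow> 0 \<le> x \<Longrightarrow> x \<le> 1 \<Longrightarrow> t + (x + real I) * h \<ge> b \<Longrightarrow>
      norm (h *\<^sub>R (\<Sum>i<I. g 1 (t + (x + real i) * h)) + (\<Sum>m\<le>N. (bern_poly m x * h ^ m) *\<^sub>R g m t))
        \<le> C * M * h ^ N * (b - a + 3 * h)"
  show thesis
  \<comment> \<open>The factor \<open>2 * R\<close> is the length of a chord of the strip,
    \<open>2 * R + 2\<close> the length of a window with margin 1 on either side, and
    \<open>3 * D\<close> bounds \<open>3 * ?h\<close>. The division by \<open>D\<close> and the
    factor \<open>k\<close> in the bound come from dividing by the step \<open>?h\<close>.\<close>
  proof (rule that[of "C * (2 * R) * real D ^ N * (2 * R + 2 + 3 * real D) / real D"])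
    show "0 \<le> C * (2 * R) * real D ^ N * (2 * R + 2 + 3 * real D) / real D"
      using C R by simp
    fix f M k z \<xi> and I :: nat
    assume f: "f \<in> V" and M: "\<And>x. norm (dds (replicate (Suc N) v) f x) \<le> M" and k: "k \<ge> (1::nat)"
      and \<xi>: "0 \<le> \<xi>" "\<xi> \<le> 1" and I: "\<zeta> z + (\<xi> + real I) * (real D / real k) \<ge> R + 1"
    let ?h = "real D / real k"
    let ?J = "ray_integral v f"
    define g where "g m \<tau> = dds (replicate m v) ?J (z + \<tau> *\<^sub>R v)" for m \<tau>
    have M0: "M \<ge> 0" using order_trans[OF norm_ge_zero M] .
    have h: "?h > 0" "?h \<le> real D" using k D by (auto simp: field_simps)
    have \<zeta>z: "\<zeta> (z + \<tau> *\<^sub>R v) = \<zeta> z + \<tau>" for \<tau> by (simp add: add scaleR \<zeta>v)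
    have gJ: "g m \<tau> = ray_integral v (dds (replicate m v) f) (z + \<tau> *\<^sub>R v)" for m \<tau>
      using f by (simp add: g_def dds_ray_integral)
    have gS: "g (Suc m) \<tau> = - dds (replicate m v) f (z + \<tau> *\<^sub>R v)" for m \<tau>
      using f by (simp add: g_def dds_ray_integral V_dds dd_ray_integral_self)
    have "norm (?h *\<^sub>R (\<Sum>i<I. g 1 (0 + (\<xi> + real i) * ?h)) + (\<Sum>m\<le>N. (bern_poly m \<xi> * ?h ^ m) *\<^sub>R g m 0))
        \<le> C * (2 * R * M) * ?h ^ N * ((R + 1 - \<zeta> z) - (- R - 1 - \<zeta> z) + 3 * ?h)"
    proof (rule EM)
      show "(g n has_vector_derivative g (Suc n) t) (at t)" for n t
        using dir_smooth_derivative[OF dir_smooth_dds[OF dir_smooth_ray_integral[OF f], of "replicate n v"], of z v t]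
        by (simp add: g_def[abs_def])
      show "norm (g (Suc N) t) \<le> 2 * R * M" for t
        unfolding gJ using ray_integral_bound[OF V_dds[OF f] M] R by simp
      show "g n t = 0" if "t \<ge> R + 1 - \<zeta> z" for n t
        unfolding gJ by (rule ray_integral_eq_0[OF V_dds[OF f]]) (use that \<zeta>z in auto)
      show "g (Suc n) t = 0" if "t \<le> - R - 1 - \<zeta> z" for n t
        using zero_off[OF V_dds[OF f], of t z "replicate n v"] that by (simp add: gS)
    qed (use h \<xi> R I in auto)
    also have "?h *\<^sub>R (\<Sum>i<I. g 1 (0 + (\<xi> + real i) * ?h)) = - (?h *\<^sub>R (\<Sum>i<I. f (z + ((\<xi> + real i) * ?h) *\<^sub>R v)))"
      by (simp add: gS sum_negf)
    also have "(\<Sum>m\<le>N. (bern_poly m \<xi> * ?h ^ m) *\<^sub>R g m 0)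
        = ?h *\<^sub>R (\<Sum>m\<le>N. of_real (bern_poly m \<xi> * ?h ^ m * (real k / real D)) * dds (replicate m v) ?J z)"
      unfolding scaleR_sum_right using k D
      by (intro sum.cong refl) (simp add: g_def scaleR_conv_of_real)
    finally have bd: "norm (- (?h *\<^sub>R (\<Sum>i<I. f (z + ((\<xi> + real i) * ?h) *\<^sub>R v)))
        + ?h *\<^sub>R (\<Sum>m\<le>N. of_real (bern_poly m \<xi> * ?h ^ m * (real k / real D)) * dds (replicate m v) ?J z))
        \<le> C * (2 * R * M) * ?h ^ N * (2 * R + 2 + 3 * ?h)" by (simp add: algebra_simps)
    let ?d = "(\<Sum>i<I. f (z + ((\<xi> + real i) * ?h) *\<^sub>R v))
         - (\<Sum>m\<le>N. of_real (bern_poly m \<xi> * ?h ^ m * (real k / real D)) * dds (replicate m v) ?J z)"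
    have aux: "norm (c *\<^sub>R (p - q)) = norm (- (c *\<^sub>R p) + c *\<^sub>R q)" for c :: real and p q :: complex
      by (subst norm_minus_cancel[symmetric]) (simp add: algebra_simps)
    have "?h * norm ?d = norm (?h *\<^sub>R ?d)" using h by simp
    also have "\<dots> = norm (- (?h *\<^sub>R (\<Sum>i<I. f (z + ((\<xi> + real i) * ?h) *\<^sub>R v)))
        + ?h *\<^sub>R (\<Sum>m\<le>N. of_real (bern_poly m \<xi> * ?h ^ m * (real k / real D)) * dds (replicate m v) ?J z))"
      by (rule aux)
    also have "\<dots> \<le> C * (2 * R * M) * ?h ^ N * (2 * R + 2 + 3 * ?h)" by (rule bd)
    also have "\<dots> \<le> C * (2 * R * M) * ?h ^ N * (2 * R + 2 + 3 * real D)"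
      using C R M0 h by (intro mult_left_mono) auto
    finally have "norm ?d \<le> C * (2 * R * M) * ?h ^ N * (2 * R + 2 + 3 * real D) / ?h"
      using h(1) by (simp only: pos_le_divide_eq mult.commute)
    also have "\<dots> = C * (2 * R) * real D ^ N * (2 * R + 2 + 3 * real D) / real D * M * (real k / real k ^ N)"
      using k D by (simp add: power_divide field_simps)
    finally show "norm ?d \<le> C * (2 * R) * real D ^ N * (2 * R + 2 + 3 * real D) / real D * M * (real k / real k ^ N)" .
  qed
qed

context lattice_basis
begin

subsection \<open>Boundary operators\<close>

text \<open>In the elimination step \<open>A y + a\<close> is the projection of \<open>y\<close>
  along the eliminated coordinate onto the hyperplane where the inequality is an equality;
  \<open>us\<close> repeats \<open>v\<close>, once for each order of the Euler-Maclaurin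
  term.\<close>

definition boundary :: "'a list \<Rightarrow> 'a \<Rightarrow> ('a \<Rightarrow> 'a) \<Rightarrow> 'a \<Rightarrow> ('a \<Rightarrow> complex) \<Rightarrow> 'a \<Rightarrow> complex" where
  "boundary us v A a f y = dds us (ray_integral v f) (A y + a)"

text \<open>For \<open>v = b\<close> or \<open>v = - b\<close> the factor \<open>crd b v\<close> is
  a sign, so this is the coordinate that increases with slope 1 along \<open>v\<close>.\<close>

definition sgn_crd :: "'a \<Rightarrow> 'a \<Rightarrow> 'a \<Rightarrow> real" where
  "sgn_crd b v y = crd b v * crd b y"

lemma strip_sgn_crd:
  assumes "b \<in> B" "v = b \<or> v = - b"
  shows "strip (sgn_crd b v) v"
proof (rule strip.intro)
  show "bounded_linear (sgn_crd b v)"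
    unfolding sgn_crd_def[abs_def] using assms(1)
    by (intro bounded_linear_const_mult crd_bounded_linear)
  show "sgn_crd b v v = 1" using assms by (auto simp: sgn_crd_def crd_basis crd_minus)
qed

lemma box_supported_subset_V:
  assumes "b \<in> B" "v = b \<or> v = - b" "b \<in> S" "f \<in> box_supported S R"
  shows "f \<in> strip.V (sgn_crd b v) R"
proof -
  have "\<bar>sgn_crd b v y\<bar> = \<bar>crd b y\<bar>" for y
    using assms by (auto simp: sgn_crd_def crd_basis crd_minus)
  then show ?thesis
    using assms strip.V_def[OF strip_sgn_crd[OF assms(1,2)]] by (auto simp: box_supported_def)
qed

text \<open>Moving along \<open>v\<close> leaves the coordinates in \<open>S\<close> unchanged, and
  so does the affine map; hence the same \<open>R\<close> still bounds the support in those
  coordinates, while control of the coordinate \<open>b\<close> is lost.\<close>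

lemma boundary_X:
  assumes S: "insert b S \<subseteq> B" "b \<notin> S" and v: "v = b \<or> v = - b" and A: "bounded_linear A"
    and cA: "\<And>c y. c \<in> S \<Longrightarrow> crd c (A y + a) = crd c y" and f: "f \<in> box_supported (insert b S) R"
  shows "boundary us v A a f \<in> box_supported S R"
proof -
  interpret strip "sgn_crd b v" v R by (rule strip_sgn_crd) (use S v in auto)
  have fV: "f \<in> V" by (rule box_supported_subset_V[OF _ v _ f]) (use S in auto)
  have "ray_integral v f y = 0" if c: "c \<in> S" "\<bar>crd c y\<bar> > R" for c y
  proof -
    have "crd c v = 0" using c S v by (auto simp: crd_basis crd_minus)
    then have "f (y + t *\<^sub>R v) = 0" for t
      using c by (intro box_supported_zero[OF f, of c]) (auto simp: crd_add crd_scale)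
    then show ?thesis by (simp add: ray_integral_def)
  qed
  then have "ray_integral v f \<in> box_supported S R" using dir_smooth_ray_integral[OF fV] by (auto simp: box_supported_def)
  then have "dds us (ray_integral v f) \<in> box_supported S R" using S by (intro box_supported_dds) auto
  then show ?thesis using dir_smooth_affine[OF _ A] cA by (auto simp: box_supported_def boundary_def[abs_def])
qed

text \<open>Directional derivatives commute with the ray integral and turn into derivatives in the
  directions \<open>map A vs\<close> under the affine map. A derivative of the boundary value is
  therefore the ray integral of one derivative of \<open>f\<close>, bounded by the width of the
  strip.\<close>

lemma boundary_op:
  assumes S: "insert b S \<subseteq> B" "b \<notin> S" and v: "v = b \<or> v = - b" and A: "bounded_linear A"
    and cA: "\<And>c y. c \<in> S \<Longrightarrow> crd c (A y + a) = crd c y"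
  shows "controlled_op (insert b S) S (boundary us v A a)"
  unfolding controlled_op_def
proof (intro conjI allI ballI)
  have st: "strip (sgn_crd b v) v" by (rule strip_sgn_crd) (use S v in auto)
  note sm = strip.dir_smooth_ray_integral[OF st]
  have V: "f \<in> strip.V (sgn_crd b v) R" if "f \<in> box_supported (insert b S) R" for f R
    by (rule box_supported_subset_V[OF _ v _ that]) (use S in auto)
  fix R
  show "\<exists>R'. \<forall>f\<in>box_supported (insert b S) R. boundary us v A a f \<in> box_supported S R'"
    using boundary_X[OF S v A cA] by blast
  show "boundary us v A a (\<lambda>x. f x + g x) = (\<lambda>x. boundary us v A a f x + boundary us v A a g x)"
    if "f \<in> box_supported (insert b S) R" "g \<in> box_supported (insert b S) R" for f g
  proof -
    have "ray_integral v (\<lambda>x. f x + g x) = (\<lambda>y. ray_integral v f y + ray_integral v g y)"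
      using strip.ray_integral_add[OF st V[OF that(1)] V[OF that(2)]] by auto
    then show ?thesis using dds_add[OF sm[OF V[OF that(1)]] sm[OF V[OF that(2)]], of us]
      by (simp add: boundary_def[abs_def])
  qed
  show "boundary us v A a (\<lambda>x. c * f x) = (\<lambda>x. c * boundary us v A a f x)"
    if "f \<in> box_supported (insert b S) R" for f c
  proof -
    have "ray_integral v (\<lambda>x. c * f x) = (\<lambda>y. c * ray_integral v f y)"
      using strip.ray_integral_scale[OF st] by auto
    then show ?thesis using dds_scale[OF sm[OF V[OF that(1)]], of us c]
      by (simp add: boundary_def[abs_def])
  qed
  fix vs
  show "\<exists>C F. 0 \<le> C \<and> finite F \<and> (\<forall>f\<in>box_supported (insert b S) R. \<forall>M. deriv_bound F f M \<longrightarrow>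
            (\<forall>x. norm (dds vs (boundary us v A a f) x) \<le> C * M))"
  proof (intro exI[of _ "2 * \<bar>R\<bar>"] exI[of _ "{map A vs @ us}"] conjI ballI allI impI)
    fix f M x assume f: "f \<in> box_supported (insert b S) R" and M: "deriv_bound {map A vs @ us} f M"
    have "dds vs (boundary us v A a f) x = dds (map A vs) (dds us (ray_integral v f)) (A x + a)"
      using dds_affine[OF dir_smooth_dds[OF sm[OF V[OF f]]] A] by (simp add: boundary_def[abs_def])
    also have "\<dots> = ray_integral v (dds (map A vs @ us) f) (A x + a)"
      by (simp only: dds_append strip.dds_ray_integral[OF st V[OF f], symmetric])
    finally show "norm (dds vs (boundary us v A a f) x) \<le> 2 * \<bar>R\<bar> * M"
      using strip.ray_integral_bound[OF st strip.V_dds[OF st V[OF f]]] M by (simp add: deriv_bound_def)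
  qed auto
qed

text \<open>With \<open>Q\<close> a common denominator of the values of \<open>u\<close>, a shift of
  the lattice point and \<open>k\<close> by multiples of \<open>D * Q\<close> changes
  \<open>u\<close> by a multiple of \<open>D\<close>. The rounding error stays the same and the
  argument of \<open>\<eta>\<close> moves by a period.\<close>

lemma weight_periodic_ceiling:
  fixes h :: "real \<Rightarrow> complex"
  assumes \<eta>: "weight_periodic \<eta>" and v: "v \<in> lat B" and g: "(f, \<beta>) \<in> rat_ineqs" and p: "p \<in> \<rat>"
    and u: "\<And>x k. u x k = (f x - \<beta> * of_int k) / p"
  shows "weight_periodic (\<lambda>x k. \<eta> (x + of_int (\<lceil>u x k\<rceil> + e) *\<^sub>R v) k * h (of_int \<lceil>u x k\<rceil> - u x k))"
proof -
  have lf: "linear f" and fr: "\<And>x. x \<in> lat B \<Longrightarrow> f x \<in> \<rat>" and \<beta>: "\<beta> \<in> \<rat>"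
    using g by (auto simp: rat_ineqs_def)
  have "finite (insert (\<beta> / p) ((\<lambda>b. f b / p) ` B))" using finite_B by simp
  moreover have "insert (\<beta> / p) ((\<lambda>b. f b / p) ` B) \<subseteq> \<rat>"
    using p \<beta> fr lat_basis[of _ B] by (auto intro!: Rats_divide)
  ultimately obtain Q :: int where "Q > 0"
    "\<forall>a\<in>insert (\<beta> / p) ((\<lambda>b. f b / p) ` B). of_int Q * a \<in> (\<int> :: real set)"
    using common_denominator by blast
  then have Q: "Q > 0" "of_int Q * (\<beta> / p) \<in> (\<int> :: real set)"
      "\<And>b. b \<in> B \<Longrightarrow> of_int Q * (f b / p) \<in> (\<int> :: real set)" by auto
  have int: "of_int Q * u y l \<in> \<int>" if y: "y \<in> lat B" for y l
  proof -
    have "of_int Q * u y l = (\<Sum>b\<in>B. crd b y * (of_int Q * (f b / p))) - (of_int Q * (\<beta> / p)) * of_int l"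
      unfolding u linear_crd[OF lf, of y] by (simp add: diff_divide_distrib sum_divide_distrib sum_distrib_left algebra_simps)
    moreover have "(\<Sum>b\<in>B. crd b y * (of_int Q * (f b / p))) \<in> \<int>"
      by (intro Ints_sum Ints_mult[OF _ Q(3)]) (use y in \<open>auto simp: lat_def\<close>)
    ultimately show ?thesis using Q(2) by (metis Ints_diff Ints_mult Ints_of_int)
  qed
  from weight_periodic_multiple[OF \<eta>] obtain D where D: "D > 0"
    "\<And>x y k l m. x \<in> lat B \<Longrightarrow> y \<in> lat B \<Longrightarrow> \<eta> (x + of_int (D * m) *\<^sub>R y) (k + D * m * l) = \<eta> x k" by blast
  show ?thesis unfolding weight_periodic_def
  proof (intro exI[of _ "D * Q"] conjI ballI allI)
    show "D * Q > 0" using D Q by simp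
    fix x y k l assume x: "x \<in> lat B" and y: "y \<in> lat B"
    obtain m :: int where m: "of_int Q * u y l = of_int m" using int[OF y, of l] by (auto elim: Ints_cases)
    have "u (x + of_int (D * Q) *\<^sub>R y) (k + D * Q * l) = u x k + of_int D * (of_int Q * u y l)"
      unfolding u by (simp add: linear_add[OF lf] linear_cmul[OF lf] add_divide_distrib diff_divide_distrib algebra_simps)
    then have us: "u (x + of_int (D * Q) *\<^sub>R y) (k + D * Q * l) = u x k + of_int (D * m)" by (simp add: m)
    then have c: "\<lceil>u (x + of_int (D * Q) *\<^sub>R y) (k + D * Q * l)\<rceil> = \<lceil>u x k\<rceil> + D * m" by (simp only: ceiling_add_of_int)
    have e1: "x + of_int (D * Q) *\<^sub>R y + of_int (\<lceil>u x k\<rceil> + D * m + e) *\<^sub>R v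
        = (x + of_int (\<lceil>u x k\<rceil> + e) *\<^sub>R v) + of_int (D * 1) *\<^sub>R (of_int Q *\<^sub>R y + of_int m *\<^sub>R v)"
      by (simp add: algebra_simps)
    have e2: "\<eta> ((x + of_int (\<lceil>u x k\<rceil> + e) *\<^sub>R v) + of_int (D * 1) *\<^sub>R (of_int Q *\<^sub>R y + of_int m *\<^sub>R v)) (k + D * 1 * (Q * l)) = \<eta> (x + of_int (\<lceil>u x k\<rceil> + e) *\<^sub>R v) k"
      by (rule D(2)) (intro lat_add lat_scale x y v)+
    have e3: "k + D * Q * l = k + D * 1 * (Q * l)" by simp
    show "\<eta> (x + of_int (D * Q) *\<^sub>R y + of_int (\<lceil>u (x + of_int (D * Q) *\<^sub>R y) (k + D * Q * l)\<rceil> + e) *\<^sub>R v) (k + D * Q * l)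
        * h (of_int \<lceil>u (x + of_int (D * Q) *\<^sub>R y) (k + D * Q * l)\<rceil> - u (x + of_int (D * Q) *\<^sub>R y) (k + D * Q * l))
      = \<eta> (x + of_int (\<lceil>u x k\<rceil> + e) *\<^sub>R v) k * h (of_int \<lceil>u x k\<rceil> - u x k)"
      unfolding c unfolding us unfolding e1 e3 e2 by simp
  qed
qed

end

lemma sum_int_lessThan: "sum F {c..<c + int n} = (\<Sum>i<n. F (c + int i))"
  by (rule sum.reindex_bij_witness[of _ "\<lambda>i. c + int i" "\<lambda>j. nat (j - c)"]) auto

context lattice_basis
begin

subsection \<open>Elimination of one coordinate\<close>

text \<open>On each line \<open>x + j *\<^sub>R v\<close> the inequalities in \<open>H\<close> are
  constant and the remaining one says \<open>j \<ge> \<lceil>u x k\<rceil>\<close>. The inner sum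
  splits into \<open>D\<close> tails with constant \<open>\<eta>\<close>. Their Euler-Maclaurin
  terms are sums over \<open>lat S\<close> of boundary values with periodic weights, to which
  \<open>IH\<close> applies, and \<open>expands_diagonal\<close> assembles the orders.\<close>

lemma eliminate_one_sided:
  assumes S: "insert b S \<subseteq> B" "b \<notin> S"
    and IH: "\<And>H \<eta>. set H \<subseteq> rat_ineqs \<Longrightarrow> weight_periodic \<eta> \<Longrightarrow> good S (\<lambda>x k. ineq_indicator H x k * \<eta> x k)"
    and H: "set H \<subseteq> rat_ineqs" "\<And>f \<beta>. (f, \<beta>) \<in> set H \<Longrightarrow> f b = 0"
    and g: "(f, \<beta>) \<in> rat_ineqs" "f b \<noteq> 0" and \<eta>: "weight_periodic \<eta>"
  shows "good (insert b S) (\<lambda>x k. ineq_indicator ((f, \<beta>) # H) x k * \<eta> x k)"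
proof -
  \<comment> \<open>The orientation makes \<open>f\<close> decrease along \<open>v\<close>, so that
    the inequality becomes a lower bound for \<open>j\<close>.\<close>
  define v where "v = (if f b > 0 then - b else b)"
  have v: "v = b \<or> v = - b" by (auto simp: v_def)
  have bB: "b \<in> B" and SB: "S \<subseteq> B" and finS: "finite S"
    using S finite_B finite_subset by auto
  have lf: "linear f" using g by (auto simp: rat_ineqs_def)
  define p where "p = - f v"
  have p: "p > 0" using g(2) by (auto simp: p_def v_def linear_neg[OF lf])
  have vlat: "v \<in> lat B" using v bB lat_basis[OF bB bB] lat_minus by auto
  have pQ: "p \<in> \<rat>" using g vlat by (auto simp: p_def rat_ineqs_def)
  have cv: "crd c v = 0" if "c \<noteq> b" for c using that v bB by (auto simp: crd_basis crd_minus)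
  \<comment> \<open>This is the real number \<open>j\<close> at which the line
    \<open>x + j *\<^sub>R v\<close> crosses the hyperplane \<open>f = \<beta> * k\<close>.\<close>
  define u where "u x k = (f x - \<beta> * of_int k) / p" for x and k :: int
  \<comment> \<open>The coordinate \<open>b\<close> is dropped first and then moved along
    \<open>v\<close> to the hyperplane \<open>f = \<beta>\<close>; together with the translation
    \<open>a\<close> this is the projection used in \<open>boundary\<close>.\<close>
  define A where "A y = (y - crd b y *\<^sub>R b) + (f (y - crd b y *\<^sub>R b) / p) *\<^sub>R v" for y
  define a where "a = - (\<beta> / p) *\<^sub>R v"
  have blA: "bounded_linear A"
  proof -
    have 1: "bounded_linear (\<lambda>y. y - crd b y *\<^sub>R b)"
      by (intro bounded_linear_sub bounded_linear_ident bounded_linear_scaleR_const crd_bounded_linear bB)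
    have "bounded_linear (\<lambda>y. (1 / p) * f (y - crd b y *\<^sub>R b))"
      by (intro bounded_linear_const_mult bounded_linear_compose[OF linear_imp_bounded_linear[OF lf] 1])
    then have "bounded_linear (\<lambda>y. f (y - crd b y *\<^sub>R b) / p)" by simp
    then show ?thesis unfolding A_def[abs_def]
      by (intro bounded_linear_add 1 bounded_linear_scaleR_const)
  qed
  have cA: "crd c (A y + a) = crd c y" if "c \<in> S" for c y
  proof -
    have "c \<noteq> b" using that S by auto
    then show ?thesis by (simp add: A_def a_def crd_add crd_diff crd_minus crd_scale crd_basis bB cv)
  qed
  from \<eta> obtain D0 :: int where D0: "D0 > 0"
    "\<And>x y k l. x \<in> lat B \<Longrightarrow> y \<in> lat B \<Longrightarrow> \<eta> (x + of_int D0 *\<^sub>R y) (k + D0 * l) = \<eta> x k"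
    unfolding weight_periodic_def by blast
  define D where "D = nat D0"
  have D: "D > 0" "int D = D0" using D0 by (auto simp: D_def)
  have \<eta>per: "\<eta> (x + of_int (int (D * i)) *\<^sub>R v) k = \<eta> x k" if "x \<in> lat B" for x k i
    using D0(2)[OF that lat_scale[OF vlat, of "int i"], of k 0] D(2) by simp
  obtain K\<eta> where K\<eta>: "\<And>x k. x \<in> lat B \<Longrightarrow> norm (\<eta> x k) \<le> K\<eta>" using weight_periodic_bounded[OF \<eta>] by blast
  have "0 \<in> lat B" by (simp add: lat_def)
  then have K\<eta>0: "K\<eta> \<ge> 0" using order_trans[OF norm_ge_zero K\<eta>] by blast

  define \<eta>e where "\<eta>e e x k = \<eta> (x + of_int (\<lceil>u x k\<rceil> + int e) *\<^sub>R v) k" for e x k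
  \<comment> \<open>After scaling by \<open>1 / k\<close>, the first point of residue class
    \<open>e\<close> lies \<open>\<xi>\<close> steps of length \<open>D / k\<close> past the
    hyperplane. Since the rounding error is below 1 and \<open>e < D\<close>, this fraction is at
    most 1, as the summation formula requires.\<close>
  define \<xi> where "\<xi> e x k = (of_int \<lceil>u x k\<rceil> - u x k + real e) / real D" for e x k
  define W where "W r e x k = ineq_indicator H x k * (\<eta>e e x k * of_real (bern_poly r (\<xi> e x k)))" for r e x k
  define T where "T r = boundary (replicate r v) v A a" for r
  \<comment> \<open>The factor \<open>k / D\<close> is the inverse of the step up to scale, and
    \<open>D ^ r\<close> is what remains of the r-th power of the step \<open>D / k\<close> once
    \<open>k ^ r\<close> has been split off for \<open>expands_diagonal\<close>.\<close>
  define E where "E r k f = (\<Sum>e<D. of_real (real D ^ r / real D) * (of_nat k * lattice_sum S (W r e) k (T r f)))"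
    for r k f
  have \<xi>: "0 \<le> \<xi> e x k" "\<xi> e x k \<le> 1" if "e < D" for e x k
  proof -
    have "real e + 1 \<le> real D" using that by linarith
    then have "of_int \<lceil>u x k\<rceil> - u x k + real e \<le> real D" by linarith
    then show "0 \<le> \<xi> e x k" "\<xi> e x k \<le> 1" using D by (auto simp: \<xi>_def)
  qed
  have expE: "expands (insert b S) (card (insert b S)) (E r)" for r
  proof -
    have "expands (insert b S) (Suc (card S)) (E r)"
      unfolding E_def[abs_def]
    proof (intro expands_sum expands_scale expands_times_k)
      fix e
      have "weight_periodic (\<lambda>x k. \<eta>e e x k * of_real (bern_poly r (\<xi> e x k)))"
        using weight_periodic_ceiling[OF \<eta> vlat g(1) pQ u_def, where e = "int e"
            and h = "\<lambda>s. of_real (bern_poly r ((s + real e) / real D))"]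
        by (simp add: \<eta>e_def \<xi>_def)
      then have "good S (W r e)" unfolding W_def[abs_def] by (rule IH[OF H(1)])
      then show "expands (insert b S) (card S) (\<lambda>k f. lattice_sum S (W r e) k (T r f))"
        unfolding good_def T_def
        by (rule expands_comp[rotated, where A = "lattice_sum S (W r e)"]) (rule boundary_op[OF S v blA cA])
    qed auto
    then show ?thesis using S finS by simp
  qed

  let ?w = "\<lambda>x k. ineq_indicator ((f, \<beta>) # H) x k * \<eta> x k"
  \<comment> \<open>An exact identity: whenever the cutoffs \<open>I x\<close> reach beyond the
    support, the error after order \<open>N\<close> is the sum of the tail errors over all lattice
    points of the box and all residue classes.\<close>
  have main: "lattice_sum (insert b S) ?w k \<phi> - (\<Sum>r\<le>N. 1 / of_nat k ^ r * E r k \<phi>)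
      = (\<Sum>x\<in>box S (R * real k). \<Sum>e<D. ineq_indicator H x (int k) * \<eta>e e x (int k) *
          ((\<Sum>i<I x. \<phi> ((A (x /\<^sub>R real k) + a) + ((\<xi> e x (int k) + real i) * (real D / real k)) *\<^sub>R v))
         - (\<Sum>m\<le>N. of_real (bern_poly m (\<xi> e x (int k)) * (real D / real k) ^ m * (real k / real D))
               * dds (replicate m v) (ray_integral v \<phi>) (A (x /\<^sub>R real k) + a))))"
    if \<phi>: "\<phi> \<in> box_supported (insert b S) R" and k: "k \<ge> 1" and
      I: "\<And>x. x \<in> box S (R * real k) \<Longrightarrow> of_int \<lceil>u x (int k)\<rceil> + real (D * I x) \<ge> (R + 1) * real k"
    for \<phi> k R N I
  proof -
    let ?K = "R * real k"
    have k0: "real k > 0" using k by simp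
    have lhs: "lattice_sum (insert b S) ?w k \<phi> = (\<Sum>x\<in>box S ?K. \<Sum>e<D. ineq_indicator H x (int k) * \<eta>e e x (int k) *
       (\<Sum>i<I x. \<phi> ((A (x /\<^sub>R real k) + a) + ((\<xi> e x (int k) + real i) * (real D / real k)) *\<^sub>R v)))"
    proof -
      have "lattice_sum (insert b S) ?w k \<phi> = (\<Sum>y\<in>box (insert b S) ?K. ?w y (int k) * \<phi> (y /\<^sub>R real k))"
        by (rule lattice_sum_box[OF S(1) \<phi> k order_refl])
      also have "\<dots> = (\<Sum>(x, j)\<in>box S ?K \<times> {j::int. \<bar>of_int j\<bar> \<le> ?K}.
          ?w (x + of_int j *\<^sub>R v) (int k) * \<phi> ((x + of_int j *\<^sub>R v) /\<^sub>R real k))"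
        by (subst sum.reindex_bij_betw[OF box_insert[OF bB S(2) v], symmetric]) (simp add: split_beta)
      also have "\<dots> = (\<Sum>x\<in>box S ?K. \<Sum>j\<in>{j::int. \<bar>of_int j\<bar> \<le> ?K}.
          ?w (x + of_int j *\<^sub>R v) (int k) * \<phi> ((x + of_int j *\<^sub>R v) /\<^sub>R real k))"
        by (rule sum.cartesian_product[symmetric])
      also have "\<dots> = (\<Sum>x\<in>box S ?K. \<Sum>e<D. ineq_indicator H x (int k) * \<eta>e e x (int k) *
         (\<Sum>i<I x. \<phi> ((A (x /\<^sub>R real k) + a) + ((\<xi> e x (int k) + real i) * (real D / real k)) *\<^sub>R v)))"
      proof (rule sum.cong[OF refl])
        fix x assume x: "x \<in> box S ?K"
        then have xS: "x \<in> lat S" and xB: "x \<in> lat B" using lat_mono[OF SB] by (auto simp: box_def)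
        have xb: "crd b x = 0" using xS bB S(2) by (simp add: lat_def)
        let ?u = "u x (int k)"
        let ?F = "\<lambda>j. \<eta> (x + of_int j *\<^sub>R v) (int k) * \<phi> ((x + of_int j *\<^sub>R v) /\<^sub>R real k)"
        have F0: "?F j = 0" if "\<bar>of_int j\<bar> > ?K" for j
        proof -
          have "\<bar>crd b ((x + of_int j *\<^sub>R v) /\<^sub>R real k)\<bar> = \<bar>of_int j\<bar> / real k"
            using v bB k0 by (auto simp: crd_scale crd_add xb crd_minus crd_basis abs_mult divide_inverse)
          also have "\<dots> > R" using that k0 by (simp add: field_simps)
          finally have "\<phi> ((x + of_int j *\<^sub>R v) /\<^sub>R real k) = 0" by (intro box_supported_zero[OF \<phi>, of b]) auto
          then show ?thesis by simp
        qed
        have indj: "ineq_indicator ((f, \<beta>) # H) (x + of_int j *\<^sub>R v) (int k) = (if \<lceil>?u\<rceil> \<le> j then 1 else 0) * ineq_indicator H x (int k)" for j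
        proof -
          have "f' (x + of_int j *\<^sub>R v) = f' x" if "(f', \<beta>') \<in> set H" for f' \<beta>'
          proof -
            have l: "linear f'" using that H(1) by (auto simp: rat_ineqs_def)
            show ?thesis using H(2)[OF that] v by (auto simp: linear_add[OF l] linear_cmul[OF l] linear_neg[OF l])
          qed
          note fx = this
          have "(case q of (f', \<beta>') \<Rightarrow> f' (x + of_int j *\<^sub>R v) \<le> \<beta>' * of_int (int k))
              = (case q of (f', \<beta>') \<Rightarrow> f' x \<le> \<beta>' * of_int (int k))" if "q \<in> set H" for q
            using fx[of "fst q" "snd q"] that by (cases q) simp
          then have "ineq_indicator H (x + of_int j *\<^sub>R v) (int k) = ineq_indicator H x (int k)"
            unfolding ineq_indicator_def by (intro if_cong ball_cong refl)
          moreover have "f (x + of_int j *\<^sub>R v) \<le> \<beta> * of_int (int k) \<longleftrightarrow> \<lceil>?u\<rceil> \<le> j"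
          proof -
            have "f (x + of_int j *\<^sub>R v) = f x - of_int j * p"
              by (simp add: linear_add[OF lf] linear_cmul[OF lf] p_def)
            then have "f (x + of_int j *\<^sub>R v) \<le> \<beta> * of_int (int k) \<longleftrightarrow> f x - \<beta> * of_int (int k) \<le> of_int j * p"
              by auto
            also have "\<dots> \<longleftrightarrow> ?u \<le> of_int j" unfolding u_def by (rule pos_divide_le_eq[OF p, symmetric])
            finally show ?thesis by (simp add: ceiling_le_iff)
          qed
          ultimately show ?thesis by (simp add: ineq_indicator_Cons)
        qed
        have z: "(A (x /\<^sub>R real k) + a) + ((\<xi> e x (int k) + real i) * (real D / real k)) *\<^sub>R v
            = (x + of_int (\<lceil>?u\<rceil> + int (e + D * i)) *\<^sub>R v) /\<^sub>R real k" for e i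
        proof -
          have *: "A (x /\<^sub>R real k) + a = x /\<^sub>R real k + (?u / real k) *\<^sub>R v"
          proof -
            have "f (x /\<^sub>R real k) / p = \<beta> / p + ?u / real k"
              using k0 p by (simp add: u_def linear_cmul[OF lf] field_simps)
            then show ?thesis by (simp add: A_def a_def crd_scale xb scaleR_add_left)
          qed
          have "(\<xi> e x (int k) + real i) * (real D / real k) = (of_int \<lceil>?u\<rceil> - ?u + real e + real D * real i) / real k"
            using D k0 by (simp add: \<xi>_def field_simps)
          then have "?u / real k + (\<xi> e x (int k) + real i) * (real D / real k) = of_int (\<lceil>?u\<rceil> + int (e + D * i)) / real k"
            by (simp only: add_divide_distrib diff_divide_distrib of_int_add of_int_of_nat_eq of_nat_add of_nat_mult)
              simp
          then show ?thesis unfolding * add.assoc scaleR_left.add[symmetric]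
            by (simp add: scaleR_add_right divide_inverse mult.commute)
        qed
        have "(\<Sum>j\<in>{j::int. \<bar>of_int j\<bar> \<le> ?K}. ?w (x + of_int j *\<^sub>R v) (int k) * \<phi> ((x + of_int j *\<^sub>R v) /\<^sub>R real k))
            = (\<Sum>j\<in>{j::int. \<bar>of_int j\<bar> \<le> ?K}. if \<lceil>?u\<rceil> \<le> j then ineq_indicator H x (int k) * ?F j else 0)"
          by (rule sum.cong) (auto simp: indj)
        also have "\<dots> = (\<Sum>j\<in>{j::int. \<bar>of_int j\<bar> \<le> ?K} \<inter> {j. \<lceil>?u\<rceil> \<le> j}. ineq_indicator H x (int k) * ?F j)"
          using finite_abs_int_le by (subst sum.inter_restrict) auto
        also have "\<dots> = (\<Sum>j\<in>{\<lceil>?u\<rceil>..<\<lceil>?u\<rceil> + int (D * I x)}. ineq_indicator H x (int k) * ?F j)"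
        proof (rule sum.mono_neutral_left)
          show "{j::int. \<bar>of_int j\<bar> \<le> ?K} \<inter> {j. \<lceil>?u\<rceil> \<le> j} \<subseteq> {\<lceil>?u\<rceil>..<\<lceil>?u\<rceil> + int (D * I x)}"
          proof
            fix j assume j: "j \<in> {j::int. \<bar>of_int j\<bar> \<le> ?K} \<inter> {j. \<lceil>?u\<rceil> \<le> j}"
            have "real_of_int j < (R + 1) * real k" using j k0 by (auto simp: distrib_right)
            also have "\<dots> \<le> of_int (\<lceil>?u\<rceil> + int (D * I x))" using I[OF x] by simp
            finally have "j < \<lceil>?u\<rceil> + int (D * I x)" by (simp only: of_int_less_iff)
            then show "j \<in> {\<lceil>?u\<rceil>..<\<lceil>?u\<rceil> + int (D * I x)}" using j by auto
          qed
          show "\<forall>j\<in>{\<lceil>?u\<rceil>..<\<lceil>?u\<rceil> + int (D * I x)} - {j::int. \<bar>of_int j\<bar> \<le> ?K} \<inter> {j. \<lceil>?u\<rceil> \<le> j}. ineq_indicator H x (int k) * ?F j = 0"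
          proof
            fix j assume "j \<in> {\<lceil>?u\<rceil>..<\<lceil>?u\<rceil> + int (D * I x)} - {j::int. \<bar>of_int j\<bar> \<le> ?K} \<inter> {j. \<lceil>?u\<rceil> \<le> j}"
            then have "?F j = 0" by (intro F0) auto
            then show "ineq_indicator H x (int k) * ?F j = 0" by simp
          qed
        qed auto
        also have "\<dots> = (\<Sum>n<D * I x. ineq_indicator H x (int k) * ?F (\<lceil>?u\<rceil> + int n))"
          by (rule sum_int_lessThan)
        also have "\<dots> = (\<Sum>e<D. \<Sum>i<I x. ineq_indicator H x (int k) * ?F (\<lceil>?u\<rceil> + int (e + D * i)))"
          by (rule sum_lessThan_mult)
        also have "\<dots> = (\<Sum>e<D. ineq_indicator H x (int k) * \<eta>e e x (int k) *
         (\<Sum>i<I x. \<phi> ((A (x /\<^sub>R real k) + a) + ((\<xi> e x (int k) + real i) * (real D / real k)) *\<^sub>R v)))"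
          unfolding sum_distrib_left
        proof (intro sum.cong refl)
          fix e i
          have "\<eta> (x + of_int (\<lceil>?u\<rceil> + int (e + D * i)) *\<^sub>R v) (int k)
            = \<eta> ((x + of_int (\<lceil>?u\<rceil> + int e) *\<^sub>R v) + of_int (int (D * i)) *\<^sub>R v) (int k)"
            by (simp add: algebra_simps)
          also have "\<dots> = \<eta>e e x (int k)"
            unfolding \<eta>e_def by (rule \<eta>per) (intro lat_add lat_scale xB vlat)
          finally show "ineq_indicator H x (int k) * ?F (\<lceil>?u\<rceil> + int (e + D * i)) = ineq_indicator H x (int k) * \<eta>e e x (int k) *
             \<phi> ((A (x /\<^sub>R real k) + a) + ((\<xi> e x (int k) + real i) * (real D / real k)) *\<^sub>R v)"
            unfolding z by (simp only: mult.assoc)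
        qed
        finally show "(\<Sum>j\<in>{j::int. \<bar>of_int j\<bar> \<le> ?K}. ?w (x + of_int j *\<^sub>R v) (int k) * \<phi> ((x + of_int j *\<^sub>R v) /\<^sub>R real k))
          = (\<Sum>e<D. ineq_indicator H x (int k) * \<eta>e e x (int k) *
         (\<Sum>i<I x. \<phi> ((A (x /\<^sub>R real k) + a) + ((\<xi> e x (int k) + real i) * (real D / real k)) *\<^sub>R v)))" .
      qed
      finally show ?thesis .
    qed
    have TX: "T r \<phi> \<in> box_supported S R" for r unfolding T_def by (rule boundary_X[OF S v blA cA \<phi>])
    have "(\<Sum>r\<le>N. 1 / of_nat k ^ r * E r k \<phi>)
        = (\<Sum>r\<le>N. \<Sum>e<D. \<Sum>x\<in>box S ?K. ineq_indicator H x (int k) * \<eta>e e x (int k) *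
            (of_real (bern_poly r (\<xi> e x (int k)) * (real D / real k) ^ r * (real k / real D))
               * dds (replicate r v) (ray_integral v \<phi>) (A (x /\<^sub>R real k) + a)))"
      unfolding E_def lattice_sum_box[OF SB TX k order_refl] sum_distrib_left
      by (intro sum.cong refl) (simp add: W_def T_def boundary_def power_divide field_simps)
    also have "\<dots> = (\<Sum>r\<le>N. \<Sum>x\<in>box S ?K. \<Sum>e<D. ineq_indicator H x (int k) * \<eta>e e x (int k) *
            (of_real (bern_poly r (\<xi> e x (int k)) * (real D / real k) ^ r * (real k / real D))
               * dds (replicate r v) (ray_integral v \<phi>) (A (x /\<^sub>R real k) + a)))"
      by (rule sum.cong[OF refl]) (rule sum.swap)
    also have "\<dots> = (\<Sum>x\<in>box S ?K. \<Sum>r\<le>N. \<Sum>e<D. ineq_indicator H x (int k) * \<eta>e e x (int k) *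
            (of_real (bern_poly r (\<xi> e x (int k)) * (real D / real k) ^ r * (real k / real D))
               * dds (replicate r v) (ray_integral v \<phi>) (A (x /\<^sub>R real k) + a)))"
      by (rule sum.swap)
    also have "\<dots> = (\<Sum>x\<in>box S ?K. \<Sum>e<D. \<Sum>r\<le>N. ineq_indicator H x (int k) * \<eta>e e x (int k) *
            (of_real (bern_poly r (\<xi> e x (int k)) * (real D / real k) ^ r * (real k / real D))
               * dds (replicate r v) (ray_integral v \<phi>) (A (x /\<^sub>R real k) + a)))"
      by (rule sum.cong[OF refl]) (rule sum.swap)
    finally show ?thesis unfolding lhs
      by (simp only: sum_subtractf[symmetric] right_diff_distrib sum_distrib_left)
  qed

  have strip: "strip (sgn_crd b v) v" by (rule strip_sgn_crd[OF bB v])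
  show ?thesis unfolding good_def
  proof (rule expands_diagonal[OF expE])
    fix N
    show "controlled (insert b S) {1..} (\<lambda>k f. of_nat k ^ N / of_nat k ^ card (insert b S) * lattice_sum (insert b S) ?w k f
          - (\<Sum>r\<le>N. of_nat k ^ (N - r) / of_nat k ^ card (insert b S) * E r k f))"
      unfolding controlled_def
    proof
      fix R0 :: real
      \<comment> \<open>A negative radius is replaced by 0, which only enlarges the class of
        functions.\<close>
      define R where "R = max R0 0"
      have R: "R \<ge> 0" "R0 \<le> R" by (auto simp: R_def)
      show "\<exists>C F. 0 \<le> C \<and> finite F \<and> (\<forall>\<phi>\<in>box_supported (insert b S) R0. \<forall>M. deriv_bound F \<phi> M \<longrightarrow> (\<forall>k\<in>{1..}.
          norm (of_nat k ^ N / of_nat k ^ card (insert b S) * lattice_sum (insert b S) ?w k \<phi>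
          - (\<Sum>r\<le>N. of_nat k ^ (N - r) / of_nat k ^ card (insert b S) * E r k \<phi>)) \<le> C * M))"
      proof (rule strip.tail_sum_expansion[OF strip R(1) D(1), of N])
        fix C assume C: "C \<ge> 0" and tail: "\<And>f M k z \<xi> I. f \<in> strip.V (sgn_crd b v) R \<Longrightarrow>
           (\<And>x. norm (dds (replicate (Suc N) v) f x) \<le> M) \<Longrightarrow> k \<ge> (1::nat) \<Longrightarrow>
           0 \<le> \<xi> \<Longrightarrow> \<xi> \<le> 1 \<Longrightarrow> sgn_crd b v z + (\<xi> + real I) * (real D / real k) \<ge> R + 1 \<Longrightarrow>
           norm ((\<Sum>i<I. f (z + ((\<xi> + real i) * (real D / real k)) *\<^sub>R v))
             - (\<Sum>m\<le>N. of_real (bern_poly m \<xi> * (real D / real k) ^ m * (real k / real D))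
                   * dds (replicate m v) (ray_integral v f) z)) \<le> C * M * (real k / real k ^ N)"
        \<comment> \<open>There are at most \<open>((2 * R + 1) * k) ^ card S\<close> points
          \<open>x\<close>, each with \<open>D\<close> classes and an error of at most
          \<open>K\<eta> * C * M * k / k ^ N\<close> per class. The powers of \<open>k\<close>
          combine to \<open>k ^ Suc (card S) / k ^ N\<close>, which the normalization
          cancels.\<close>
        let ?C = "(2 * R + 1) ^ card S * (real D * (K\<eta> * C))"
        show ?thesis
        proof (intro exI[of _ ?C] exI[of _ "{replicate (Suc N) v}"] conjI ballI allI impI)
          show "0 \<le> ?C" using R C K\<eta>0 by simp
          fix \<phi> M k assume \<phi>0: "\<phi> \<in> box_supported (insert b S) R0" and M: "deriv_bound {replicate (Suc N) v} \<phi> M" and "k \<in> {1::nat..}"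
          then have k: "k \<ge> 1" "real k > 0" by auto
          have M0: "M \<ge> 0" using M by (simp add: deriv_bound_def)
          have \<phi>: "\<phi> \<in> box_supported (insert b S) R" using \<phi>0 box_supported_antimono[OF order_refl R(2)] by auto
          have V: "\<phi> \<in> strip.V (sgn_crd b v) R" by (rule box_supported_subset_V[OF bB v _ \<phi>]) simp
          define I where "I x = nat \<lceil>(R + 1) * real k - of_int \<lceil>u x (int k)\<rceil>\<rceil>" for x
          have I: "of_int \<lceil>u x (int k)\<rceil> + real (D * I x) \<ge> (R + 1) * real k" for x
          proof -
            have "(R + 1) * real k - of_int \<lceil>u x (int k)\<rceil> \<le> real (I x)"
              unfolding I_def by (rule real_nat_ceiling_ge)
            also have "\<dots> \<le> real (D * I x)" using D(1) by (simp only: of_nat_le_iff) simp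
            finally show ?thesis by simp
          qed
          let ?d = "\<lambda>x e. (\<Sum>i<I x. \<phi> ((A (x /\<^sub>R real k) + a) + ((\<xi> e x (int k) + real i) * (real D / real k)) *\<^sub>R v))
             - (\<Sum>m\<le>N. of_real (bern_poly m (\<xi> e x (int k)) * (real D / real k) ^ m * (real k / real D))
               * dds (replicate m v) (ray_integral v \<phi>) (A (x /\<^sub>R real k) + a))"
          have d: "norm (?d x e) \<le> C * M * (real k / real k ^ N)" if x: "x \<in> box S (R * real k)" and e: "e < D" for x e
          proof (rule tail[OF V _ k(1) \<xi>[OF e]])
            show "norm (dds (replicate (Suc N) v) \<phi> y) \<le> M" for y using M by (simp add: deriv_bound_def)
            have xb: "crd b x = 0" using x bB S(2) by (simp add: lat_def box_def)
            have "crd b v * crd b v = 1" using v bB by (auto simp: crd_basis crd_minus)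
            then have "sgn_crd b v (A (x /\<^sub>R real k) + a) = (f x / real k - \<beta>) / p"
              using k p by (simp add: sgn_crd_def A_def a_def crd_add crd_diff crd_scale xb linear_cmul[OF lf] field_simps)
            also have "\<dots> = u x (int k) / real k" using k by (simp add: u_def field_simps)
            finally have "sgn_crd b v (A (x /\<^sub>R real k) + a) + (\<xi> e x (int k) + real (I x)) * (real D / real k)
              = (of_int \<lceil>u x (int k)\<rceil> + real (D * I x) + real e) / real k"
              using D k by (simp add: \<xi>_def field_simps)
            also have "\<dots> \<ge> R + 1" using I[of x] k by (simp add: pos_le_divide_eq)
            finally show "R + 1 \<le> sgn_crd b v (A (x /\<^sub>R real k) + a) + (\<xi> e x (int k) + real (I x)) * (real D / real k)" .
          qed
          have "norm (lattice_sum (insert b S) ?w k \<phi> - (\<Sum>r\<le>N. 1 / of_nat k ^ r * E r k \<phi>))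
              \<le> (\<Sum>x\<in>box S (R * real k). \<Sum>e<D. K\<eta> * (C * M * (real k / real k ^ N)))"
            unfolding main[OF \<phi> k(1) I]
          proof (intro sum_norm_le)
            fix x e assume x: "x \<in> box S (R * real k)" and e: "e \<in> {..<D}"
            have "x \<in> lat B" using x lat_mono[OF SB] by (auto simp: box_def)
            then have "norm (\<eta>e e x (int k)) \<le> K\<eta>"
              unfolding \<eta>e_def by (intro K\<eta> lat_add lat_scale vlat)
            moreover have "norm (ineq_indicator H x (int k)) \<le> 1" by (simp add: ineq_indicator_def)
            ultimately have "norm (ineq_indicator H x (int k) * \<eta>e e x (int k)) \<le> 1 * K\<eta>"
              unfolding norm_mult by (intro mult_mono) auto
            then show "norm (ineq_indicator H x (int k) * \<eta>e e x (int k) * ?d x e) \<le> K\<eta> * (C * M * (real k / real k ^ N))"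
              unfolding norm_mult[of "ineq_indicator H x (int k) * \<eta>e e x (int k)"]
              using d[OF x] e K\<eta>0 by (intro mult_mono) auto
          qed
          also have "\<dots> = real (card (box S (R * real k))) * (real D * (K\<eta> * (C * M * (real k / real k ^ N))))"
            by simp
          also have "\<dots> \<le> ((2 * R + 1) * real k) ^ card S * (real D * (K\<eta> * (C * M * (real k / real k ^ N))))"
          proof (rule mult_right_mono)
            have "real (card (box S (R * real k))) \<le> (2 * (R * real k) + 1) ^ card S"
              by (rule card_box[OF SB]) (use R in simp)
            also have "\<dots> \<le> ((2 * R + 1) * real k) ^ card S"
              using R k by (intro power_mono) (auto simp: algebra_simps)
            finally show "real (card (box S (R * real k))) \<le> ((2 * R + 1) * real k) ^ card S" .
            show "0 \<le> real D * (K\<eta> * (C * M * (real k / real k ^ N)))" using K\<eta>0 C M0 by simp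
          qed
          finally have le: "norm (lattice_sum (insert b S) ?w k \<phi> - (\<Sum>r\<le>N. 1 / of_nat k ^ r * E r k \<phi>))
            \<le> ((2 * R + 1) * real k) ^ card S * (real D * (K\<eta> * (C * M * (real k / real k ^ N))))" .
          have cS: "card (insert b S) = Suc (card S)" using S finS by simp
          have "of_nat k ^ N / of_nat k ^ card (insert b S) * lattice_sum (insert b S) ?w k \<phi>
            - (\<Sum>r\<le>N. of_nat k ^ (N - r) / of_nat k ^ card (insert b S) * E r k \<phi>)
            = of_real (real k ^ N / real k ^ Suc (card S)) *
               (lattice_sum (insert b S) ?w k \<phi> - (\<Sum>r\<le>N. 1 / of_nat k ^ r * E r k \<phi>))"
            unfolding right_diff_distrib sum_distrib_left cS
            using k by (intro arg_cong2[where f = "(-)"] sum.cong refl) (auto simp: power_diff)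
          then have "norm (of_nat k ^ N / of_nat k ^ card (insert b S) * lattice_sum (insert b S) ?w k \<phi>
            - (\<Sum>r\<le>N. of_nat k ^ (N - r) / of_nat k ^ card (insert b S) * E r k \<phi>))
            = real k ^ N / real k ^ Suc (card S) *
               norm (lattice_sum (insert b S) ?w k \<phi> - (\<Sum>r\<le>N. 1 / of_nat k ^ r * E r k \<phi>))"
            by (simp add: norm_mult norm_divide norm_power)
          also have "\<dots> \<le> real k ^ N / real k ^ Suc (card S) *
             (((2 * R + 1) * real k) ^ card S * (real D * (K\<eta> * (C * M * (real k / real k ^ N)))))"
            by (rule mult_left_mono[OF le]) simp
          also have "\<dots> = ?C * M"
            unfolding power_mult_distrib using k by (simp add: field_simps)
          finally show "norm (of_nat k ^ N / of_nat k ^ card (insert b S) * lattice_sum (insert b S) ?w k \<phi>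
            - (\<Sum>r\<le>N. of_nat k ^ (N - r) / of_nat k ^ card (insert b S) * E r k \<phi>)) \<le> ?C * M" .
        qed simp
      qed
    qed
  qed
qed

subsection \<open>Reduction to a single inequality\<close>

lemma ineq_indicator_append: "ineq_indicator (G @ H) x k = ineq_indicator G x k * ineq_indicator H x k"
  by (auto simp: ineq_indicator_def)

lemma rat_ineqs_add: "(f, \<beta>) \<in> rat_ineqs \<Longrightarrow> (g, \<gamma>) \<in> rat_ineqs \<Longrightarrow> (\<lambda>x. f x + g x, \<beta> + \<gamma>) \<in> rat_ineqs"
  by (auto simp: rat_ineqs_def image_subset_iff intro: linear_compose_add)

lemma rat_ineqs_scale: "(f, \<beta>) \<in> rat_ineqs \<Longrightarrow> c \<in> \<rat> \<Longrightarrow> (\<lambda>x. c * f x, c * \<beta>) \<in> rat_ineqs"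
  using linear_compose_scale_right[of f c] by (auto simp: rat_ineqs_def image_subset_iff)

lemma rat_ineqs_diff:
  "(f, \<beta>) \<in> rat_ineqs \<Longrightarrow> (g, \<gamma>) \<in> rat_ineqs \<Longrightarrow> (\<lambda>x. f x - g x, \<beta> - \<gamma>) \<in> rat_ineqs"
  using rat_ineqs_add[of f \<beta> "\<lambda>x. (-1) * g x" "(-1) * \<gamma>"] rat_ineqs_scale[of g \<gamma> "-1"] by simp

lemma rat_ineqs_crd: "b \<in> B \<Longrightarrow> (crd b, 0) \<in> rat_ineqs" "b \<in> B \<Longrightarrow> (\<lambda>x. - crd b x, 0) \<in> rat_ineqs"
proof -
  assume b: "b \<in> B"
  then show *: "(crd b, 0) \<in> rat_ineqs"
    by (auto simp: rat_ineqs_def crd_linear lat_def Ints_subset_Rats[THEN subsetD])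
  show "(\<lambda>x. - crd b x, 0) \<in> rat_ineqs"
    using rat_ineqs_scale[OF *, of "-1"] by simp
qed

text \<open>More restricted coordinates mean fewer functions, so the identity map carries the
  expansion over.\<close>

lemma expands_antimono:
  assumes "S \<subseteq> S'" "S' \<subseteq> B" "expands S d A" shows "expands S' d A"
proof (rule expands_comp[where P = "\<lambda>f. f", OF _ assms(3)])
  have sub: "box_supported S' R \<subseteq> box_supported S R" for R by (rule box_supported_antimono[OF assms(1)]) simp
  show "controlled_op S' S (\<lambda>f. f)"
    unfolding controlled_op_def
  proof (intro conjI allI ballI)
    show "\<exists>C F. 0 \<le> C \<and> finite F \<and>
       (\<forall>f\<in>box_supported S' R. \<forall>M. deriv_bound F f M \<longrightarrow> (\<forall>x. norm (dds vs f x) \<le> C * M))" for R vs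
      by (intro exI[of _ 1] exI[of _ "{vs}"]) (auto simp: deriv_bound_def)
  qed (use sub in auto)
qed

text \<open>The points of \<open>lat (insert b S)\<close> with vanishing coordinate \<open>b\<close>
  are those of \<open>lat S\<close>, so the sum is literally the lower-dimensional one, of order one
  less.\<close>

lemma good_restrict:
  assumes S: "insert b S \<subseteq> B" "b \<notin> S" and w: "good S w"
  shows "good (insert b S) (\<lambda>x k. if crd b x = 0 then w x k else 0)"
proof -
  have fin: "finite S" using S finite_B finite_subset by auto
  have eq: "lattice_sum (insert b S) (\<lambda>x k. if crd b x = 0 then w x k else 0) = lattice_sum S w"
    unfolding lattice_sum_def
  proof (intro ext infsum_cong_neutral)
    fix k :: nat and f :: "'a \<Rightarrow> complex" and x
    show "(if crd b x = 0 then w x (int k) else 0) * f (x /\<^sub>R real k) = 0" if "x \<in> lat (insert b S) - lat S"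
      using that by (auto simp: lat_def)
    show "w x (int k) * f (x /\<^sub>R real k) = 0" if "x \<in> lat S - lat (insert b S)"
      using that lat_mono[of S "insert b S"] by auto
    show "(if crd b x = 0 then w x (int k) else 0) * f (x /\<^sub>R real k) = w x (int k) * f (x /\<^sub>R real k)"
      if "x \<in> lat (insert b S) \<inter> lat S"
      using that S by (auto simp: lat_def)
  qed
  have "expands (insert b S) (card S) (lattice_sum S w)"
    by (rule expands_antimono[OF _ S(1)]) (use w in \<open>auto simp: good_def\<close>)
  then show ?thesis unfolding good_def eq using S(2) fin by (auto intro: expands_Suc)
qed

text \<open>Two inequalities involving the coordinate \<open>b\<close> are traded for one, at the price of
  inequalities free of \<open>b\<close>: two bounds on the same side are compared with each other, and for
  bounds \<open>l \<le> r\<close> on opposite sides \<open>[l \<le> j \<le> r] = [l \<le> j] + [j \<le> r] - 1\<close>.\<close>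

lemma good_insert:
  assumes S: "insert b S \<subseteq> B" "b \<notin> S"
    and IH: "\<And>H \<eta>. set H \<subseteq> rat_ineqs \<Longrightarrow> weight_periodic \<eta> \<Longrightarrow> good S (\<lambda>x k. ineq_indicator H x k * \<eta> x k)"
    and G: "set G \<subseteq> rat_ineqs" "\<And>f \<beta>. (f, \<beta>) \<in> set G \<Longrightarrow> f b \<noteq> 0"
    and H: "set H \<subseteq> rat_ineqs" "\<And>f \<beta>. (f, \<beta>) \<in> set H \<Longrightarrow> f b = 0" and \<eta>: "weight_periodic \<eta>"
  shows "good (insert b S) (\<lambda>x k. ineq_indicator (G @ H) x k * \<eta> x k)"
  using G H
proof (induction "length G" arbitrary: G H rule: less_induct)
  case less
  have bB: "b \<in> B" using S by auto
  have one: "good (insert b S) (\<lambda>x k. ineq_indicator ((f, \<beta>) # H) x k * \<eta> x k)"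
    if "(f, \<beta>) \<in> rat_ineqs" "f b \<noteq> 0" for f \<beta>
  proof (rule eliminate_one_sided[OF S])
    show "good S (\<lambda>x k. ineq_indicator H' x k * \<eta>' x k)" if "set H' \<subseteq> rat_ineqs" "weight_periodic \<eta>'" for H' \<eta>'
      using that by (rule IH)
    show "f' b = 0" if "(f', \<beta>') \<in> set H" for f' \<beta>' using that by (rule less.prems(4))
  qed fact+
  consider "G = []" | f \<beta> where "G = [(f, \<beta>)]" | f1 \<beta>1 f2 \<beta>2 G' where "G = (f1, \<beta>1) # (f2, \<beta>2) # G'"
    by (metis list.exhaust surj_pair)
  then show ?case
  proof cases
    \<comment> \<open>A coordinate without any bound is given one artificially: the constant 1 is
      the sum of the indicators of \<open>crd b x \<le> 0\<close> and
      \<open>crd b x \<ge> 0\<close>, minus that of \<open>crd b x = 0\<close>, which lives on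
      \<open>lat S\<close>.\<close>
    case 1
    have "good (insert b S) (\<lambda>x k. if crd b x = 0 then ineq_indicator H x k * \<eta> x k else 0)"
      by (rule good_restrict[OF S IH[OF less.prems(3) \<eta>]])
    moreover have "good (insert b S) (\<lambda>x k. ineq_indicator ((crd b, 0) # H) x k * \<eta> x k)"
      by (rule one) (use rat_ineqs_crd[OF bB] bB in \<open>auto simp: crd_basis\<close>)
    moreover have "good (insert b S) (\<lambda>x k. ineq_indicator ((\<lambda>x. - crd b x, 0) # H) x k * \<eta> x k)"
      by (rule one) (use rat_ineqs_crd[OF bB] bB in \<open>auto simp: crd_basis\<close>)
    ultimately have "good (insert b S) (\<lambda>x k. ineq_indicator ((crd b, 0) # H) x k * \<eta> x k
        + ineq_indicator ((\<lambda>x. - crd b x, 0) # H) x k * \<eta> x k - (if crd b x = 0 then ineq_indicator H x k * \<eta> x k else 0))"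
      by (intro good_diff good_add S)
    then show ?thesis by (rule good_cong) (auto simp: 1 ineq_indicator_Cons)
  next
    case 2
    then show ?thesis using less.prems one[of f \<beta>] by simp
  next
    case 3
    have r: "(f1, \<beta>1) \<in> rat_ineqs" "(f2, \<beta>2) \<in> rat_ineqs" and nz: "f1 b \<noteq> 0" "f2 b \<noteq> 0"
      using less.prems 3 by auto
    have G': "set G' \<subseteq> rat_ineqs" "\<And>f \<beta>. (f, \<beta>) \<in> set G' \<Longrightarrow> f b \<noteq> 0" using less.prems 3 by auto
    have rec: "good (insert b S) (\<lambda>x k. ineq_indicator (G'' @ H'') x k * \<eta> x k)"
      if "length G'' < length G" "set G'' \<subseteq> rat_ineqs" "\<And>f \<beta>. (f, \<beta>) \<in> set G'' \<Longrightarrow> f b \<noteq> 0"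
        "set H'' \<subseteq> rat_ineqs" "\<And>f \<beta>. (f, \<beta>) \<in> set H'' \<Longrightarrow> f b = 0" for G'' H''
    proof (rule less.hyps)
      show "f b \<noteq> 0" if "(f, \<beta>) \<in> set G''" for f \<beta> using that by (rule \<open>\<And>f \<beta>. (f, \<beta>) \<in> set G'' \<Longrightarrow> f b \<noteq> 0\<close>)
      show "f b = 0" if "(f, \<beta>) \<in> set H''" for f \<beta> using that by (rule \<open>\<And>f \<beta>. (f, \<beta>) \<in> set H'' \<Longrightarrow> f b = 0\<close>)
    qed fact+
    \<comment> \<open>Scaling makes both coefficients of \<open>b\<close> equal to 1 or -1, so that
      \<open>b\<close> cancels from either the difference or the sum of the two
      inequalities.\<close>
    define c1 where "c1 = 1 / \<bar>f1 b\<bar>"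
    define c2 where "c2 = 1 / \<bar>f2 b\<bar>"
    have c: "c1 > 0" "c2 > 0" using nz by (auto simp: c1_def c2_def)
    have "f1 b \<in> \<rat>" "f2 b \<in> \<rat>" using r lat_basis[OF bB bB] by (auto simp: rat_ineqs_def)
    then have cQ: "c1 \<in> \<rat>" "c2 \<in> \<rat>" by (auto simp: c1_def c2_def abs_if intro!: Rats_divide)
    note R1 = rat_ineqs_scale[OF r(1) cQ(1)] and R2 = rat_ineqs_scale[OF r(2) cQ(2)]
    have iff: "f1 x \<le> \<beta>1 * t \<longleftrightarrow> c1 * f1 x \<le> c1 * \<beta>1 * t" "f2 x \<le> \<beta>2 * t \<longleftrightarrow> c2 * f2 x \<le> c2 * \<beta>2 * t" for x t
      using c by (simp_all add: mult.assoc)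
    show ?thesis
    proof (cases "c1 * f1 b = c2 * f2 b")
      case True
      \<comment> \<open>\<open>?d\<close> says that the second bound is at least as strong as the
        first, \<open>?e\<close> the reverse, and neither involves \<open>b\<close>. In each case
        only the stronger bound is kept; the cases overlap in ties, which are subtracted
        once.\<close>
      let ?d = "(\<lambda>x. c1 * f1 x - c2 * f2 x, c1 * \<beta>1 - c2 * \<beta>2)"
      let ?e = "(\<lambda>x. c2 * f2 x - c1 * f1 x, c2 * \<beta>2 - c1 * \<beta>1)"
      have de: "?d \<in> rat_ineqs" "?e \<in> rat_ineqs" by (rule rat_ineqs_diff R1 R2)+
      have "good (insert b S) (\<lambda>x k. ineq_indicator (((f2, \<beta>2) # G') @ (?d # H)) x k * \<eta> x k
         + ineq_indicator (((f1, \<beta>1) # G') @ (?e # H)) x k * \<eta> x k - ineq_indicator (((f1, \<beta>1) # G') @ (?d # ?e # H)) x k * \<eta> x k)"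
        using r nz G' less.prems de True 3
        by (intro good_diff good_add S rec) auto
      then show ?thesis
      proof (rule good_cong)
        fix x k
        show "ineq_indicator (G @ H) x k * \<eta> x k = ineq_indicator (((f2, \<beta>2) # G') @ (?d # H)) x k * \<eta> x k
         + ineq_indicator (((f1, \<beta>1) # G') @ (?e # H)) x k * \<eta> x k - ineq_indicator (((f1, \<beta>1) # G') @ (?d # ?e # H)) x k * \<eta> x k"
          unfolding 3 ineq_indicator_append ineq_indicator_Cons append_Cons iff left_diff_distrib by auto
      qed
    next
      case False
      then have opp: "c1 * f1 b + c2 * f2 b = 0" using nz by (auto simp: c1_def c2_def abs_if split: if_splits)
      \<comment> \<open>\<open>?s\<close> says that the lower bound does not exceed the upper one.
        Under it at least one of the two inequalities holds, so inclusion-exclusion expresses their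
        conjunction.\<close>
      let ?s = "(\<lambda>x. c1 * f1 x + c2 * f2 x, c1 * \<beta>1 + c2 * \<beta>2)"
      have s: "?s \<in> rat_ineqs" by (rule rat_ineqs_add R1 R2)+
      have "good (insert b S) (\<lambda>x k. ineq_indicator (((f1, \<beta>1) # G') @ (?s # H)) x k * \<eta> x k
         + ineq_indicator (((f2, \<beta>2) # G') @ (?s # H)) x k * \<eta> x k - ineq_indicator (G' @ (?s # H)) x k * \<eta> x k)"
        using r nz G' less.prems s opp 3
        by (intro good_diff good_add S rec) auto
      then show ?thesis
      proof (rule good_cong)
        fix x k
        show "ineq_indicator (G @ H) x k * \<eta> x k = ineq_indicator (((f1, \<beta>1) # G') @ (?s # H)) x k * \<eta> x k
         + ineq_indicator (((f2, \<beta>2) # G') @ (?s # H)) x k * \<eta> x k - ineq_indicator (G' @ (?s # H)) x k * \<eta> x k"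
          unfolding 3 ineq_indicator_append ineq_indicator_Cons append_Cons iff distrib_right by auto
      qed
    qed
  qed
qed

text \<open>The lattice is the single point 0, and the sum is \<open>\<eta> 0 k * f 0\<close> or
  zero. It is its own expansion, with only the leading coefficient and no error from order 1
  on.\<close>

lemma good_empty:
  assumes H: "set H \<subseteq> rat_ineqs" and \<eta>: "weight_periodic \<eta>"
  shows "good {} (\<lambda>x k. ineq_indicator H x k * \<eta> x k)"
proof -
  \<comment> \<open>At the origin an inequality reads \<open>0 \<le> \<beta> * k\<close>, which does
    not depend on \<open>k \<ge> 1\<close>.\<close>
  define c :: complex where "c = (if \<forall>(f, \<beta>)\<in>set H. 0 \<le> \<beta> then 1 else 0)"
  have indc: "ineq_indicator H 0 (int k) = c" if "k \<ge> 1" for k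
  proof -
    have "(case q of (f, \<beta>) \<Rightarrow> f 0 \<le> \<beta> * of_int (int k)) = (case q of (f, \<beta>) \<Rightarrow> 0 \<le> \<beta>)" if "q \<in> set H" for q
    proof -
      have "linear (fst q)" using that H by (auto simp: rat_ineqs_def)
      then show ?thesis using \<open>k \<ge> 1\<close> by (cases q) (simp add: linear_0 zero_le_mult_iff)
    qed
    then show ?thesis unfolding ineq_indicator_def c_def by (intro if_cong ball_cong refl)
  qed
  have L: "lattice_sum {} (\<lambda>x k. ineq_indicator H x k * \<eta> x k) k f = c * \<eta> 0 (int k) * f 0" if "k \<ge> 1" for k f
    using that by (simp add: lattice_sum_def lat_empty indc)
  have 0: "0 \<in> lat B" by (simp add: lat_def)
  obtain K where K: "\<And>k. norm (\<eta> 0 k) \<le> K" using weight_periodic_bounded[OF \<eta>] 0 by metis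
  have ev: "controlled {} UNIV (\<lambda>i f. c * \<eta> 0 i * f 0)"
  proof (rule controlled_scale)
    show "controlled {} UNIV (\<lambda>i f. f 0)"
      unfolding controlled_def
    proof
      fix R
      show "\<exists>C F. 0 \<le> C \<and> finite F \<and> (\<forall>f\<in>box_supported {} R. \<forall>M. deriv_bound F f M \<longrightarrow> (\<forall>i\<in>UNIV. norm (f 0) \<le> C * M))"
        by (rule exI[of _ 1], rule exI[of _ "{[]}"]) (simp add: deriv_bound_def)
    qed
    show "norm (c * \<eta> 0 i) \<le> norm c * K" for i
      unfolding norm_mult by (intro mult_left_mono K) auto
  qed
  let ?\<theta> = "\<lambda>n. if n = (0::nat) then \<lambda>k (f :: 'a \<Rightarrow> complex). c * \<eta> 0 k * f 0 else (\<lambda>k f. 0)"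
  have "int_periodic (\<eta> 0)"
  proof -
    obtain D where "D > 0" "\<forall>x\<in>lat B. \<forall>y\<in>lat B. \<forall>k l. \<eta> (x + of_int D *\<^sub>R y) (k + D * l) = \<eta> x k"
      using \<eta> unfolding weight_periodic_def by auto
    then show ?thesis unfolding int_periodic_def using 0 by (metis add.right_neutral scaleR_zero_right)
  qed
  then have "int_periodic (\<lambda>k (f :: 'a \<Rightarrow> complex). c * \<eta> 0 k * f 0)" by (rule int_periodic_comp)
  moreover have "lin_functional {} (\<lambda>f. c * \<eta> 0 k * f 0)" for k by (simp add: lin_functional_def algebra_simps)
  ultimately have "coeffs_ok {} ?\<theta>"
    unfolding coeffs_ok_def using ev by (auto simp: int_periodic_const controlled_zero lin_functional_zero)
  moreover have "controlled {} {1..} (remainder 0 N (lattice_sum {} (\<lambda>x k. ineq_indicator H x k * \<eta> x k)) ?\<theta>)" for N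
  proof (cases N)
    case 0
    show ?thesis by (rule controlled_cong[OF controlled_reindex[OF ev, of int]]) (auto simp: 0 remainder_def L)
  next
    case (Suc M)
    show ?thesis
      by (rule controlled_cong[OF controlled_zero])
        (auto simp: Suc remainder_def L sum.lessThan_Suc_shift simp del: sum.lessThan_Suc)
  qed
  ultimately show ?thesis unfolding good_def expands_def by auto
qed

text \<open>Both \<open>H\<close> and \<open>\<eta>\<close> are generalized in the induction, since
  eliminating a coordinate combines inequalities and multiplies the weight by functions of the
  rounding error.\<close>

theorem good_polyhedral:
  assumes "S \<subseteq> B" "set H \<subseteq> rat_ineqs" "weight_periodic \<eta>"
  shows "good S (\<lambda>x k. ineq_indicator H x k * \<eta> x k)"
proof -
  have "finite S" using assms finite_B finite_subset by blast
  then show ?thesis using assms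
  proof (induction S arbitrary: H \<eta> rule: finite_induct)
    case empty
    then show ?case by (intro good_empty)
  next
    case (insert b S)
    let ?G = "filter (\<lambda>(f, \<beta>). f b \<noteq> 0) H" and ?H = "filter (\<lambda>(f, \<beta>). f b = 0) H"
    have "good (insert b S) (\<lambda>x k. ineq_indicator (?G @ ?H) x k * \<eta> x k)"
      by (rule good_insert) (use insert in auto)
    moreover have "ineq_indicator (?G @ ?H) x k = ineq_indicator H x k" for x k
      unfolding ineq_indicator_def by (rule if_cong) auto
    ultimately show ?case by simp
  qed
qed

section \<open>Quasi-polynomial weights\<close>

text \<open>A linear form is bounded on the common support box, and each derivative that hits it
  leaves a constant.\<close>

lemma linear_mult_op:
  assumes l: "linear l"
  shows "controlled_op B B (\<lambda>f x. of_real (l x) * f x)"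
proof -
  have bl: "bounded_linear l" using l by (rule linear_imp_bounded_linear)
  have mem: "(\<lambda>x. of_real (l x) * f x) \<in> box_supported B R" if "f \<in> box_supported B R" for f R
    using that dir_smooth_linear_mult[OF _ bl] by (auto simp: box_supported_def)
  have bound: "\<exists>C F. 0 \<le> C \<and> finite F \<and>
     (\<forall>f\<in>box_supported B R. \<forall>M. deriv_bound F f M \<longrightarrow> (\<forall>x. norm (dds vs (\<lambda>x. of_real (l x) * f x) x) \<le> C * M))" for R vs
  \<comment> \<open>The last entry of the list is differentiated first. Peeling it off turns the
    product into one with \<open>dd v f\<close>, again in the same class, to which the induction
    hypothesis applies.\<close>
  proof (induction vs rule: rev_induct)
    case Nil
    let ?C = "\<bar>R\<bar> * (\<Sum>b\<in>B. \<bar>l b\<bar>)"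
    have "norm (of_real (l x) * f x) \<le> ?C * M" if f: "f \<in> box_supported B R" and M: "deriv_bound {[]} f M" for f M x
    proof (cases "\<exists>b\<in>B. \<bar>crd b x\<bar> > R")
      case True
      then have "f x = 0" using f by (auto intro: box_supported_zero)
      then show ?thesis using M by (simp add: deriv_bound_def sum_nonneg)
    next
      case False
      then have c: "\<bar>crd b x\<bar> \<le> \<bar>R\<bar>" if "b \<in> B" for b using that by force
      have "\<bar>l x\<bar> \<le> (\<Sum>b\<in>B. \<bar>crd b x * l b\<bar>)"
        unfolding linear_crd[OF l, of x] by (rule sum_abs)
      also have "\<dots> \<le> (\<Sum>b\<in>B. \<bar>R\<bar> * \<bar>l b\<bar>)"
        unfolding abs_mult by (intro sum_mono mult_right_mono c) auto
      finally have "\<bar>l x\<bar> \<le> ?C" by (simp add: sum_distrib_left)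
      then have "\<bar>l x\<bar> * norm (f x) \<le> ?C * M"
        using M by (intro mult_mono) (auto simp: deriv_bound_def)
      then show ?thesis by (simp add: norm_mult)
    qed
    then show ?case by (intro exI[of _ ?C] exI[of _ "{[]}"]) (auto simp: sum_nonneg)
  next
    case (snoc v vs)
    then obtain C F where CF: "0 \<le> C" "finite F"
      "\<And>f M x. f \<in> box_supported B R \<Longrightarrow> deriv_bound F f M \<Longrightarrow> norm (dds vs (\<lambda>x. of_real (l x) * f x) x) \<le> C * M" by blast
    have "norm (dds (vs @ [v]) (\<lambda>x. of_real (l x) * f x) x) \<le> (\<bar>l v\<bar> + C) * M"
      if f: "f \<in> box_supported B R" and M: "deriv_bound (insert vs ((\<lambda>us. us @ [v]) ` F)) f M" for f M x
    proof -
      have df: "dd v f \<in> box_supported B R" using box_supported_dds[OF order_refl f, of "[v]"] by simp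
      have "dds (vs @ [v]) (\<lambda>x. of_real (l x) * f x) = dds vs (\<lambda>x. of_real (l v) * f x + of_real (l x) * dd v f x)"
        by (simp add: dds_append[symmetric] dd_linear_mult[OF box_supported_Sm[OF f] bl])
      also have "\<dots> = (\<lambda>x. of_real (l v) * dds vs f x + dds vs (\<lambda>x. of_real (l x) * dd v f x) x)"
        using box_supported_Sm[OF f] box_supported_Sm[OF mem[OF df]] by (simp add: dds_add dds_scale dir_smooth_scale)
      finally have eq: "dds (vs @ [v]) (\<lambda>x. of_real (l x) * f x) x
          = of_real (l v) * dds vs f x + dds vs (\<lambda>x. of_real (l x) * dd v f x) x" by simp
      have "deriv_bound F (dd v f) M"
        using M dds_append[of _ "[v]" f] by (auto simp: deriv_bound_def)
      then have "norm (dds vs (\<lambda>x. of_real (l x) * dd v f x) x) \<le> C * M" by (rule CF(3)[OF df])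
      moreover have "norm (of_real (l v) * dds vs f x) \<le> \<bar>l v\<bar> * M"
        unfolding norm_mult using M by (intro mult_mono) (auto simp: deriv_bound_def)
      ultimately show ?thesis unfolding eq distrib_right by (intro order_trans[OF norm_triangle_ineq] add_mono)
    qed
    then show ?case using CF(1,2)
      by (intro exI[of _ "\<bar>l v\<bar> + C"] exI[of _ "insert vs ((\<lambda>us. us @ [v]) ` F)"]) auto
  qed
  show ?thesis unfolding controlled_op_def using mem bound by (auto simp: algebra_simps)
qed

text \<open>Quantifying over all periodic factors makes the notion stable under multiplication by
  them; the order \<open>d\<close> may depend on the factor.\<close>

definition temperate :: "('a \<Rightarrow> int \<Rightarrow> complex) \<Rightarrow> bool" where
  "temperate w \<longleftrightarrow> (\<forall>\<eta>. weight_periodic \<eta> \<longrightarrow> (\<exists>d. expands B d (lattice_sum B (\<lambda>x k. \<eta> x k * w x k))))"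

text \<open>Quasi-polynomials are closed under products of arbitrary elements, so the induction
  needs a property that composes. Acting on all temperate weights does, whereas an expansion for one
  fixed weight would not.\<close>

definition multiplier :: "('a \<times> real \<Rightarrow> complex) \<Rightarrow> bool" where
  "multiplier q \<longleftrightarrow> (\<forall>w. temperate w \<longrightarrow> temperate (\<lambda>x k. q (x, of_int k) * w x k))"

lemma expands_LS_add:
  assumes "\<exists>d. expands B d (lattice_sum B w)" "\<exists>d. expands B d (lattice_sum B w')"
  shows "\<exists>d. expands B d (lattice_sum B (\<lambda>x k. w x k + w' x k))"
proof -
  obtain d d' where "expands B d (lattice_sum B w)" "expands B d' (lattice_sum B w')" using assms by auto
  then have "expands B (max d d') (lattice_sum B w)" "expands B (max d d') (lattice_sum B w')"
    by (auto intro: expands_mono[rotated])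
  then have "expands B (max d d') (lattice_sum B (\<lambda>x k. w x k + w' x k))"
    by (rule expands_cong[OF expands_add]) (rule lattice_sum_add[OF order_refl])
  then show ?thesis by blast
qed

lemma multiplier_add: "multiplier p \<Longrightarrow> multiplier q \<Longrightarrow> multiplier (\<lambda>z. p z + q z)"
  unfolding multiplier_def temperate_def distrib_right distrib_left using expands_LS_add by blast

lemma multiplier_mult: "multiplier p \<Longrightarrow> multiplier q \<Longrightarrow> multiplier (\<lambda>z. p z * q z)"
  unfolding multiplier_def by (simp add: mult.assoc)

lemma multiplier_lper:
  assumes "weight_periodic (\<lambda>x k. q (x, of_int k))" shows "multiplier q"
  unfolding multiplier_def temperate_def
proof (intro allI impI)
  fix w \<eta> assume w: "\<forall>\<eta>. weight_periodic \<eta> \<longrightarrow> (\<exists>d. expands B d (lattice_sum B (\<lambda>x k. \<eta> x k * w x k)))" and \<eta>: "weight_periodic \<eta>"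
  from w[rule_format, OF weight_periodic_mult[OF \<eta> assms]]
  show "\<exists>d. expands B d (lattice_sum B (\<lambda>x k. \<eta> x k * (q (x, of_int k) * w x k)))"
    by (simp only: mult.assoc)
qed

text \<open>A linear form at \<open>(x, k)\<close> is \<open>k\<close> times its value at
  \<open>(x / k, 1)\<close>. Its part in \<open>x\<close> is absorbed into the test function, its
  part in \<open>k\<close> is a constant, and the factor \<open>k\<close> raises the order by
  one.\<close>

lemma multiplier_linear:
  assumes l: "bounded_linear l" shows "multiplier (\<lambda>z. of_real (l z))"
  unfolding multiplier_def temperate_def
proof (intro allI impI)
  fix w \<eta> assume "\<forall>\<eta>. weight_periodic \<eta> \<longrightarrow> (\<exists>d. expands B d (lattice_sum B (\<lambda>x k. \<eta> x k * w x k)))" and "weight_periodic \<eta>"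
  then obtain d where d: "expands B d (lattice_sum B (\<lambda>x k. \<eta> x k * w x k))" by blast
  interpret l: bounded_linear l by fact
  define l1 where "l1 x = l (x, 0)" for x :: 'a
  define c where "c = l (0, 1)"
  have lin_functional: "linear l1"
  proof (rule linearI)
    show "l1 (x + y) = l1 x + l1 y" for x y
      using l.add[of "(x, 0)" "(y, 0)"] by (simp add: l1_def)
    show "l1 (r *\<^sub>R x) = r *\<^sub>R l1 x" for r x
      using l.scaleR[of r "(x, 0)"] by (simp add: l1_def)
  qed
  have split: "l (x, t) = l1 x + t * c" for x t
    using l.add[of "(x, 0)" "(0, t)"] l.scaleR[of t "(0, 1)"] by (simp add: l1_def c_def)
  have e: "expands B (Suc d) (\<lambda>k f. of_nat k * lattice_sum B (\<lambda>x k. \<eta> x k * w x k) k (\<lambda>x. of_real (l1 x) * f x)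
        + of_real c * (of_nat k * lattice_sum B (\<lambda>x k. \<eta> x k * w x k) k f))"
    by (intro expands_add expands_scale expands_times_k d expands_comp[OF linear_mult_op[OF lin_functional] d])
  have "expands B (Suc d) (lattice_sum B (\<lambda>x k. \<eta> x k * (of_real (l (x, of_int k)) * w x k)))"
  proof (rule expands_cong[OF e])
    fix R :: real and k :: nat and f assume k: "k \<ge> 1" and f: "f \<in> box_supported B R"
    have f': "(\<lambda>x. of_real (l1 x) * f x) \<in> box_supported B R"
      using f dir_smooth_linear_mult[OF box_supported_Sm[OF f] linear_imp_bounded_linear[OF lin_functional]] by (auto simp: box_supported_def)
    show "lattice_sum B (\<lambda>x k. \<eta> x k * (of_real (l (x, of_int k)) * w x k)) k f
        = of_nat k * lattice_sum B (\<lambda>x k. \<eta> x k * w x k) k (\<lambda>x. of_real (l1 x) * f x)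
        + of_real c * (of_nat k * lattice_sum B (\<lambda>x k. \<eta> x k * w x k) k f)"
      unfolding lattice_sum_box[OF order_refl f k order_refl] lattice_sum_box[OF order_refl f' k order_refl]
        sum_distrib_left sum.distrib[symmetric]
      using k by (intro sum.cong refl) (simp add: split linear_cmul[OF lin_functional] field_simps)
  qed
  then show "\<exists>d. expands B d (lattice_sum B (\<lambda>x k. \<eta> x k * (of_real (l (x, of_int k)) * w x k)))" by blast
qed

lemma multiplier_const: "multiplier (\<lambda>z. c)"
  by (rule multiplier_lper) (rule weight_periodic_const)

lemma multiplier_real_polynomial: "real_polynomial_function p \<Longrightarrow> multiplier (\<lambda>z. of_real (p z))"
  by (induction p rule: real_polynomial_function.induct)
    (simp_all add: multiplier_linear multiplier_const multiplier_add multiplier_mult)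

lemma multiplier_polynomial:
  assumes "polynomial_function p" shows "multiplier p"
proof -
  have "real_polynomial_function (\<lambda>z. Re (p z))" "real_polynomial_function (\<lambda>z. Im (p z))"
    using assms bounded_linear_Re bounded_linear_Im unfolding polynomial_function_def
    by (auto simp: o_def)
  then have "multiplier (\<lambda>z. of_real (Re (p z)) + \<i> * of_real (Im (p z)))"
    by (intro multiplier_add multiplier_mult multiplier_const multiplier_real_polynomial)
  then show ?thesis by (simp add: complex_eq[symmetric])
qed

lemma multiplier_quasi_polynomial:
  assumes "q \<in> quasi_polynomials (lat B \<times> \<int>)" shows "multiplier q"
  using assms
proof induction
  case (periodic f)
  then obtain D :: nat where D: "D > 0"
    "\<And>x y. x \<in> lat B \<times> \<int> \<Longrightarrow> y \<in> lat B \<times> \<int> \<Longrightarrow> f (x + of_nat D *\<^sub>R y) = f x"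
    unfolding lattice_periodic_def by auto
  have "weight_periodic (\<lambda>x k. f (x, of_int k))"
    unfolding weight_periodic_def
  proof (intro exI[of _ "int D"] conjI ballI allI)
    fix x y k l assume "x \<in> lat B" "y \<in> lat B"
    then show "f (x + of_int (int D) *\<^sub>R y, of_int (k + int D * l)) = f (x, of_int k)"
      using D(2)[of "(x, of_int k)" "(y, of_int l)"] by simp
  qed (use D in simp)
  then show ?case by (rule multiplier_lper)
qed (auto intro: multiplier_polynomial multiplier_add multiplier_mult)

section \<open>Cone functions and their linear span\<close>

lemma cone_over_iff: "t > 0 \<Longrightarrow> (x, t) \<in> cone_over P \<longleftrightarrow> x /\<^sub>R t \<in> P"
proof
  assume t: "t > 0" and x: "x /\<^sub>R t \<in> P"
  have "(x, t) = (t *\<^sub>R (x /\<^sub>R t), t)" using t by simp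
  then show "(x, t) \<in> cone_over P"
    unfolding cone_over_def using t x
    by (intro CollectI exI[of _ t] exI[of _ "x /\<^sub>R t"]) auto
qed (auto simp: cone_over_def)

text \<open>For \<open>k \<ge> 1\<close> membership in the cone is a list of homogenized
  inequalities. Their indicator is temperate by \<open>good_polyhedral\<close>, \<open>q\<close>
  acts on it as a multiplier, and the periodic factor is finally taken to be 1.\<close>

lemma expands_cone_function:
  assumes P: "rational_polyhedron (lat B) P" and q: "q \<in> quasi_polynomials (lat B \<times> \<int>)"
  shows "\<exists>d. expands B d (lattice_sum B (\<lambda>x k. cone_function (lat B) P q (x, of_int k)))"
proof -
  from P[unfolded rational_polyhedron_def] obtain H' :: "(('a \<Rightarrow> real) \<times> real) set" where
    H0: "finite H' \<and> (\<forall>(f, b)\<in>H'. linear f \<and> f ` lat B \<subseteq> \<rat> \<and> b \<in> \<rat>) \<and> P = {x. \<forall>(f, b)\<in>H'. f x \<le> b}" ..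
  then have H'2: "H' \<subseteq> rat_ineqs" unfolding rat_ineqs_def by blast
  from H0 have H'1: "finite H'" and H'3: "P = {x. \<forall>(f, b)\<in>H'. f x \<le> b}" by simp_all
  note H' = H'1 H'2 H'3
  obtain H where H: "set H = H'" using finite_list[OF H'(1)] by blast
  have "temperate (ineq_indicator H)"
    unfolding temperate_def
  proof (intro allI impI)
    fix \<eta> assume "weight_periodic \<eta>"
    then have "good B (\<lambda>x k. ineq_indicator H x k * \<eta> x k)"
      using good_polyhedral[of B H] H H' by auto
    then show "\<exists>d. expands B d (lattice_sum B (\<lambda>x k. \<eta> x k * ineq_indicator H x k))"
      unfolding good_def by (auto simp: mult.commute)
  qed
  then have "temperate (\<lambda>x k. q (x, of_int k) * ineq_indicator H x k)"
    using multiplier_quasi_polynomial[OF q] unfolding multiplier_def by blast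
  then obtain d where d: "expands B d (lattice_sum B (\<lambda>x k. 1 * (q (x, of_int k) * ineq_indicator H x k)))"
    using weight_periodic_const unfolding temperate_def by blast
  have "cone_function (lat B) P q (x, of_int (int k)) = 1 * (q (x, of_int (int k)) * ineq_indicator H x (int k))"
    if "x \<in> lat B" "k \<ge> 1" for x k
  proof -
    have "(case h of (f, b) \<Rightarrow> f (x /\<^sub>R real k) \<le> b) = (case h of (f, b) \<Rightarrow> f x \<le> b * of_int (int k))"
      if "h \<in> set H" for h
    proof -
      have "linear (fst h)" using that H H'(2) by (auto simp: rat_ineqs_def)
      then show ?thesis using \<open>k \<ge> 1\<close> by (cases h) (simp add: linear_cmul field_simps)
    qed
    then have "x /\<^sub>R real k \<in> P \<longleftrightarrow> (\<forall>(f, b)\<in>set H. f x \<le> b * of_int (int k))"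
      unfolding H'(3) H[symmetric] by auto
    then show ?thesis using that by (simp add: cone_function_def cone_over_iff ineq_indicator_def)
  qed
  then have "expands B d (lattice_sum B (\<lambda>x k. cone_function (lat B) P q (x, of_int k)))"
    by (intro expands_cong[OF d]) (simp add: lattice_sum_def cong: infsum_cong)
  then show ?thesis by blast
qed

lemma expands_S_space:
  assumes "m \<in> S_space (lat B)"
  shows "\<exists>d. expands B d (lattice_sum B (\<lambda>x k. m (x, of_int k)))"
  using assms
proof induction
  case (gen P q)
  then show ?case by (rule expands_cone_function)
next
  case (add f g)
  show ?case using expands_LS_add[OF add.IH] by simp
next
  case (scale f c)
  then obtain d where "expands B d (lattice_sum B (\<lambda>x k. f (x, of_int k)))" by blast
  then have "expands B d (lattice_sum B (\<lambda>x k. c * f (x, of_int k)))"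
    by (rule expands_cong[OF expands_scale]) (rule lattice_sum_scale[OF order_refl])
  then show ?case by blast
qed

section \<open>Test functions and distributions\<close>

lemma dd_frechet:
  fixes f :: "'a \<Rightarrow> complex"
  assumes "\<And>x. f differentiable at x" shows "dd v f = (\<lambda>x. frechet_derivative f (at x) v)"
    and "((\<lambda>t. f (x + t *\<^sub>R v)) has_vector_derivative frechet_derivative f (at x) v) (at 0)"
proof -
  have *: "((\<lambda>t. f (x + t *\<^sub>R v)) has_vector_derivative frechet_derivative f (at x) v) (at 0)" for x :: 'a
  proof -
    have f': "(f has_derivative frechet_derivative f (at x)) (at (x + 0 *\<^sub>R v))"
      using assms frechet_derivative_works by auto
    have "((\<lambda>t. x + t *\<^sub>R v) has_derivative (\<lambda>t. t *\<^sub>R v)) (at 0)"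
      by (auto intro!: derivative_eq_intros)
    from diff_chain_at[OF this f']
    have "((\<lambda>t. f (x + t *\<^sub>R v)) has_derivative (\<lambda>t. frechet_derivative f (at x) (t *\<^sub>R v))) (at 0)"
      by (simp add: o_def)
    then show ?thesis
      unfolding has_vector_derivative_def
      using linear_cmul[OF has_derivative_linear[OF f']] by simp
  qed
  show "((\<lambda>t. f (x + t *\<^sub>R v)) has_vector_derivative frechet_derivative f (at x) v) (at 0)" by (rule *)
  show "dd v f = (\<lambda>x. frechet_derivative f (at x) v)" by (rule dd_eqI) (rule *)
qed

lemma smooth_dd:
  fixes f :: "'a \<Rightarrow> complex"
  assumes "smooth f"
  shows "f differentiable at x" "smooth (\<lambda>x. frechet_derivative f (at x) v)"
  using assms unfolding smooth_def by (metis C_k.simps(2))+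

lemma smooth_Sm:
  fixes f :: "'a \<Rightarrow> complex"
  assumes "smooth f" shows "dir_smooth f"
proof (rule dir_smooth_coinduct[where A = "Collect smooth"])
  show "continuous_on UNIV f" if "f \<in> Collect smooth" for f :: "'a \<Rightarrow> complex"
    using that unfolding smooth_def by (metis C_k.simps(1) mem_Collect_eq)
  show "\<exists>g\<in>Collect smooth. \<forall>x. ((\<lambda>t. f (x + t *\<^sub>R v)) has_vector_derivative g x) (at 0)"
    if "f \<in> Collect smooth" for f :: "'a \<Rightarrow> complex" and v :: 'a
    using that by (intro bexI[of _ "\<lambda>x. frechet_derivative f (at x) v"] allI dd_frechet smooth_dd CollectI) auto
qed (use assms in simp)

lemma dds_dir_derivs:
  fixes f :: "'a \<Rightarrow> complex"
  assumes "smooth f" shows "dds vs f = dir_derivs vs f"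
proof -
  have "dds vs f = dir_derivs vs f \<and> smooth (dir_derivs vs f)"
    using assms by (induction vs) (auto simp: dd_frechet(1) smooth_dd)
  then show ?thesis by simp
qed

lemma compact_coordinates:
  assumes "compact K" obtains R where "\<And>x b. x \<in> K \<Longrightarrow> b \<in> B \<Longrightarrow> \<bar>crd b x\<bar> \<le> R"
proof -
  obtain a where a: "\<And>x. x \<in> K \<Longrightarrow> norm x \<le> a"
    using compact_imp_bounded[OF assms] by (auto simp: bounded_iff)
  obtain C where C: "\<And>b x. b \<in> B \<Longrightarrow> \<bar>crd b x\<bar> \<le> C * norm x" using crd_bounded by blast
  have "\<bar>crd b x\<bar> \<le> \<bar>C\<bar> * a" if "x \<in> K" "b \<in> B" for x b
  proof -
    have "\<bar>crd b x\<bar> \<le> \<bar>C\<bar> * norm x" using C[OF that(2), of x] by (meson abs_ge_self mult_right_mono norm_ge_zero order_trans)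
    also have "\<dots> \<le> \<bar>C\<bar> * a" using a[OF that(1)] by (intro mult_left_mono) auto
    finally show ?thesis .
  qed
  then show thesis by (rule that)
qed

lemma test_function_X:
  assumes "\<phi> \<in> test_functions" "\<And>x b. x \<in> supp \<phi> \<Longrightarrow> b \<in> B \<Longrightarrow> \<bar>crd b x\<bar> \<le> R"
  shows "\<phi> \<in> box_supported B R"
proof -
  have "\<phi> x = 0" if "b \<in> B" "\<bar>crd b x\<bar> > R" for b x
  proof (rule ccontr)
    assume "\<phi> x \<noteq> 0"
    then have "x \<in> supp \<phi>" using closure_subset[of "{x. \<phi> x \<noteq> 0}"] by (auto simp: supp_def)
    then show False using assms(2)[OF _ that(1)] that(2) by force
  qed
  then show ?thesis using assms(1) by (auto simp: box_supported_def test_functions_def smooth_Sm)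
qed

lemma test_function_exists_X:
  assumes "\<phi> \<in> test_functions" obtains R where "\<phi> \<in> box_supported B R"
proof -
  have "compact (supp \<phi>)" using assms by (simp add: test_functions_def)
  from compact_coordinates[OF this] obtain R where "\<And>x b. x \<in> supp \<phi> \<Longrightarrow> b \<in> B \<Longrightarrow> \<bar>crd b x\<bar> \<le> R" by blast
  with assms show thesis by (intro that test_function_X)
qed

text \<open>This makes the \<open>SUP\<close> in \<open>distribution\<close> a genuine supremum,
  hence an upper bound for the derivative at each point.\<close>

lemma test_function_bdd_above:
  fixes \<phi> :: "'a \<Rightarrow> complex"
  assumes "\<phi> \<in> test_functions"
  shows "bdd_above (range (\<lambda>x. norm (dds vs \<phi> x)))"
proof -
  have c: "compact (supp \<phi>)" and s: "dir_smooth \<phi>" using assms by (auto simp: test_functions_def smooth_Sm)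
  have "compact (dds vs \<phi> ` supp \<phi>)"
    by (rule compact_continuous_image[OF _ c]) (rule continuous_on_subset[OF dir_smooth_continuous[OF dir_smooth_dds[OF s]]], simp)
  from compact_imp_bounded[OF this] obtain a where a: "\<And>x. x \<in> supp \<phi> \<Longrightarrow> norm (dds vs \<phi> x) \<le> a"
    by (auto simp: bounded_iff)
  have "dds vs \<phi> x = 0" if "x \<notin> supp \<phi>" for x
  proof (rule dds_vanish[where U = "- supp \<phi>"])
    show "\<phi> y = 0" if "y \<in> - supp \<phi>" for y
      using that closure_subset[of "{x. \<phi> x \<noteq> 0}"] by (auto simp: supp_def)
  qed (use that in \<open>auto simp: supp_def\<close>)
  then have "norm (dds vs \<phi> x) \<le> max a 0" for x using a[of x] by (cases "x \<in> supp \<phi>") auto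
  then show ?thesis by (intro bdd_aboveI2)
qed

lemma test_function_bnd:
  fixes \<phi> :: "'a \<Rightarrow> complex"
  assumes "\<phi> \<in> test_functions" "finite F"
  shows "deriv_bound F \<phi> (\<Sum>vs\<in>F. SUP x. norm (dir_derivs vs \<phi> x))"
proof -
  have sm: "smooth \<phi>" using assms by (simp add: test_functions_def)
  have le: "norm (dds vs \<phi> x) \<le> (SUP x. norm (dir_derivs vs \<phi> x))" for vs x
    unfolding dds_dir_derivs[OF sm, symmetric]
    by (rule cSUP_upper[OF UNIV_I test_function_bdd_above[OF assms(1)]])
  have nn: "0 \<le> (SUP x. norm (dir_derivs vs \<phi> x))" for vs
    using order_trans[OF norm_ge_zero le] .
  show ?thesis unfolding deriv_bound_def
  proof (intro conjI ballI allI sum_nonneg nn)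
    fix vs x assume "vs \<in> F"
    then have "(SUP x. norm (dir_derivs vs \<phi> x)) \<le> (\<Sum>vs\<in>F. SUP x. norm (dir_derivs vs \<phi> x))"
      using nn assms(2) by (intro member_le_sum) auto
    then show "norm (dds vs \<phi> x) \<le> (\<Sum>vs\<in>F. SUP x. norm (dir_derivs vs \<phi> x))" using le order_trans by blast
  qed
qed

text \<open>A compact set lies in a coordinate box, which fixes \<open>R\<close>; the sum of the
  finitely many seminorms then serves as the bound \<open>M\<close>. The index set only has to
  supply some index.\<close>

lemma distribution_if_controlled:
  assumes controlled: "controlled B I (\<lambda>i. T)" and "I \<noteq> {}" and lin_functional: "lin_functional B T"
  shows "distribution T"
  unfolding distribution_def
proof (intro conjI ballI allI impI)
  fix \<phi> assume \<phi>: "\<phi> \<in> (test_functions :: ('a \<Rightarrow> complex) set)"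
  obtain R where R: "\<phi> \<in> box_supported B R" using test_function_exists_X[OF \<phi>] .
  show "T (\<lambda>x. c * \<phi> x) = c * T \<phi>" for c by (rule lin_functional_scaleD[OF lin_functional R])
  fix \<psi> assume \<psi>: "\<psi> \<in> (test_functions :: ('a \<Rightarrow> complex) set)"
  obtain R' where R': "\<psi> \<in> box_supported B R'" using test_function_exists_X[OF \<psi>] .
  have "\<phi> \<in> box_supported B (max R R')" "\<psi> \<in> box_supported B (max R R')"
    using subsetD[OF box_supported_antimono[OF order_refl max.cobounded1] R]
      subsetD[OF box_supported_antimono[OF order_refl max.cobounded2] R'] by auto
  then show "T (\<lambda>x. \<phi> x + \<psi> x) = T \<phi> + T \<psi>" by (rule lin_functional_addD[OF lin_functional])
next
  fix K :: "'a set" assume "compact K"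
  then obtain R where R: "\<And>x b. x \<in> K \<Longrightarrow> b \<in> B \<Longrightarrow> \<bar>crd b x\<bar> \<le> R" using compact_coordinates by blast
  obtain C F where CF: "0 \<le> C" "finite F" "\<And>f M i. f \<in> box_supported B R \<Longrightarrow> deriv_bound F f M \<Longrightarrow> i \<in> I \<Longrightarrow> norm (T f) \<le> C * M"
    using controlled unfolding controlled_def by metis
  have "norm (T \<phi>) \<le> C * (\<Sum>vs\<in>F. SUP x. norm (dir_derivs vs \<phi> x))"
    if "\<phi> \<in> test_functions" "supp \<phi> \<subseteq> K" for \<phi>
    using \<open>I \<noteq> {}\<close> that R
    by (auto intro!: CF(3) test_function_X test_function_bnd CF(2))
  then show "\<exists>C F. finite F \<and> (\<forall>\<phi>\<in>test_functions. supp \<phi> \<subseteq> K \<longrightarrow>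
      norm (T \<phi>) \<le> C * (\<Sum>vs\<in>F. SUP x. norm (dir_derivs vs \<phi> x)))"
    using CF(2) by blast
qed

text \<open>For fixed \<open>k\<close> the sum is a finite combination of point evaluations on each
  box, so the sup norm alone dominates it.\<close>

lemma distribution_LS:
  assumes k: "k \<ge> 1" shows "distribution (lattice_sum B w k)"
proof (rule distribution_if_controlled[where I = "{()}"])
  show "lin_functional B (lattice_sum B w k)"
    unfolding lin_functional_def
    using lattice_sum_box[OF order_refl box_supported_add k order_refl] lattice_sum_box[OF order_refl box_supported_scale k order_refl]
      lattice_sum_box[OF order_refl _ k order_refl]
    by (auto simp: sum_distrib_left distrib_left sum.distrib mult_ac)
  show "controlled B {()} (\<lambda>i. lattice_sum B w k)"
    unfolding controlled_def
  proof
    fix R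
    let ?C = "\<Sum>x\<in>box B (R * real k). norm (w x (int k))"
    have "norm (lattice_sum B w k f) \<le> ?C * M" if "f \<in> box_supported B R" "deriv_bound {[]} f M" for f M
    proof -
      have "norm (lattice_sum B w k f) \<le> (\<Sum>x\<in>box B (R * real k). norm (w x (int k)) * M)"
        unfolding lattice_sum_box[OF order_refl that(1) k order_refl]
        using that(2) by (intro sum_norm_le) (auto simp: norm_mult deriv_bound_def intro!: mult_left_mono)
      then show ?thesis by (simp add: sum_distrib_right)
    qed
    then show "\<exists>C F. 0 \<le> C \<and> finite F \<and>
      (\<forall>f\<in>box_supported B R. \<forall>M. deriv_bound F f M \<longrightarrow> (\<forall>i\<in>{()}. norm (lattice_sum B w k f) \<le> C * M))"
      by (intro exI[of _ ?C] exI[of _ "{[]}"]) (auto intro: sum_nonneg)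
  qed
qed simp

section \<open>From uniform remainders to the asymptotic expansion\<close>

lemma expands_imp_asymptotic_expansion:
  assumes "expands B d A" shows "admits_asymptotic_expansion A"
proof -
  obtain \<theta> where ok: "coeffs_ok B \<theta>" and rem: "\<And>N. controlled B {1..} (remainder d N A \<theta>)"
    using assms unfolding expands_def by blast
  show ?thesis unfolding admits_asymptotic_expansion_def
  proof (intro exI[of _ "int d"] exI[of _ \<theta>] conjI allI ballI)
    fix n
    show "distribution (\<theta> n k)" for k
    proof (rule distribution_if_controlled[where I = "{k}"])
      have "controlled B {k} (\<theta> n)" using ok unfolding coeffs_ok_def controlled_def by (meson UNIV_I)
      then show "controlled B {k} (\<lambda>i. \<theta> n k)" by (rule controlled_cong) simp
      show "lin_functional B (\<theta> n k)" using ok by (simp add: coeffs_ok_def)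
    qed simp
    have "int_periodic (\<theta> n)" using ok by (simp add: coeffs_ok_def)
    then show "periodic_family (\<theta> n)" unfolding int_periodic_def periodic_family_def by metis
  next
    fix \<phi> N assume \<phi>: "\<phi> \<in> (test_functions :: ('a \<Rightarrow> complex) set)"
    obtain R where R: "\<phi> \<in> box_supported B R" using test_function_exists_X[OF \<phi>] .
    obtain C F where CF: "0 \<le> C" "finite F"
      "\<And>f M k. f \<in> box_supported B R \<Longrightarrow> deriv_bound F f M \<Longrightarrow> k \<in> {1..} \<Longrightarrow> norm (remainder d (Suc N) A \<theta> k f) \<le> C * M"
      \<comment> \<open>The expansion is used one order further than asked: the terms up to
        \<open>n = N\<close> leave an error O(k^(d - N - 1)), which is o(k^(d - N)).\<close>
      using rem[of "Suc N"] unfolding controlled_def by metis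
    obtain M where "deriv_bound F \<phi> M" using test_function_bnd[OF \<phi> CF(2)] by blast
    with CF(3)[OF R] have bd: "norm (remainder d (Suc N) A \<theta> k \<phi>) \<le> C * M" if "k \<ge> 1" for k
      using that by simp
    let ?r = "\<lambda>k. A k \<phi> - of_nat k powi int d * (\<Sum>n\<le>N. 1 / of_nat k ^ n * \<theta> n (int k) \<phi>)"
    show "?r \<in> o[sequentially](\<lambda>k. of_nat k powi (int d - int N))"
    proof (rule landau_o.smallI)
      fix c :: real assume c: "c > 0"
      have "\<forall>\<^sub>F k in sequentially. real k \<ge> C * M / c"
        using filterlim_real_sequentially by (simp add: filterlim_at_top)
      then show "\<forall>\<^sub>F k in sequentially. norm (?r k) \<le> c * norm (of_nat k powi (int d - int N) :: complex)"
        using eventually_ge_at_top[of "1::nat"]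
      proof eventually_elim
        case (elim k)
        then have k: "real k > 0" "of_nat k \<noteq> (0::complex)" by auto
        have "?r k = of_real (real k ^ d / real k ^ Suc N) * remainder d (Suc N) A \<theta> k \<phi>"
          unfolding remainder_def right_diff_distrib sum_distrib_left lessThan_Suc_atMost using k
          by (intro arg_cong2[where f = "(-)"] sum.cong refl) (auto simp: power_diff)
        then have "norm (?r k) \<le> real k ^ d / real k ^ Suc N * (C * M)"
          using bd[of k] elim(2) by (simp add: norm_mult norm_divide norm_power mult_left_mono divide_right_mono)
        also have "\<dots> = real k ^ d / real k ^ N * (C * M / real k)" by simp
        also have "\<dots> \<le> real k ^ d / real k ^ N * c"
          using elim(1) c k(1) by (intro mult_left_mono) (auto simp: field_simps)
        also have "real k ^ d / real k ^ N = norm (of_nat k powi (int d - int N) :: complex)"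
          using k by (simp add: power_int_diff norm_divide norm_power)
        finally show ?case by (simp add: mult.commute)
      qed
    qed
  qed
qed

end

theorem proposition1p7:
  fixes \<Lambda> :: "'a::real_normed_vector set" and m :: "'a \<times> real \<Rightarrow> complex"
  assumes "full_lattice \<Lambda>" and "m \<in> S_space \<Lambda>"
  shows "(\<forall>k\<ge>1. distribution (Theta \<Lambda> m k)) \<and> admits_asymptotic_expansion (Theta \<Lambda> m)"
proof -
  obtain B where B: "finite B" "independent B" "span B = UNIV"
    "\<Lambda> = {\<Sum>b\<in>B. of_int (c b) *\<^sub>R b | c :: 'a \<Rightarrow> int. True}"
    using assms(1) unfolding full_lattice_def by blast
  interpret lattice_basis B by unfold_locales (use B in auto)
  have L: "\<Lambda> = lat B" unfolding lat_B B(4) ..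
  have Theta: "Theta \<Lambda> m = lattice_sum B (\<lambda>x k. m (x, of_int k))"
    by (intro ext) (simp add: Theta_def lattice_sum_def L)
  have "m \<in> S_space (lat B)" using assms(2) L by simp
  then obtain d where "expands B d (lattice_sum B (\<lambda>x k. m (x, of_int k)))"
    using expands_S_space by blast
  then show ?thesis
    using expands_imp_asymptotic_expansion distribution_LS unfolding Theta by blast
qed

end
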